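(* Let $\mathcal{F} = \{F_1,\ldots,F_m\}$ be a hypergraph on a finite vertex set $V$. Algorithm RS (described in the context), started at $S = \emptyset$, outputs all minimal hitting sets of $\mathcal{F}$, in $O(\|\mathcal{F}\| \times |\mathcal{S}|)$ time and $O(\|\mathcal{F}\|)$ space.
   Context: A hypergraph is a finite family of subsets (hyperedges) of $V$, here indexed $F_1,\ldots,F_m$; $\|\mathcal{F}\| = \sum_{F \in \mathcal{F}} |F|$. A minimal hitting set of a hypergraph is an inclusion-minimal $H \subseteq V$ meeting every hyperedge; $dual(\mathcal{G})$ denotes the set of minimal hitting sets of $\mathcal{G}$. $\mathcal{F}_i = \{F_1,\ldots,F_i\}$ and $\mathcal{S} = \bigcup_{i=1}^m dual(\mathcal{F}_i)$. For $u \in V$, $\mathcal{F}(u) = \{F \in \mathcal{F} : u \in F\}$. For $S\subseteq V$: $uncov(S) = \{F \in \mathcal{F}: F\cap S = \emptyset\}$; for $v\in S$, $crit(v,S) = \{F\in\mathcal{F} : S\cap F = \{v\}\}$. Algorithm RS maintains, as global lists, $uncov = uncov(S)$ and $crit[u] = crit(u,S)$ for $u\in S$. RS$(S)$: (1) if $uncov = \emptyset$, output $S$ and return; (2) let $i = \min\{j : F_j \in uncov\}$; (3) for each $v \in F_i$: update the lists to those of $S \cup \{v\}$ by processing each $F \in \mathcal{F}(v)$ (remove $F$ from $crit[u]$ if $F \in crit[u]$ for some $u \in S$; if $F \in uncov$, remove it from $uncov$ and add it to $crit[v]$); if $\min\{t : F_t \in crit[f]\} < i$ for every $f \in S$, call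 RS$(S \cup \{v\})$; then undo the update.
   Formalization: The literal bounds are claimed for nonempty families of nonempty hyperedges (for F={∅} both bounds would be 0); for all inputs they hold with ‖F‖+m+1 and |S|+1 in place of ‖F‖ and |S|. Vertices are encoded as natural numbers, and the output is not counted as space. *)

theory Defs
  imports Main
begin

section \<open>Hypergraphs\<close>

text \<open>A hypergraph with hyperedges $F_1,\dots,F_m$ is a list of sets; repetitions are allowed.
  Hyperedges are identified with their indices $1,\dots,m$.\<close>

definition hypergraph :: "'v set \<Rightarrow> 'v set list \<Rightarrow> bool" where
  "hypergraph V Fs \<longleftrightarrow> finite V \<and> (\<forall>F\<in>set Fs. F \<subseteq> V)"

definition edge :: "'v set list \<Rightarrow> nat \<Rightarrow> 'v set" where
  "edge Fs j = Fs ! (j - 1)"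

definition total_size :: "'v set list \<Rightarrow> nat" where
  "total_size Fs = (\<Sum>F\<leftarrow>Fs. card F)"

definition hitting_set :: "'v set list \<Rightarrow> 'v set \<Rightarrow> bool" where
  "hitting_set Fs H \<longleftrightarrow> (\<forall>F\<in>set Fs. F \<inter> H \<noteq> {})"

definition dual :: "'v set \<Rightarrow> 'v set list \<Rightarrow> 'v set set" where
  "dual V Fs = {H. H \<subseteq> V \<and> hitting_set Fs H \<and> (\<forall>H'. H' \<subset> H \<longrightarrow> \<not> hitting_set Fs H')}"

definition prefix_duals :: "'v set \<Rightarrow> 'v set list \<Rightarrow> 'v set set" where
  "prefix_duals V Fs = (\<Union>i\<in>{1..length Fs}. dual V (take i Fs))"

definition uncov :: "'v set list \<Rightarrow> 'v set \<Rightarrow> nat set" where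
  "uncov Fs S = {j \<in> {1..length Fs}. edge Fs j \<inter> S = {}}"

definition crit :: "'v set list \<Rightarrow> 'v \<Rightarrow> 'v set \<Rightarrow> nat set" where
  "crit Fs v S = {j \<in> {1..length Fs}. S \<inter> edge Fs j = {v}}"


section \<open>Algorithm RS\<close>

text \<open>\<open>RS Fs S outs\<close>: the call RS($S$) may output the sequence \<open>outs\<close>.  The order in which a
  hyperedge is traversed is left open.  The minimum of the empty set counts as infinite.\<close>

inductive RS :: "'v set list \<Rightarrow> 'v set \<Rightarrow> 'v set list \<Rightarrow> bool"
  and RS_for :: "'v set list \<Rightarrow> 'v set \<Rightarrow> nat \<Rightarrow> 'v list \<Rightarrow> 'v set list \<Rightarrow> bool"
  for Fs :: "'v set list"
where
  RS_output: "uncov Fs S = {} \<Longrightarrow> RS Fs S [S]"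
| RS_branch: "\<lbrakk> uncov Fs S \<noteq> {}; i = Min (uncov Fs S); distinct vs; set vs = edge Fs i;
     RS_for Fs S i vs outs \<rbrakk> \<Longrightarrow> RS Fs S outs"
| RS_for_Nil: "RS_for Fs S i [] []"
| RS_for_call: "\<lbrakk> \<forall>f\<in>S. crit Fs f (insert v S) \<noteq> {} \<and> Min (crit Fs f (insert v S)) < i;
     RS Fs (insert v S) outs; RS_for Fs S i vs outs' \<rbrakk> \<Longrightarrow> RS_for Fs S i (v # vs) (outs @ outs')"
| RS_for_skip: "\<lbrakk> \<not> (\<forall>f\<in>S. crit Fs f (insert v S) \<noteq> {} \<and> Min (crit Fs f (insert v S)) < i);
     RS_for Fs S i vs outs \<rbrakk> \<Longrightarrow> RS_for Fs S i (v # vs) outs"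


section \<open>A random access machine\<close>

text \<open>The memory consists of named arrays of natural numbers.  The only arithmetic is successor
  and predecessor, so words stay small.  There are no variables outside the memory; a single
  parameterless procedure may call itself recursively.\<close>

type_synonym 'a cell = "'a \<times> nat"

datatype 'a aexp =
    N nat
  | Read 'a "'a aexp"  ("_\<langle>_\<rangle>" [1000, 0] 1000)
  | Inc "'a aexp"
  | Dec "'a aexp"

datatype 'a bexp =
    Equal "'a aexp" "'a aexp"  (infix "=\<^sub>e" 50)
  | Less "'a aexp" "'a aexp"  (infix "<\<^sub>e" 50)
  | Neg "'a bexp"
  | Conj "'a bexp" "'a bexp"

datatype 'a com =
    SKIP
  | Store 'a "'a aexp" "'a aexp"  ("_\<langle>_\<rangle> ::= _" [1000, 0, 61] 61)
  | Seq "'a com" "'a com"  ("_;;/ _" [60, 61] 60)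
  | Cond "'a bexp" "'a com" "'a com"  ("(IF _/ THEN _/ ELSE _)" [0, 0, 61] 61)
  | While "'a bexp" "'a com"  ("(WHILE _/ DO _)" [0, 61] 61)
  | Print "'a aexp"
  | EndRecord
  | Call

text \<open>A state is the memory together with the output tape, on which \<open>None\<close> marks the end of a
  record.\<close>

type_synonym 'a state = "('a cell \<Rightarrow> nat) \<times> nat option list"

fun aval :: "'a aexp \<Rightarrow> ('a cell \<Rightarrow> nat) \<Rightarrow> nat" where
  "aval (N n) M = n"
| "aval (Read a e) M = M (a, aval e M)"
| "aval (Inc e) M = aval e M + 1"
| "aval (Dec e) M = aval e M - 1"

fun acells :: "'a aexp \<Rightarrow> ('a cell \<Rightarrow> nat) \<Rightarrow> 'a cell set" where
  "acells (N n) M = {}"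
| "acells (Read a e) M = insert (a, aval e M) (acells e M)"
| "acells (Inc e) M = acells e M"
| "acells (Dec e) M = acells e M"

fun bval :: "'a bexp \<Rightarrow> ('a cell \<Rightarrow> nat) \<Rightarrow> bool" where
  "bval (Equal e1 e2) M \<longleftrightarrow> aval e1 M = aval e2 M"
| "bval (Less e1 e2) M \<longleftrightarrow> aval e1 M < aval e2 M"
| "bval (Neg b) M \<longleftrightarrow> \<not> bval b M"
| "bval (Conj b1 b2) M \<longleftrightarrow> bval b1 M \<and> bval b2 M"

fun bcells :: "'a bexp \<Rightarrow> ('a cell \<Rightarrow> nat) \<Rightarrow> 'a cell set" where
  "bcells (Equal e1 e2) M = acells e1 M \<union> acells e2 M"
| "bcells (Less e1 e2) M = acells e1 M \<union> acells e2 M"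
| "bcells (Neg b) M = bcells b M"
| "bcells (Conj b1 b2) M = bcells b1 M \<union> bcells b2 M"

text \<open>\<open>exec p c s n A d t\<close>: with procedure body \<open>p\<close>, command \<open>c\<close> started in state \<open>s\<close> halts in
  state \<open>t\<close> after \<open>n\<close> steps, having accessed (read or written) exactly the cells in \<open>A\<close>, with at
  most \<open>d\<close> simultaneously active procedure calls.  A step is a basic command or the evaluation of a
  guard; as the expressions in a fixed program have bounded size, finer accounting would change
  \<open>n\<close> by a constant factor only.\<close>

inductive exec ::
    "'a com \<Rightarrow> 'a com \<Rightarrow> 'a state \<Rightarrow> nat \<Rightarrow> 'a cell set \<Rightarrow> nat \<Rightarrow> 'a state \<Rightarrow> bool"
  for p :: "'a com"
where
  Skip: "exec p SKIP s 1 {} 0 s"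
| Store: "exec p (Store a e1 e2) (M, w) 1
     (insert (a, aval e1 M) (acells e1 M \<union> acells e2 M)) 0
     (M((a, aval e1 M) := aval e2 M), w)"
| Seq: "\<lbrakk> exec p c1 s n1 A1 d1 s'; exec p c2 s' n2 A2 d2 t \<rbrakk> \<Longrightarrow>
     exec p (Seq c1 c2) s (n1 + n2) (A1 \<union> A2) (max d1 d2) t"
| CondTrue: "\<lbrakk> bval b (fst s); exec p c1 s n A d t \<rbrakk> \<Longrightarrow>
     exec p (Cond b c1 c2) s (Suc n) (bcells b (fst s) \<union> A) d t"
| CondFalse: "\<lbrakk> \<not> bval b (fst s); exec p c2 s n A d t \<rbrakk> \<Longrightarrow>
     exec p (Cond b c1 c2) s (Suc n) (bcells b (fst s) \<union> A) d t"
| WhileFalse: "\<not> bval b (fst s) \<Longrightarrow> exec p (While b c) s 1 (bcells b (fst s)) 0 s"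
| WhileTrue: "\<lbrakk> bval b (fst s); exec p c s n1 A1 d1 s'; exec p (While b c) s' n2 A2 d2 t \<rbrakk> \<Longrightarrow>
     exec p (While b c) s (Suc (n1 + n2)) (bcells b (fst s) \<union> A1 \<union> A2) (max d1 d2) t"
| Print: "exec p (Print e) (M, w) 1 (acells e M) 0 (M, w @ [Some (aval e M)])"
| EndRecord: "exec p EndRecord (M, w) 1 {} 0 (M, w @ [None])"
| Call: "exec p p s n A d t \<Longrightarrow> exec p Call s (Suc n) A (Suc d) t"

inductive_cases exec_elims:
  "exec p SKIP s n A d t"
  "exec p (Store a e1 e2) s n A d t"
  "exec p (Seq c1 c2) s n A d t"
  "exec p (Cond b c1 c2) s n A d t"
  "exec p (Print e) s n A d t"
  "exec p EndRecord s n A d t"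
  "exec p Call s n A d t"
inductive_cases exec_WhileE: "exec p (While b c) s n A d t"

lemma exec_deterministic:
  assumes "exec p c s n A d t" and "exec p c s n' A' d' t'"
  shows "n' = n \<and> A' = A \<and> d' = d \<and> t' = t"
  using assms
proof (induction arbitrary: n' A' d' t' rule: exec.induct)
  case (Skip s)
  from Skip.prems show ?case by (rule exec_elims(1)) simp
next
  case (Store a e1 e2 M w)
  from Store.prems show ?case by (rule exec_elims(2)) simp
next
  case (Seq c1 s n1 A1 d1 s' c2 n2 A2 d2 t)
  from Seq.prems show ?case
  proof (rule exec_elims(3))
    fix m1 B1 k1 r m2 B2 k2
    assume "exec p c1 s m1 B1 k1 r" "exec p c2 r m2 B2 k2 t'"
      and "n' = m1 + m2" "A' = B1 \<union> B2" "d' = max k1 k2"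
    with Seq.IH(1)[of m1 B1 k1 r] Seq.IH(2)[of m2 B2 k2 t'] show ?case by simp
  qed
next
  case (CondTrue b s c1 n A d t c2)
  from CondTrue.prems show ?case
  proof (rule exec_elims(4))
    fix m B
    assume "exec p c1 s m B d' t'" "n' = Suc m" "A' = bcells b (fst s) \<union> B"
    with CondTrue.IH[of m B d' t'] show ?case by simp
  qed (use CondTrue.hyps in simp)
next
  case (CondFalse b s c2 n A d t c1)
  from CondFalse.prems show ?case
  proof (rule exec_elims(4))
    fix m B
    assume "exec p c2 s m B d' t'" "n' = Suc m" "A' = bcells b (fst s) \<union> B"
    with CondFalse.IH[of m B d' t'] show ?case by simp
  qed (use CondFalse.hyps in simp)
next
  case (WhileFalse b s c)
  from WhileFalse.prems show ?case
    by (rule exec_WhileE) (use WhileFalse.hyps in simp_all)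
next
  case (WhileTrue b s c n1 A1 d1 s' n2 A2 d2 t)
  from WhileTrue.prems show ?case
  proof (rule exec_WhileE)
    fix m1 B1 k1 r m2 B2 k2
    assume "exec p c s m1 B1 k1 r" "exec p (While b c) r m2 B2 k2 t'"
      and "n' = Suc (m1 + m2)" "A' = bcells b (fst s) \<union> B1 \<union> B2" "d' = max k1 k2"
    with WhileTrue.IH(1)[of m1 B1 k1 r] WhileTrue.IH(2)[of m2 B2 k2 t'] show ?case by simp
  qed (use WhileTrue.hyps in simp)
next
  case (Print e M w)
  from Print.prems show ?case by (rule exec_elims(5)) simp
next
  case (EndRecord M w)
  from EndRecord.prems show ?case by (rule exec_elims(6)) simp
next
  case (Call s n A d t)
  from Call.prems show ?case
  proof (rule exec_elims(7))
    fix m k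
    assume "exec p p s m A' k t'" "n' = Suc m" "d' = Suc k"
    with Call.IH[of m A' k t'] show ?case by simp
  qed
qed

definition exec_space :: "'a cell set \<Rightarrow> nat \<Rightarrow> nat" where
  "exec_space A d = card A + d"


section \<open>Implementation of RS on the machine\<close>

text \<open>Vertices are natural numbers, hyperedges are $1,\dots,m$, and 0 serves as null pointer and as
  the sentinel of the list \<open>uncov\<close>.  The input consists of \<open>NumEdges\<close> (cell 0), of \<open>Elt\<close>, which
  lists the elements of $F_1$, then those of $F_2$, and so on, at positions $1,2,\dots$, and of
  \<open>Start\<close>, the first position of each hyperedge.

  \<^item> The positions holding \<open>v\<close>, i.e. the family $\mathcal F(v)$, form a doubly linked list in
    descending order (\<open>IncFirst v\<close>, \<open>IncLast v\<close>, \<open>IncNext\<close>, \<open>IncPrev\<close>); \<open>EdgeOf\<close> maps positions to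
    hyperedges.
  \<^item> \<open>uncov\<close> is a circular doubly linked list in ascending order (\<open>UncovNext\<close>, \<open>UncovPrev\<close>).
  \<^item> Each \<open>crit[u]\<close> is a doubly linked list in ascending order (\<open>CritFirst u\<close>, \<open>CritNext\<close>,
    \<open>CritPrev\<close>).
  \<^item> \<open>Cover j\<close> is $|F_j \cap S|$, so $F_j$ is in \<open>uncov\<close> if this is 0, and in some \<open>crit[u]\<close> if
    this is 1; then \<open>Owner j\<close> is that \<open>u\<close>.  Removed list nodes keep their own pointers, hence
    removals can be undone in reverse order.
  \<^item> \<open>Level\<close> (cell 0) is the recursion depth $|S|$, and \<open>Chosen 0\<close>, \<open>Chosen 1\<close>, \dots are the
    elements of $S$.  \<open>Index\<close> and \<open>Pos\<close> hold, for each level, the index \<open>i\<close> and the current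
    position in $F_i$.
  \<^item> \<open>Edg\<close>, \<open>Cnt\<close>, \<open>Ptr\<close>, \<open>Occ\<close>, \<open>Vtx\<close> and \<open>Ok\<close> are registers (cell 0).\<close>

datatype name =
    NumEdges | Start | Elt
  | EdgeOf | IncFirst | IncLast | IncNext | IncPrev
  | UncovNext | UncovPrev
  | CritFirst | CritNext | CritPrev
  | Cover | Owner
  | Level | Chosen | Index | Pos
  | Edg | Cnt | Ptr | Occ | Vtx | Ok

abbreviation reg :: "name \<Rightarrow> name aexp" where
  "reg r \<equiv> r\<langle>N 0\<rangle>"

abbreviation set_reg :: "name \<Rightarrow> name aexp \<Rightarrow> name com"  ("_ :== _" [1000, 61] 61) where
  "r :== e \<equiv> r\<langle>N 0\<rangle> ::= e"

abbreviation Cond1 :: "name bexp \<Rightarrow> name com \<Rightarrow> name com"  ("(WHEN _/ DO _)" [0, 61] 61) where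
  "WHEN b DO c \<equiv> IF b THEN c ELSE SKIP"

abbreviation Neq :: "name aexp \<Rightarrow> name aexp \<Rightarrow> name bexp"  (infix "\<noteq>\<^sub>e" 50) where
  "e1 \<noteq>\<^sub>e e2 \<equiv> Neg (e1 =\<^sub>e e2)"

definition build_lists :: "name com" where
  "build_lists =
   (Edg :== N 1;;
    Ptr :== N 1;;
    WHILE reg Edg \<noteq>\<^sub>e Inc (reg NumEdges) DO
     (UncovNext\<langle>Dec (reg Edg)\<rangle> ::= reg Edg;;
      UncovPrev\<langle>reg Edg\<rangle> ::= Dec (reg Edg);;
      WHILE reg Ptr \<noteq>\<^sub>e Start\<langle>Inc (reg Edg)\<rangle> DO
       (EdgeOf\<langle>reg Ptr\<rangle> ::= reg Edg;;
        Vtx :== Elt\<langle>reg Ptr\<rangle>;;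
        IncNext\<langle>reg Ptr\<rangle> ::= IncFirst\<langle>reg Vtx\<rangle>;;
        IF IncFirst\<langle>reg Vtx\<rangle> =\<^sub>e N 0
          THEN IncLast\<langle>reg Vtx\<rangle> ::= reg Ptr
          ELSE IncPrev\<langle>IncFirst\<langle>reg Vtx\<rangle>\<rangle> ::= reg Ptr;;
        IncFirst\<langle>reg Vtx\<rangle> ::= reg Ptr;;
        Ptr :== Inc (reg Ptr));;
      Edg :== Inc (reg Edg));;
    UncovNext\<langle>reg NumEdges\<rangle> ::= N 0;;
    UncovPrev\<langle>N 0\<rangle> ::= reg NumEdges;;
    Level :== N 0)"

definition print_S :: "name com" where
  "print_S =
   (Cnt :== N 0;;
    WHILE reg Cnt \<noteq>\<^sub>e reg Level DO
     (Print (Chosen\<langle>reg Cnt\<rangle>);;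
      Cnt :== Inc (reg Cnt));;
    EndRecord)"

text \<open>Update of the lists from $S$ to $S \cup \{v\}$, where \<open>v\<close> is in register \<open>Vtx\<close>.\<close>

definition update :: "name com" where
  "update =
   (Occ :== IncFirst\<langle>reg Vtx\<rangle>;;
    WHILE reg Occ \<noteq>\<^sub>e N 0 DO
     (Edg :== EdgeOf\<langle>reg Occ\<rangle>;;
      IF Cover\<langle>reg Edg\<rangle> =\<^sub>e N 0 THEN
       (UncovNext\<langle>UncovPrev\<langle>reg Edg\<rangle>\<rangle> ::= UncovNext\<langle>reg Edg\<rangle>;;
        UncovPrev\<langle>UncovNext\<langle>reg Edg\<rangle>\<rangle> ::= UncovPrev\<langle>reg Edg\<rangle>;;
        CritNext\<langle>reg Edg\<rangle> ::= CritFirst\<langle>reg Vtx\<rangle>;;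
        CritPrev\<langle>reg Edg\<rangle> ::= N 0;;
        WHEN CritFirst\<langle>reg Vtx\<rangle> \<noteq>\<^sub>e N 0 DO CritPrev\<langle>CritFirst\<langle>reg Vtx\<rangle>\<rangle> ::= reg Edg;;
        CritFirst\<langle>reg Vtx\<rangle> ::= reg Edg;;
        Owner\<langle>reg Edg\<rangle> ::= reg Vtx)
      ELSE WHEN Cover\<langle>reg Edg\<rangle> =\<^sub>e N 1 DO
       (IF CritPrev\<langle>reg Edg\<rangle> =\<^sub>e N 0
          THEN CritFirst\<langle>Owner\<langle>reg Edg\<rangle>\<rangle> ::= CritNext\<langle>reg Edg\<rangle>
          ELSE CritNext\<langle>CritPrev\<langle>reg Edg\<rangle>\<rangle> ::= CritNext\<langle>reg Edg\<rangle>;;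
        WHEN CritNext\<langle>reg Edg\<rangle> \<noteq>\<^sub>e N 0 DO CritPrev\<langle>CritNext\<langle>reg Edg\<rangle>\<rangle> ::= CritPrev\<langle>reg Edg\<rangle>);;
      Cover\<langle>reg Edg\<rangle> ::= Inc (Cover\<langle>reg Edg\<rangle>);;
      Occ :== IncNext\<langle>reg Occ\<rangle>))"

text \<open>The minimum of \<open>crit[f]\<close> is its first element.  When RS($S$) is entered, the minimum of each
  \<open>crit[f]\<close> with $f \in S$ is below the least index in \<open>uncov\<close>, so only the lists \<open>crit[f]\<close> that
  have just lost a hyperedge need to be inspected; these belong to the hyperedges of $\mathcal F(v)$
  that are now covered exactly twice.  (Inspecting all $f \in S$ for each \<open>v\<close> would take too long.)\<close>

definition test :: "name com" where
  "test =
   (Ok :== N 1;;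
    Occ :== IncFirst\<langle>reg Vtx\<rangle>;;
    WHILE reg Occ \<noteq>\<^sub>e N 0 DO
     (Edg :== EdgeOf\<langle>reg Occ\<rangle>;;
      WHEN Cover\<langle>reg Edg\<rangle> =\<^sub>e N 2 DO
       (IF Conj (CritFirst\<langle>Owner\<langle>reg Edg\<rangle>\<rangle> \<noteq>\<^sub>e N 0)
               (CritFirst\<langle>Owner\<langle>reg Edg\<rangle>\<rangle> <\<^sub>e Index\<langle>reg Level\<rangle>)
          THEN SKIP
          ELSE Ok :== N 0);;
      Occ :== IncNext\<langle>reg Occ\<rangle>))"

definition undo :: "name com" where
  "undo =
   (Occ :== IncLast\<langle>reg Vtx\<rangle>;;
    WHILE reg Occ \<noteq>\<^sub>e N 0 DO
     (Edg :== EdgeOf\<langle>reg Occ\<rangle>;;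
      Cover\<langle>reg Edg\<rangle> ::= Dec (Cover\<langle>reg Edg\<rangle>);;
      IF Cover\<langle>reg Edg\<rangle> =\<^sub>e N 0 THEN
       (CritFirst\<langle>reg Vtx\<rangle> ::= CritNext\<langle>reg Edg\<rangle>;;
        WHEN CritNext\<langle>reg Edg\<rangle> \<noteq>\<^sub>e N 0 DO CritPrev\<langle>CritNext\<langle>reg Edg\<rangle>\<rangle> ::= N 0;;
        UncovNext\<langle>UncovPrev\<langle>reg Edg\<rangle>\<rangle> ::= reg Edg;;
        UncovPrev\<langle>UncovNext\<langle>reg Edg\<rangle>\<rangle> ::= reg Edg)
      ELSE WHEN Cover\<langle>reg Edg\<rangle> =\<^sub>e N 1 DO
       (IF CritPrev\<langle>reg Edg\<rangle> =\<^sub>e N 0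
          THEN CritFirst\<langle>Owner\<langle>reg Edg\<rangle>\<rangle> ::= reg Edg
          ELSE CritNext\<langle>CritPrev\<langle>reg Edg\<rangle>\<rangle> ::= reg Edg;;
        WHEN CritNext\<langle>reg Edg\<rangle> \<noteq>\<^sub>e N 0 DO CritPrev\<langle>CritNext\<langle>reg Edg\<rangle>\<rangle> ::= reg Edg);;
      Occ :== IncPrev\<langle>reg Occ\<rangle>))"

definition RS_body :: "name com" where
  "RS_body =
   (IF UncovNext\<langle>N 0\<rangle> =\<^sub>e N 0 THEN print_S
    ELSE
     (Index\<langle>reg Level\<rangle> ::= UncovNext\<langle>N 0\<rangle>;;
      Pos\<langle>reg Level\<rangle> ::= Start\<langle>Index\<langle>reg Level\<rangle>\<rangle>;;
      WHILE Pos\<langle>reg Level\<rangle> \<noteq>\<^sub>e Start\<langle>Inc (Index\<langle>reg Level\<rangle>)\<rangle> DO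
       (Vtx :== Elt\<langle>Pos\<langle>reg Level\<rangle>\<rangle>;;
        update;;
        test;;
        WHEN reg Ok =\<^sub>e N 1 DO
         (Chosen\<langle>reg Level\<rangle> ::= reg Vtx;;
          Level :== Inc (reg Level);;
          Call;;
          Level :== Dec (reg Level));;
        Vtx :== Elt\<langle>Pos\<langle>reg Level\<rangle>\<rangle>;;
        undo;;
        Pos\<langle>reg Level\<rangle> ::= Inc (Pos\<langle>reg Level\<rangle>))))"

definition RS_main :: "name com" where
  "RS_main = (build_lists;; Call)"

text \<open>The hyperedges are given as lists without repetitions; all cells not used for the input are
  initially 0, and the output tape is empty.\<close>

definition enumerates :: "nat list list \<Rightarrow> nat set list \<Rightarrow> bool" where
  "enumerates Es Fs \<longleftrightarrow> list_all2 (\<lambda>xs F. distinct xs \<and> set xs = F) Es Fs"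

definition input_mem :: "nat list list \<Rightarrow> name cell \<Rightarrow> nat" where
  "input_mem Es = (\<lambda>(a, k).
     if a = NumEdges \<and> k = 0 then length Es
     else if a = Start \<and> k \<in> {1..length Es + 1} then length (concat (take (k - 1) Es)) + 1
     else if a = Elt \<and> k \<in> {1..length (concat Es)} then concat Es ! (k - 1)
     else 0)"

definition tape_of :: "nat list list \<Rightarrow> nat option list" where
  "tape_of outs = concat (map (\<lambda>xs. map Some xs @ [None]) outs)"

text \<open>By \<open>exec_deterministic\<close>, an input has at most one run.\<close>

definition RS_run ::
    "nat list list \<Rightarrow> nat \<Rightarrow> nat \<Rightarrow> nat list list \<Rightarrow> bool" where
  "RS_run Es time space outs \<longleftrightarrow>
     (\<exists>A d M. exec RS_body RS_main (input_mem Es, []) time A d (M, tape_of outs) \<and>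
        space = exec_space A d)"

end

(* A set S is "valid" if each of its elements has a critical hyperedge that precedes all uncovered
   hyperedges.  RS visits exactly the valid sets: a nonempty valid set has a unique parent, obtained
   by deleting the vertex whose first critical hyperedge comes last, and this parent is valid.  Every
   nonempty valid set is a minimal hitting set of a prefix of the family, so there are at most
   |prefix_duals| + 1 calls.  Within one call the lists of distinct vertices are traversed a bounded
   number of times, which costs O(total size) because these lists are disjoint.

   For the machine, undoing an update restores all cells that are still meaningful (removed list
   nodes keep their pointers).  Hence a call returns with the memory unchanged up to garbage, and the
   time of a call is bounded by the number of its descendants in the search tree. *)

theory Submission imports Defs begin

section \<open>The search tree of RS\<close>

text \<open>In the middle of an update v has been added to some hyperedges of F(v) only, so the
  lists belong to no vertex set. Memory is therefore described by an arbitrary map \<open>X\<close>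
  from hyperedges to the chosen elements in them; completed updates give the special maps
  \<open>chosen vs\<close>, and only these are tied to \<open>uncov\<close> and \<open>crit\<close>.
  An update traverses F(v) in descending order, because hyperedges then enter \<open>crit[v]\<close>
  at its front and its head stays its minimum. Undoing must go the opposite way, hence links in both
  directions. The time budget of a call splits exactly over its children, so constant overheads have
  to be charged to something nonempty: the occurrences of v, of which there is at least one since v
  is taken from a hyperedge. Space follows by confining all accesses to one finite set of cells,
  arrays times indices. The existence of an RS derivation is not shown separately but read off the
  halting machine run.\<close>

lemma finite_uncov [simp]: "finite (uncov Fs S)"
  by (simp add: uncov_def)

lemma finite_crit [simp]: "finite (crit Fs v S)"
  by (simp add: crit_def)

definition child :: "'v set list \<Rightarrow> ('v set \<times> 'v set) set" where
  "child Fs = {(S, insert v S) | S v. uncov Fs S \<noteq> {} \<and> v \<in> edge Fs (Min (uncov Fs S)) \<and>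
     (\<forall>f\<in>S. crit Fs f (insert v S) \<noteq> {} \<and> Min (crit Fs f (insert v S)) < Min (uncov Fs S))}"

lemma Min_uncov_disjoint:
  assumes "uncov Fs S \<noteq> {}"
  shows "edge Fs (Min (uncov Fs S)) \<inter> S = {}"
  using Min_in[OF finite_uncov assms] by (simp add: uncov_def)

text \<open>The hyperedges critical for v in H are among those uncovered by S, and F_i with i =
  \<open>Min (uncov Fs S)\<close> is one of them because it misses S. So the first critical index of
  v is i, while the test places that of every other element strictly below i.\<close>

lemma childE:
  assumes "(S, H) \<in> child Fs"
  obtains v where "v \<notin> S" "H = insert v S" "uncov Fs S \<noteq> {}" "v \<in> edge Fs (Min (uncov Fs S))"
    "crit Fs v H \<noteq> {}" "Min (crit Fs v H) = Min (uncov Fs S)"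
    "\<And>f. f \<in> S \<Longrightarrow> crit Fs f H \<noteq> {} \<and> Min (crit Fs f H) < Min (uncov Fs S)"
proof -
  from assms obtain v where v: "H = insert v S" "uncov Fs S \<noteq> {}" "v \<in> edge Fs (Min (uncov Fs S))"
    and c: "\<forall>f\<in>S. crit Fs f H \<noteq> {} \<and> Min (crit Fs f H) < Min (uncov Fs S)"
    unfolding child_def by blast
  let ?i = "Min (uncov Fs S)"
  have i: "?i \<in> uncov Fs S" using v(2) by simp
  have vS: "v \<notin> S" using v(3) Min_uncov_disjoint[OF v(2)] by blast
  have m: "?i \<in> crit Fs v H" using i v vS by (auto simp: uncov_def crit_def)
  have "crit Fs v H \<subseteq> uncov Fs S" using v(1) vS by (auto simp: uncov_def crit_def)
  then have "Min (crit Fs v H) = ?i" using m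
    by (intro Min_eqI) (auto intro: Min_le)
  with that[OF vS v] m c show ?thesis by blast
qed

lemma child_unique:
  assumes "(S, H) \<in> child Fs" "(S', H) \<in> child Fs"
  shows "S = S'"
proof -
  from assms(1) obtain v where v: "v \<notin> S" "H = insert v S"
    "Min (crit Fs v H) = Min (uncov Fs S)"
    "\<And>f. f \<in> S \<Longrightarrow> Min (crit Fs f H) < Min (uncov Fs S)" by (rule childE) blast
  from assms(2) obtain w where w: "w \<notin> S'" "H = insert w S'"
    "Min (crit Fs w H) = Min (uncov Fs S')"
    "\<And>f. f \<in> S' \<Longrightarrow> Min (crit Fs f H) < Min (uncov Fs S')" by (rule childE) blast
  \<comment> \<open>Otherwise each of v and w lies in the other's parent, and the two strict
    inequalities contradict each other.\<close>
  have "v = w"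
  proof (rule ccontr)
    assume "v \<noteq> w"
    moreover have "insert v S = insert w S'" using v w by simp
    ultimately have "v \<in> S'" "w \<in> S" by (metis insertE insertI1)+
    then show False using v(3) w(3) v(4)[of w] w(4)[of v] by simp
  qed
  with v w show ?thesis by (metis insert_ident)
qed

lemma child_psubset: "(S, H) \<in> child Fs \<Longrightarrow> S \<subset> H"
  by (erule childE) auto

lemma child_rtrancl_subset: "(S, H) \<in> (child Fs)\<^sup>* \<Longrightarrow> S \<subseteq> H"
  by (induction rule: rtrancl_induct) (auto dest: child_psubset)

lemma child_finite: "(S, H) \<in> child Fs \<Longrightarrow> finite S \<Longrightarrow> finite H"
  by (erule childE) auto

lemma child_rtrancl_finite: "(S, H) \<in> (child Fs)\<^sup>* \<Longrightarrow> finite S \<Longrightarrow> finite H"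
  by (induction rule: rtrancl_induct) (auto dest: child_finite)

text \<open>The ancestors of H form a chain, as parents are unique, and cardinality strictly
  increases along it; so two ancestors of equal size coincide.\<close>

lemma child_rtrancl_unique:
  assumes "(A, H) \<in> (child Fs)\<^sup>*" "(B, H) \<in> (child Fs)\<^sup>*" "card A = card B" "finite A" "finite B"
  shows "A = B"
  using assms(1,2)
proof (induction rule: rtrancl_induct)
  case base
  then show ?case using assms child_rtrancl_subset card_subset_eq by metis
next
  case (step H' H)
  have fin: "finite H'" "finite H" using step assms child_finite child_rtrancl_finite by metis+
  have "card A \<le> card H'" using child_rtrancl_subset[OF step(1)] fin card_mono by blast
  also have "\<dots> < card H" using child_psubset[OF step(2)] fin psubset_card_mono by blast
  finally have "B \<noteq> H" using assms by auto
  with step.prems obtain H'' where "(B, H'') \<in> (child Fs)\<^sup>*" "(H'', H) \<in> child Fs"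
    by (metis rtranclE)
  with step show ?case using child_unique by metis
qed

text \<open>Siblings have equal size, so by uniqueness of ancestors their subtrees share no set.
  Duplicate-freeness of the output and additivity of the running time both rest on this.\<close>

lemma descendants_disjoint:
  assumes "finite S" "v \<notin> S" "w \<notin> S" "v \<noteq> w"
    "(insert v S, H) \<in> (child Fs)\<^sup>*" "(insert w S, H) \<in> (child Fs)\<^sup>*"
  shows False
proof -
  have "insert v S = insert w S" using assms by (intro child_rtrancl_unique[of _ H]) auto
  then show False using assms by blast
qed

section \<open>Outputs of RS in the search tree\<close>

lemma child_iff:
  assumes "uncov Fs S \<noteq> {}" "v \<in> edge Fs (Min (uncov Fs S))"
  shows "(S, insert v S) \<in> child Fs \<longleftrightarrow> (\<forall>f\<in>S. crit Fs f (insert v S) \<noteq> {} \<and>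
    Min (crit Fs f (insert v S)) < Min (uncov Fs S))" (is "?l \<longleftrightarrow> ?r")
proof
  assume ?l
  then show ?r by (rule childE) blast
next
  assume ?r
  with assms show ?l unfolding child_def by blast
qed

lemma descendants_unfold:
  assumes "uncov Fs S \<noteq> {}"
  shows "{H. (S, H) \<in> (child Fs)\<^sup>*} = insert S (\<Union>v\<in>{v \<in> edge Fs (Min (uncov Fs S)).
     (S, insert v S) \<in> child Fs}. {H. (insert v S, H) \<in> (child Fs)\<^sup>*})" (is "?L = insert S ?R")
proof (intro equalityI subsetI)
  fix H assume "H \<in> ?L"
  then have "(S, H) \<in> (child Fs)\<^sup>*" by simp
  then show "H \<in> insert S ?R"
  proof (cases rule: converse_rtranclE)
    case (step H')
    from step(1) obtain v where "H' = insert v S" "v \<in> edge Fs (Min (uncov Fs S))" by (rule childE)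
    with step show ?thesis by blast
  qed simp
next
  fix H assume "H \<in> insert S ?R"
  then show "H \<in> ?L" by (auto intro: converse_rtrancl_into_rtrancl)
qed

text \<open>Simultaneous induction on derivations of calls and of loops. In the loop statement
  \<open>vs\<close> is only the part of F_i still to be processed, hence an inclusion instead of an
  equality; different iterations produce outputs in disjoint subtrees.\<close>

lemma RS_outputs:
  "RS Fs S outs \<Longrightarrow> finite S \<Longrightarrow>
     distinct outs \<and> set outs = {H. (S, H) \<in> (child Fs)\<^sup>* \<and> uncov Fs H = {}}"
  "RS_for Fs S i vs outs \<Longrightarrow> finite S \<Longrightarrow> uncov Fs S \<noteq> {} \<Longrightarrow> i = Min (uncov Fs S) \<Longrightarrow>
     distinct vs \<Longrightarrow> set vs \<subseteq> edge Fs i \<Longrightarrow>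
     distinct outs \<and> set outs = {H. \<exists>v\<in>set vs. (S, insert v S) \<in> child Fs \<and>
       (insert v S, H) \<in> (child Fs)\<^sup>* \<and> uncov Fs H = {}}"
proof (induction rule: RS_RS_for.inducts)
  case (RS_output S)
  have "(S, H) \<in> (child Fs)\<^sup>* \<longleftrightarrow> H = S" for H
  proof
    assume "(S, H) \<in> (child Fs)\<^sup>*"
    then show "H = S"
      by (cases rule: converse_rtranclE) (use RS_output in \<open>auto elim: childE\<close>)
  qed simp
  with RS_output show ?case by auto
next
  case (RS_branch S i vs outs)
  then have *: "distinct outs" "set outs = {H. \<exists>v\<in>set vs. (S, insert v S) \<in> child Fs \<and>
       (insert v S, H) \<in> (child Fs)\<^sup>* \<and> uncov Fs H = {}}" by simp_all
  have "set outs = {H. H \<in> {H. (S, H) \<in> (child Fs)\<^sup>*} \<and> uncov Fs H = {}}"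
    unfolding descendants_unfold[OF \<open>uncov Fs S \<noteq> {}\<close>] *(2) using RS_branch by auto
  with * show ?case by simp
next
  case (RS_for_Nil S i)
  then show ?case by simp
next
  case (RS_for_call S v i outs vs outs')
  then have ch: "(S, insert v S) \<in> child Fs" by (subst child_iff) auto
  have new: "w \<notin> S" if "w \<in> set (v # vs)" for w
    using that RS_for_call.prems Min_uncov_disjoint[of Fs S] by auto
  have ih: "distinct outs" "set outs = {H. (insert v S, H) \<in> (child Fs)\<^sup>* \<and> uncov Fs H = {}}"
     "distinct outs'" "set outs' = {H. \<exists>v\<in>set vs. (S, insert v S) \<in> child Fs \<and>
       (insert v S, H) \<in> (child Fs)\<^sup>* \<and> uncov Fs H = {}}"
    using RS_for_call by simp_all
  have "set outs \<inter> set outs' = {}"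
    unfolding ih using descendants_disjoint[of S v] new RS_for_call.prems by auto
  with ih ch show ?case by auto
next
  case (RS_for_skip S v i vs outs)
  then have "(S, insert v S) \<notin> child Fs" by (subst child_iff) auto
  with RS_for_skip show ?case by auto
qed

section \<open>Valid sets and their parents\<close>

lemma crit_insert_subset: "f \<in> S \<Longrightarrow> crit Fs f (insert v S) \<subseteq> crit Fs f S"
  by (auto simp: crit_def)

text \<open>For a hitting set the condition on uncovered indices is vacuous, and validity says just
  that every element is critical.\<close>

definition valid :: "'v set list \<Rightarrow> 'v set \<Rightarrow> bool" where
  "valid Fs S \<longleftrightarrow> (\<forall>f\<in>S. \<exists>j\<in>crit Fs f S. \<forall>k\<in>uncov Fs S. j < k)"

lemma valid_empty [simp]: "valid Fs {}"
  by (simp add: valid_def)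

text \<open>All first critical indices in H are at most i = \<open>Min (uncov Fs S)\<close>: by the
  test for the elements of S, with equality for the new vertex v. Since v covers F_i, whatever is
  still uncovered has an index above i.\<close>

lemma valid_child:
  assumes "(S, H) \<in> child Fs"
  shows "valid Fs H"
proof -
  from assms obtain v where v: "v \<notin> S" "H = insert v S" "uncov Fs S \<noteq> {}"
    "v \<in> edge Fs (Min (uncov Fs S))" "crit Fs v H \<noteq> {}" "Min (crit Fs v H) = Min (uncov Fs S)"
    "\<And>f. f \<in> S \<Longrightarrow> crit Fs f H \<noteq> {} \<and> Min (crit Fs f H) < Min (uncov Fs S)"
    by (rule childE) blast
  have le: "Min (uncov Fs S) < k" if "k \<in> uncov Fs H" for k
  proof -
    have "k \<in> uncov Fs S" "k \<noteq> Min (uncov Fs S)" using that v by (auto simp: uncov_def)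
    then show ?thesis by (simp add: order_le_neq_trans)
  qed
  have "\<exists>j\<in>crit Fs f H. \<forall>k\<in>uncov Fs H. j < k" if "f \<in> H" for f
  proof (rule bexI)
    have ne: "crit Fs f H \<noteq> {}" using that v by blast
    then show "Min (crit Fs f H) \<in> crit Fs f H" by simp
    have "Min (crit Fs f H) \<le> Min (uncov Fs S)" using that v by (cases "f = v") (auto simp: less_imp_le)
    then show "\<forall>k\<in>uncov Fs H. Min (crit Fs f H) < k" using le by fastforce
  qed
  then show ?thesis by (simp add: valid_def)
qed

lemma valid_descendant: "(S, H) \<in> (child Fs)\<^sup>* \<Longrightarrow> valid Fs S \<Longrightarrow> valid Fs H"
  by (induction rule: rtrancl_induct) (auto dest: valid_child)

lemma valid_Min_less:
  assumes "valid Fs S" "f \<in> S" "k \<in> uncov Fs S"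
  shows "Min (crit Fs f S) < k"
  using assms by (auto simp: valid_def intro: le_less_trans[OF Min_le[OF finite_crit]])

lemma valid_crit_nonempty: "valid Fs S \<Longrightarrow> f \<in> S \<Longrightarrow> crit Fs f S \<noteq> {}"
  by (auto simp: valid_def)

text \<open>The parent of \<open>H\<close> is obtained by deleting the vertex whose first critical hyperedge comes last.\<close>

lemma valid_parent:
  assumes "finite H" "H \<noteq> {}" "valid Fs H"
  shows "\<exists>S. (S, H) \<in> child Fs \<and> valid Fs S"
proof -
  let ?c = "\<lambda>f. Min (crit Fs f H)"
  have im: "Max (?c ` H) \<in> ?c ` H" using assms by simp
  then obtain v where v: "v \<in> H" "?c v = Max (?c ` H)" by auto
  let ?S = "H - {v}"
  have H: "insert v ?S = H" using v by auto
  have cin: "?c f \<in> crit Fs f H" if "f \<in> H" for f using that valid_crit_nonempty[OF assms(3)] by simp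
  have cne: "?c f \<noteq> ?c v" if "f \<in> ?S" for f
    using cin[of f] cin[of v] that v(1) by (auto simp: crit_def)
  have less: "?c f < ?c v" if "f \<in> ?S" for f
  proof -
    have "?c f \<le> ?c v" unfolding v(2) using that assms(1) by (intro Max_ge) auto
    with cne[OF that] show ?thesis by simp
  qed
  have vin: "?c v \<in> uncov Fs ?S" using cin[OF v(1)] by (auto simp: crit_def uncov_def)
  \<comment> \<open>An index uncovered after deleting v either was uncovered before, and validity
    puts it above the first critical index of v, or is itself critical for v.\<close>
  have "?c v \<le> k" if "k \<in> uncov Fs ?S" for k
  proof (cases "k \<in> uncov Fs H")
    case True
    then show ?thesis using valid_Min_less[OF assms(3) v(1)] by (simp add: less_imp_le)
  next
    case False
    with that have "k \<in> crit Fs v H" using v(1) by (auto simp: uncov_def crit_def)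
    then show ?thesis by simp
  qed
  with vin have i: "Min (uncov Fs ?S) = ?c v" by (intro Min_eqI) auto
  have "v \<in> edge Fs (?c v)" using cin[OF v(1)] by (auto simp: crit_def)
  with i vin have "(?S, insert v ?S) \<in> child Fs"
    unfolding child_def H using less valid_crit_nonempty[OF assms(3)] H
    by (intro CollectI exI[of _ ?S] exI[of _ v]) (auto simp: insert_absorb)
  moreover have "valid Fs ?S"
    unfolding valid_def
  proof
    fix f assume f: "f \<in> ?S"
    then have "?c f \<in> crit Fs f ?S" using cin[of f] v(1) by (auto simp: crit_def)
    moreover have "\<forall>k\<in>uncov Fs ?S. ?c f < k" using less[OF f] i by (metis Min_le finite_uncov order_less_le_trans)
    ultimately show "\<exists>j\<in>crit Fs f ?S. \<forall>k\<in>uncov Fs ?S. j < k" by blast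
  qed
  ultimately show ?thesis using H by auto
qed

text \<open>Parents of valid sets are valid and strictly smaller, so passing to parents ends at the
  empty set.\<close>

lemma valid_root:
  assumes "finite H" "valid Fs H"
  shows "({}, H) \<in> (child Fs)\<^sup>*"
  using assms
proof (induction rule: finite_psubset_induct)
  case (psubset H)
  show ?case
  proof (cases "H = {}")
    case False
    with psubset obtain S where S: "(S, H) \<in> child Fs" "valid Fs S" using valid_parent by blast
    then have "({}, S) \<in> (child Fs)\<^sup>*" by (intro psubset.IH child_psubset)
    with S show ?thesis by auto
  qed simp
qed

section \<open>Minimal hitting sets, prefixes and the number of calls\<close>

lemma set_eq_edges: "set Fs = edge Fs ` {1..length Fs}"
proof (intro equalityI subsetI)
  fix F assume "F \<in> set Fs"
  then obtain i where "i < length Fs" "F = Fs ! i" by (auto simp: in_set_conv_nth)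
  then have "Suc i \<in> {1..length Fs}" "F = edge Fs (Suc i)" by (simp_all add: edge_def)
  then show "F \<in> edge Fs ` {1..length Fs}" by blast
next
  fix F assume "F \<in> edge Fs ` {1..length Fs}"
  then show "F \<in> set Fs" unfolding edge_def by fastforce
qed

lemma hitting_set_iff_uncov: "hitting_set Fs H \<longleftrightarrow> uncov Fs H = {}"
  unfolding hitting_set_def set_eq_edges uncov_def by auto

lemma edge_take: "1 \<le> j \<Longrightarrow> j \<le> i \<Longrightarrow> edge (take i Fs) j = edge Fs j"
  by (simp add: edge_def)

lemma uncov_take: "i \<le> length Fs \<Longrightarrow> uncov (take i Fs) S = {j \<in> uncov Fs S. j \<le> i}"
  by (rule set_eqI) (auto simp: uncov_def edge_def)

lemma crit_take: "i \<le> length Fs \<Longrightarrow> crit (take i Fs) v S = {j \<in> crit Fs v S. j \<le> i}"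
  unfolding crit_def mem_Collect_eq length_take
  by (rule Collect_cong) (metis (mono_tags, lifting) atLeastAtMost_iff edge_take min.absorb2 order_trans)

text \<open>Deleting f from a hitting set uncovers exactly the hyperedges critical for f. A proper
  subset omits some f altogether and then misses a hyperedge critical for f.\<close>

lemma dual_iff:
  "H \<in> dual V Fs \<longleftrightarrow> H \<subseteq> V \<and> uncov Fs H = {} \<and> (\<forall>f\<in>H. crit Fs f H \<noteq> {})"
proof -
  have "(\<forall>H'. H' \<subset> H \<longrightarrow> uncov Fs H' \<noteq> {}) \<longleftrightarrow> (\<forall>f\<in>H. crit Fs f H \<noteq> {})" if "uncov Fs H = {}"
  proof (intro iffI allI ballI impI)
    fix f assume min: "\<forall>H'. H' \<subset> H \<longrightarrow> uncov Fs H' \<noteq> {}" and f: "f \<in> H"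
    have "H - {f} \<subset> H" using f by auto
    then have "uncov Fs (H - {f}) \<noteq> {}" by (rule min[rule_format])
    then obtain j where "j \<in> uncov Fs (H - {f})" by (meson all_not_in_conv)
    moreover have "j \<notin> uncov Fs H" unfolding that by simp
    ultimately have "j \<in> {1..length Fs}" "edge Fs j \<inter> (H - {f}) = {}" "edge Fs j \<inter> H \<noteq> {}"
      unfolding uncov_def by simp_all
    with f have "j \<in> crit Fs f H" unfolding crit_def by blast
    then show "crit Fs f H \<noteq> {}" by blast
  next
    fix H' assume *: "\<forall>f\<in>H. crit Fs f H \<noteq> {}" "H' \<subset> H"
    then obtain f where "f \<in> H" "f \<notin> H'" by blast
    with * obtain j where "j \<in> crit Fs f H" by (meson all_not_in_conv)
    with \<open>f \<notin> H'\<close> \<open>H' \<subset> H\<close> have "j \<in> uncov Fs H'" by (auto simp: uncov_def crit_def)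
    then show "uncov Fs H' \<noteq> {}" by blast
  qed
  then show ?thesis unfolding dual_def hitting_set_iff_uncov mem_Collect_eq by blast
qed

lemma edge_subset: "hypergraph V Fs \<Longrightarrow> j \<in> {1..length Fs} \<Longrightarrow> edge Fs j \<subseteq> V"
  unfolding hypergraph_def set_eq_edges by blast

lemma child_subset:
  assumes "hypergraph V Fs" "(S, H) \<in> child Fs" "S \<subseteq> V"
  shows "H \<subseteq> V"
  using assms(2)
proof (rule childE)
  fix v assume "H = insert v S" "uncov Fs S \<noteq> {}" "v \<in> edge Fs (Min (uncov Fs S))"
  moreover from this have "Min (uncov Fs S) \<in> {1..length Fs}"
    using Min_in[of "uncov Fs S"] by (simp add: uncov_def)
  ultimately show ?thesis using assms edge_subset by blast
qed

lemma descendant_subset: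
  "(S, H) \<in> (child Fs)\<^sup>* \<Longrightarrow> hypergraph V Fs \<Longrightarrow> S \<subseteq> V \<Longrightarrow> H \<subseteq> V"
  by (induction rule: rtrancl_induct) (auto dest: child_subset)

text \<open>A minimal hitting set is valid, as no index is uncovered, and so it is reached from the
  root. Conversely every reached set is valid, which makes all its elements critical.\<close>

lemma RS_outputs_dual:
  assumes "hypergraph V Fs" "RS Fs {} outs"
  shows "distinct outs \<and> set outs = dual V Fs"
proof -
  have "{H. ({}, H) \<in> (child Fs)\<^sup>* \<and> uncov Fs H = {}} = dual V Fs"
  proof (intro equalityI subsetI)
    fix H assume "H \<in> {H. ({}, H) \<in> (child Fs)\<^sup>* \<and> uncov Fs H = {}}"
    then show "H \<in> dual V Fs"
      using descendant_subset[OF _ assms(1), of "{}" H] valid_descendant[of "{}" H Fs]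
        valid_crit_nonempty[of Fs H] by (auto simp: dual_iff)
  next
    fix H assume H: "H \<in> dual V Fs"
    then have "finite H" using assms(1) by (auto simp: dual_iff hypergraph_def intro: finite_subset)
    moreover have "valid Fs H" using H by (auto simp: dual_iff valid_def)
    ultimately show "H \<in> {H. ({}, H) \<in> (child Fs)\<^sup>* \<and> uncov Fs H = {}}"
      using H valid_root by (auto simp: dual_iff)
  qed
  with RS_outputs(1)[OF assms(2)] show ?thesis by simp
qed

lemma descendants_prefix_duals:
  assumes "hypergraph V Fs" "({}, H) \<in> (child Fs)\<^sup>*" "H \<noteq> {}"
  shows "H \<in> prefix_duals V Fs"
proof -
  have H: "H \<subseteq> V" "valid Fs H"
    using assms descendant_subset[of "{}" H Fs V] valid_descendant[of "{}" H] by auto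
  \<comment> \<open>The prefix stops just before the first uncovered hyperedge, so H hits all of it;
    validity supplies every element of H with a critical hyperedge inside this same prefix.\<close>
  define i where "i = (if uncov Fs H = {} then length Fs else Min (uncov Fs H) - 1)"
  have U: "j \<in> {1..length Fs}" if "j \<in> uncov Fs H" for j using that by (auto simp: uncov_def)
  have il: "i \<le> length Fs"
    using U[OF Min_in[OF finite_uncov]] by (cases "uncov Fs H = {}") (auto simp: i_def)
  have u: "uncov (take i Fs) H = {}"
  proof -
    have False if "j \<in> uncov Fs H" "j \<le> i" for j
    proof -
      have "uncov Fs H \<noteq> {}" using that by blast
      moreover have "Min (uncov Fs H) \<le> j" "1 \<le> j" using that U by auto
      ultimately show ?thesis using that(2) by (simp add: i_def)
    qed
    then show ?thesis by (auto simp: uncov_take[OF il])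
  qed
  have *: "\<exists>j\<in>crit Fs f H. 1 \<le> j \<and> j \<le> i" if f: "f \<in> H" for f
  proof -
    obtain j where j: "j \<in> crit Fs f H" "\<forall>k\<in>uncov Fs H. j < k" using H f by (auto simp: valid_def)
    then have "1 \<le> j" "j \<le> length Fs" by (auto simp: crit_def)
    moreover have "j \<le> i"
    proof (cases "uncov Fs H = {}")
      case False
      then have "j < Min (uncov Fs H)" using j by simp
      with False show ?thesis unfolding i_def by (simp del: Min_gr_iff)
    qed (use calculation in \<open>simp add: i_def\<close>)
    ultimately show ?thesis using j by blast
  qed
  \<comment> \<open>H has an element, and its critical index lies between 1 and i; the prefix is
    thus nonempty, as \<open>prefix_duals\<close> demands.\<close>
  then have "1 \<le> i" using assms(3) by fastforce
  moreover have "crit (take i Fs) f H \<noteq> {}" if "f \<in> H" for f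
    using *[OF that] by (auto simp: crit_take[OF il])
  with H u have "H \<in> dual V (take i Fs)" by (auto simp: dual_iff)
  ultimately show ?thesis using il by (auto simp: prefix_duals_def)
qed

lemma finite_prefix_duals: "finite V \<Longrightarrow> finite (prefix_duals V Fs)"
  by (rule finite_subset[of _ "Pow V"]) (auto simp: prefix_duals_def dual_def)

text \<open>The extra 1 is the root \<open>{}\<close>, which hits no nonempty family.\<close>

lemma card_descendants:
  assumes "hypergraph V Fs"
  shows "card {H. ({}, H) \<in> (child Fs)\<^sup>*} \<le> card (prefix_duals V Fs) + 1"
proof -
  have fin: "finite (prefix_duals V Fs)" using assms by (simp add: hypergraph_def finite_prefix_duals)
  have "{H. ({}, H) \<in> (child Fs)\<^sup>*} \<subseteq> insert {} (prefix_duals V Fs)"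
    using descendants_prefix_duals[OF assms] by blast
  then have "card {H. ({}, H) \<in> (child Fs)\<^sup>*} \<le> card (insert {} (prefix_duals V Fs))"
    using fin by (intro card_mono) auto
  also have "\<dots> \<le> card (prefix_duals V Fs) + 1" using fin by (simp add: card_insert_if)
  finally show ?thesis .
qed

text \<open>A single vertex of F_1 is a minimal hitting set of the first prefix. This allows the
  extra 1 for the root to be absorbed into a constant factor.\<close>

lemma prefix_duals_nonempty:
  assumes "hypergraph V Fs" "Fs \<noteq> []" "{} \<notin> set Fs"
  shows "card (prefix_duals V Fs) \<ge> 1"
proof -
  have one: "1 \<in> {1..length Fs}" using assms(2) by (cases Fs) auto
  then have "edge Fs 1 \<in> set Fs" unfolding set_eq_edges by blast
  with assms(3) obtain v where v: "v \<in> edge Fs 1" by (metis equals0I)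
  have "{v} \<in> dual V (take 1 Fs)"
    unfolding dual_iff using v one edge_subset[OF assms(1) one]
    by (auto simp: uncov_def crit_def edge_take)
  then have "{v} \<in> prefix_duals V Fs" using one unfolding prefix_duals_def by blast
  moreover have "finite (prefix_duals V Fs)" using assms by (simp add: hypergraph_def finite_prefix_duals)
  ultimately have "card (prefix_duals V Fs) > 0" by (auto simp: card_gt_0_iff)
  then show ?thesis by simp
qed


section \<open>Reasoning about the machine\<close>

text \<open>Exact resource counts are relaxed to upper bounds, so that the parts of a program can
  share one cell set \<open>A\<close> and one depth \<open>d\<close>.\<close>

definition runs :: "'a com \<Rightarrow> 'a com \<Rightarrow> 'a state \<Rightarrow> nat \<Rightarrow> 'a cell set \<Rightarrow> nat \<Rightarrow> 'a state \<Rightarrow> bool" where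
  "runs p c s n A d t \<longleftrightarrow> (\<exists>n' A' d'. exec p c s n' A' d' t \<and> n' \<le> n \<and> A' \<subseteq> A \<and> d' \<le> d)"

lemma runs_mono:
  "runs p c s n A d t \<Longrightarrow> n \<le> n' \<Longrightarrow> d \<le> d' \<Longrightarrow> runs p c s n' A d' t"
  unfolding runs_def by (meson order_trans)

lemma runs_Seq:
  assumes "runs p c1 s n1 A d r" "runs p c2 r n2 A d t"
  shows "runs p (c1;; c2) s (n1 + n2) A d t"
proof -
  obtain m1 A1 d1 where 1: "exec p c1 s m1 A1 d1 r" "m1 \<le> n1" "A1 \<subseteq> A" "d1 \<le> d"
    using assms(1) by (auto simp: runs_def)
  obtain m2 A2 d2 where 2: "exec p c2 r m2 A2 d2 t" "m2 \<le> n2" "A2 \<subseteq> A" "d2 \<le> d"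
    using assms(2) by (auto simp: runs_def)
  show ?thesis unfolding runs_def
    by (intro exI conjI, rule exec.Seq[OF 1(1) 2(1)]) (use 1 2 in auto)
qed

lemma runs_Cond:
  assumes "bcells b (fst s) \<subseteq> A"
    and "bval b (fst s) \<Longrightarrow> runs p c1 s n A d t" and "\<not> bval b (fst s) \<Longrightarrow> runs p c2 s n A d t"
  shows "runs p (IF b THEN c1 ELSE c2) s (Suc n) A d t"
proof (cases "bval b (fst s)")
  case True
  with assms(2) obtain m A' d' where 1: "exec p c1 s m A' d' t" "m \<le> n" "A' \<subseteq> A" "d' \<le> d"
    by (auto simp: runs_def)
  show ?thesis unfolding runs_def
    by (intro exI conjI, rule exec.CondTrue[OF True 1(1)]) (use 1 assms in auto)
next
  case False
  with assms(3) obtain m A' d' where 1: "exec p c2 s m A' d' t" "m \<le> n" "A' \<subseteq> A" "d' \<le> d"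
    by (auto simp: runs_def)
  show ?thesis unfolding runs_def
    by (intro exI conjI, rule exec.CondFalse[OF False 1(1)]) (use 1 assms in auto)
qed

lemma runs_WhileFalse:
  "\<not> bval b (fst s) \<Longrightarrow> bcells b (fst s) \<subseteq> A \<Longrightarrow> runs p (WHILE b DO c) s 1 A d s"
  unfolding runs_def by (intro exI conjI, rule exec.WhileFalse) auto

lemma runs_WhileTrue:
  assumes "bval b (fst s)" "bcells b (fst s) \<subseteq> A"
    and "runs p c s n1 A d r" "runs p (WHILE b DO c) r n2 A d t"
  shows "runs p (WHILE b DO c) s (Suc (n1 + n2)) A d t"
proof -
  obtain m1 A1 d1 where 1: "exec p c s m1 A1 d1 r" "m1 \<le> n1" "A1 \<subseteq> A" "d1 \<le> d"
    using assms(3) by (auto simp: runs_def)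
  obtain m2 A2 d2 where 2: "exec p (WHILE b DO c) r m2 A2 d2 t" "m2 \<le> n2" "A2 \<subseteq> A" "d2 \<le> d"
    using assms(4) by (auto simp: runs_def)
  show ?thesis unfolding runs_def
    by (intro exI conjI, rule exec.WhileTrue[OF assms(1) 1(1) 2(1)]) (use 1 2 assms(2) in auto)
qed

lemma runs_Call: "runs p p s n A d t \<Longrightarrow> runs p Call s (Suc n) A (Suc d) t"
  unfolding runs_def by (meson exec.Call Suc_le_mono)

section \<open>Symbolic execution of straight-line commands\<close>

fun straight :: "'a com \<Rightarrow> bool" where
  "straight (c1;; c2) \<longleftrightarrow> straight c1 \<and> straight c2"
| "straight (IF b THEN c1 ELSE c2) \<longleftrightarrow> straight c1 \<and> straight c2"
| "straight SKIP \<longleftrightarrow> True"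
| "straight (Store a e1 e2) \<longleftrightarrow> True"
| "straight _ \<longleftrightarrow> False"

fun steps :: "'a com \<Rightarrow> nat" where
  "steps (c1;; c2) = steps c1 + steps c2"
| "steps (IF b THEN c1 ELSE c2) = Suc (max (steps c1) (steps c2))"
| "steps _ = 1"

fun after :: "'a com \<Rightarrow> ('a cell \<Rightarrow> nat) \<Rightarrow> 'a cell \<Rightarrow> nat" where
  "after (c1;; c2) M = after c2 (after c1 M)"
| "after (IF b THEN c1 ELSE c2) M = (if bval b M then after c1 M else after c2 M)"
| "after (Store a e1 e2) M = M((a, aval e1 M) := aval e2 M)"
| "after _ M = M"

fun touched :: "'a com \<Rightarrow> ('a cell \<Rightarrow> nat) \<Rightarrow> 'a cell set" where
  "touched (c1;; c2) M = touched c1 M \<union> touched c2 (after c1 M)"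
| "touched (IF b THEN c1 ELSE c2) M = bcells b M \<union> (if bval b M then touched c1 M else touched c2 M)"
| "touched (Store a e1 e2) M = insert (a, aval e1 M) (acells e1 M \<union> acells e2 M)"
| "touched _ M = {}"

text \<open>Reduces loop bodies to simplification: a step bound comes from the syntax alone, final
  memory and accessed cells from symbolic evaluation. On loops, calls and output the values of
  \<open>after\<close> and \<open>touched\<close> are dummies, which \<open>straight\<close>
  excludes.\<close>

lemma runs_straight:
  "straight c \<Longrightarrow> touched c M \<subseteq> A \<Longrightarrow> runs p c (M, w) (steps c) A d (after c M, w)"
proof (induction c arbitrary: M)
  case SKIP
  show ?case unfolding runs_def by (intro exI conjI) (auto intro: exec.Skip)
next
  case (Store a e1 e2)
  then show ?case unfolding runs_def using exec.Store[of p a e1 e2 M w] by fastforce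
next
  case (Seq c1 c2)
  then show ?case by (auto intro: runs_Seq)
next
  case (Cond b c1 c2)
  then show ?case
    unfolding steps.simps by (intro runs_Cond) (auto intro: runs_mono[OF Cond.IH(1)] runs_mono[OF Cond.IH(2)])
qed auto

lemma runs_straight':
  "straight c \<Longrightarrow> touched c M \<subseteq> A \<Longrightarrow> after c M = M' \<Longrightarrow> steps c \<le> n \<Longrightarrow> runs p c (M, w) n A d (M', w)"
  by (auto intro: runs_mono[OF runs_straight])

lemma runs_Print: "acells e M \<subseteq> A \<Longrightarrow> runs p (Print e) (M, w) 1 A d (M, w @ [Some (aval e M)])"
  unfolding runs_def by (intro exI conjI, rule exec.Print) auto

lemma runs_EndRecord: "runs p EndRecord (M, w) 1 A d (M, w @ [None])"
  unfolding runs_def by (intro exI conjI, rule exec.EndRecord) auto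


section \<open>Neighbours in ordered linked lists\<close>

text \<open>The number 0 stands before the first and after the last element of \<open>P\<close>.\<close>

definition nxt :: "nat set \<Rightarrow> nat \<Rightarrow> nat" where
  "nxt P k = (let Q = {x \<in> P. k < x} in if Q = {} then 0 else Min Q)"

definition prv :: "nat set \<Rightarrow> nat \<Rightarrow> nat" where
  "prv P k = (let Q = {x \<in> P. k = 0 \<or> x < k} in if Q = {} then 0 else Max Q)"

locale node_set =
  fixes P :: "nat set"
  assumes fin: "finite P" and nz: "0 \<notin> P"
begin

text \<open>Replaces the minimum by order conditions on a candidate neighbour. The value 0 is
  unambiguous because 0 is not in \<open>P\<close>.\<close>

lemma nxt_iff:
  "nxt P k = y \<longleftrightarrow> (if y = 0 then \<forall>x\<in>P. x \<le> k else y \<in> P \<and> k < y \<and> (\<forall>x\<in>P. k < x \<longrightarrow> y \<le> x))"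
proof -
  let ?Q = "{x \<in> P. k < x}"
  have f: "finite ?Q" using fin by simp
  show ?thesis
  proof (cases "?Q = {}")
    case True
    then show ?thesis by (auto simp: nxt_def)
  next
    case False
    with f have "Min ?Q = z \<longleftrightarrow> z \<in> ?Q \<and> (\<forall>x\<in>?Q. z \<le> x)" for z by (subst Min_eq_iff) auto
    moreover have "Min ?Q \<noteq> 0" using Min_in[OF f False] by auto
    ultimately show ?thesis using False nz by (auto simp: nxt_def not_le)
  qed
qed

lemma prv_iff:
  "prv P k = y \<longleftrightarrow> (if y = 0 then \<forall>x\<in>P. k \<noteq> 0 \<and> k \<le> x
     else y \<in> P \<and> (k = 0 \<or> y < k) \<and> (\<forall>x\<in>P. k = 0 \<or> x < k \<longrightarrow> x \<le> y))"
proof -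
  let ?Q = "{x \<in> P. k = 0 \<or> x < k}"
  have f: "finite ?Q" using fin by simp
  show ?thesis
  proof (cases "?Q = {}")
    case True
    then show ?thesis by (auto simp: prv_def)
  next
    case False
    with f have "Max ?Q = z \<longleftrightarrow> z \<in> ?Q \<and> (\<forall>x\<in>?Q. x \<le> z)" for z by (subst Max_eq_iff) auto
    moreover have "Max ?Q \<noteq> 0" using Max_in[OF f False] nz by (metis (mono_tags, lifting) mem_Collect_eq)
    moreover have "prv P k = Max ?Q" using False by (simp only: prv_def Let_def if_False)
    moreover have "\<not> (\<forall>x\<in>P. k \<noteq> 0 \<and> k \<le> x)" using False by (auto simp: not_le)
    ultimately show ?thesis by auto
  qed
qed

lemma nxt_cases:
  obtains "nxt P k = 0" "\<forall>x\<in>P. x \<le> k"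
  | "nxt P k \<in> P" "nxt P k \<noteq> 0" "k < nxt P k" "\<forall>x\<in>P. k < x \<longrightarrow> nxt P k \<le> x"
  using nxt_iff[of k "nxt P k"] by (auto split: if_splits)

lemma prv_cases:
  obtains "prv P k = 0" "\<forall>x\<in>P. k \<noteq> 0 \<and> k \<le> x"
  | "prv P k \<in> P" "prv P k \<noteq> 0" "k = 0 \<or> prv P k < k" "\<forall>x\<in>P. k = 0 \<or> x < k \<longrightarrow> x \<le> prv P k"
  using prv_iff[of k "prv P k"] by (auto split: if_splits)

lemma nxt_in: "nxt P k \<in> insert 0 P" by (rule nxt_cases) auto
lemma prv_in: "prv P k \<in> insert 0 P" by (rule prv_cases) auto

lemma nxt_neq: "k \<in> P \<Longrightarrow> nxt P k \<noteq> k" using nz by (cases k rule: nxt_cases) force+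
lemma prv_neq: "k \<in> P \<Longrightarrow> prv P k \<noteq> k" using nz by (cases k rule: prv_cases) force+

lemma nxt_prv: "j \<in> P \<Longrightarrow> nxt P (prv P j) = j"
  using nz by (cases j rule: prv_cases) (fastforce simp: nxt_iff)+

lemma prv_nxt: "j \<in> P \<Longrightarrow> prv P (nxt P j) = j"
  using nz by (cases j rule: nxt_cases) (fastforce simp: prv_iff)+

lemma node_set_Diff: "node_set (P - {j})"
  by unfold_locales (use fin nz in auto)

text \<open>With 0 standing both before the first and after the last element, \<open>nxt\<close> and
  \<open>prv\<close> are mutually inverse on the cycle \<open>insert 0 P\<close>.\<close>

lemma nxt_eq_iff:
  assumes "j \<in> P" "k \<in> insert 0 P"
  shows "nxt P k = j \<longleftrightarrow> k = prv P j"
proof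
  assume j: "nxt P k = j"
  have "k = 0 \<or> k \<in> P" using assms by simp
  then show "k = prv P j"
  proof
    assume "k = 0"
    with j assms nz have "prv P j = 0" by (cases k rule: nxt_cases) (auto simp: prv_iff)
    then show ?thesis using \<open>k = 0\<close> by simp
  qed (use prv_nxt j in auto)
qed (use nxt_prv assms in auto)

lemma prv_eq_iff:
  assumes "j \<in> P" "k \<in> insert 0 P"
  shows "prv P k = j \<longleftrightarrow> k = nxt P j"
proof
  assume j: "prv P k = j"
  have "k = 0 \<or> k \<in> P" using assms by simp
  then show "k = nxt P j"
  proof
    assume "k = 0"
    with j assms nz have "nxt P j = 0" by (cases k rule: prv_cases) (auto simp: nxt_iff)
    then show ?thesis using \<open>k = 0\<close> by simp
  qed (use nxt_prv j in auto)
qed (use prv_nxt assms in auto)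

text \<open>Deleting j redirects one successor, that of the old predecessor of j. Together with the
  dual fact for \<open>prv\<close> this justifies the two pointer writes that unlink a node.\<close>

lemma nxt_Diff:
  assumes "j \<in> P" "k \<in> insert 0 P" "k \<noteq> j"
  shows "nxt (P - {j}) k = (if k = prv P j then nxt P j else nxt P k)"
proof (cases "k = prv P j")
  case True
  interpret D: node_set "P - {j}" by (rule node_set_Diff)
  have "nxt P k = j" using True assms nxt_prv by simp
  moreover have "j \<noteq> 0" using assms(1) nz by metis
  ultimately have kj: "k < j" "\<And>x. x \<in> P \<Longrightarrow> k < x \<Longrightarrow> j \<le> x" by (auto simp: nxt_iff)
  have "nxt (P - {j}) k = nxt P j"
  proof (cases j rule: nxt_cases)
    case 1
    have "x \<le> k" if "x \<in> P - {j}" for x using 1(2) kj(2)[of x] that by fastforce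
    then show ?thesis unfolding D.nxt_iff using 1(1) by simp
  next
    case 2
    have "nxt P j \<le> x" if "x \<in> P - {j}" "k < x" for x using 2(4) kj(2)[of x] that by fastforce
    then show ?thesis unfolding D.nxt_iff using 2 kj(1) by simp
  qed
  with True show ?thesis by simp
next
  case False
  interpret D: node_set "P - {j}" by (rule node_set_Diff)
  from False have "nxt P k \<noteq> j" using assms nxt_eq_iff by simp
  with False show ?thesis by (cases k rule: nxt_cases) (simp_all add: D.nxt_iff)
qed

lemma prv_Diff:
  assumes "j \<in> P" "k \<in> insert 0 P" "k \<noteq> j"
  shows "prv (P - {j}) k = (if k = nxt P j then prv P j else prv P k)"
proof (cases "k = nxt P j")
  case True
  interpret D: node_set "P - {j}" by (rule node_set_Diff)
  have "prv P k = j" using True assms prv_nxt by simp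
  moreover have j0: "j \<noteq> 0" using assms(1) nz by metis
  ultimately have kj: "k = 0 \<or> j < k" "\<And>x. x \<in> P \<Longrightarrow> k = 0 \<or> x < k \<Longrightarrow> x \<le> j"
    by (auto simp: prv_iff)
  have "prv (P - {j}) k = prv P j"
  proof (cases j rule: prv_cases)
    case 1
    have "k \<noteq> 0 \<and> k \<le> x" if "x \<in> P - {j}" for x using 1(2) kj(2)[of x] that by fastforce
    then show ?thesis unfolding D.prv_iff using 1(1) by simp
  next
    case 2
    have "x \<le> prv P j" if "x \<in> P - {j}" "k = 0 \<or> x < k" for x
      using 2(4) kj(2)[of x] that by fastforce
    then show ?thesis unfolding D.prv_iff using 2 kj(1) j0 by auto
  qed
  with True show ?thesis by simp
next
  case False
  interpret D: node_set "P - {j}" by (rule node_set_Diff)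
  from False have "prv P k \<noteq> j" using assms prv_eq_iff by simp
  with False show ?thesis by (cases k rule: prv_cases) (auto simp: D.prv_iff)
qed

lemma prv_nxt_0: "nxt P 0 \<noteq> 0 \<Longrightarrow> prv P (nxt P 0) = 0"
  using nz by (cases "0::nat" rule: nxt_cases) (force simp: prv_iff)+

section \<open>Insertion at the front of a list\<close>

context
  fixes j assumes front: "\<forall>x\<in>P. j < x" and pos: "0 < j"
begin

interpretation F: node_set "insert j P"
  by unfold_locales (use fin nz pos in auto)

lemma nxt_front: "nxt (insert j P) 0 = j" "nxt (insert j P) j = nxt P 0"
proof -
  show "nxt (insert j P) 0 = j" using front pos by (auto simp: F.nxt_iff less_imp_le)
  show "nxt (insert j P) j = nxt P 0"
    using front pos by (cases "0::nat" rule: nxt_cases) (force simp: F.nxt_iff)+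
qed

lemma nxt_behind: "k \<in> P \<Longrightarrow> nxt (insert j P) k = nxt P k"
  using front pos nz by (cases k rule: nxt_cases) (auto simp: F.nxt_iff)

lemma prv_front: "prv (insert j P) j = 0"
  using front pos by (auto simp: F.prv_iff less_imp_le)

text \<open>Only the former head, if there is one, obtains a new predecessor; this is the
  conditional write to \<open>CritPrev\<close> in the update.\<close>

lemma prv_behind:
  assumes "k \<in> P"
  shows "prv (insert j P) k = (if k = nxt P 0 then j else prv P k)"
proof (cases "k = nxt P 0")
  case True
  then have "\<forall>x\<in>P. k \<le> x" "k \<noteq> 0" using assms nz by (cases "0::nat" rule: nxt_cases; force)+
  then show ?thesis using True pos front assms unfolding F.prv_iff by auto
next
  case False
  have k: "k \<noteq> 0" using assms nz by metis
  have "prv P k \<noteq> 0"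
  proof
    assume "prv P k = 0"
    then have "\<forall>x\<in>P. k \<le> x" unfolding prv_iff by simp
    then have "nxt P 0 = k" using assms k unfolding nxt_iff by simp
    with False show False by simp
  qed
  then show ?thesis using False k front
    by (cases k rule: prv_cases) (auto simp: F.prv_iff less_imp_le)
qed

end

end


section \<open>The lists uncov and crit in memory\<close>

text \<open>\<open>X j\<close> lists the elements of $F_j \cap S$ in the order in which they were chosen; a partially
  executed update is described by the same kind of map.\<close>

definition uncovered :: "nat \<Rightarrow> (nat \<Rightarrow> nat list) \<Rightarrow> nat set" where
  "uncovered m X = {j \<in> {1..m}. X j = []}"

definition owned :: "nat \<Rightarrow> (nat \<Rightarrow> nat list) \<Rightarrow> nat \<Rightarrow> nat set" where
  "owned m X u = {j \<in> {1..m}. X j = [u]}"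

text \<open>Only \<open>uncov\<close> is circular, so its clauses include node 0; a
  \<open>crit\<close> list keeps its head in \<open>CritFirst\<close>. \<open>Owner\<close> is
  prescribed for every covered hyperedge, even one that has left its \<open>crit\<close> list, since
  the test and the undo step must still find that list.\<close>

definition repr :: "nat \<Rightarrow> (nat \<Rightarrow> nat list) \<Rightarrow> (name cell \<Rightarrow> nat) \<Rightarrow> bool" where
  "repr m X M \<longleftrightarrow>
     (\<forall>j\<in>{1..m}. M (Cover, j) = length (X j)) \<and>
     (\<forall>j\<in>{1..m}. X j \<noteq> [] \<longrightarrow> M (Owner, j) = hd (X j)) \<and>
     (\<forall>j\<in>insert 0 (uncovered m X). M (UncovNext, j) = nxt (uncovered m X) j) \<and>
     (\<forall>j\<in>insert 0 (uncovered m X). M (UncovPrev, j) = prv (uncovered m X) j) \<and>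
     (\<forall>u. M (CritFirst, u) = nxt (owned m X u) 0) \<and>
     (\<forall>u. \<forall>j\<in>owned m X u. M (CritNext, j) = nxt (owned m X u) j) \<and>
     (\<forall>u. \<forall>j\<in>owned m X u. M (CritPrev, j) = prv (owned m X u) j)"

text \<open>Agreement on the cells that matter: registers, the nodes of unused crit lists and the upper
  parts of the stacks may differ.\<close>

definition live :: "(nat \<Rightarrow> nat list) \<Rightarrow> nat \<Rightarrow> nat \<Rightarrow> name \<Rightarrow> nat \<Rightarrow> bool" where
  "live X L K a k \<longleftrightarrow> a \<notin> {Edg, Cnt, Ptr, Occ, Vtx, Ok} \<and>
     (a \<in> {CritNext, CritPrev, Owner} \<longrightarrow> X k \<noteq> []) \<and> (a = Chosen \<longrightarrow> k < L) \<and>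
     (a \<in> {Index, Pos} \<longrightarrow> k < K)"

definition agree :: "(nat \<Rightarrow> nat list) \<Rightarrow> nat \<Rightarrow> nat \<Rightarrow> (name cell \<Rightarrow> nat) \<Rightarrow> (name cell \<Rightarrow> nat) \<Rightarrow> bool" where
  "agree X L K M M' \<longleftrightarrow> (\<forall>a k. live X L K a k \<longrightarrow> M' (a, k) = M (a, k))"

lemma agreeD: "agree X L K M M' \<Longrightarrow> live X L K a k \<Longrightarrow> M' (a, k) = M (a, k)"
  by (simp add: agree_def)

lemma agree_refl [simp]: "agree X L K M M"
  by (simp add: agree_def)

lemma agree_trans: "agree X L K M M' \<Longrightarrow> agree X L K M' M'' \<Longrightarrow> agree X L K M M''"
  by (simp add: agree_def)

lemma live_mono: "live X L' K' a k \<Longrightarrow> L' \<le> L \<Longrightarrow> K' \<le> K \<Longrightarrow> live X L K a k"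
  by (auto simp: live_def)

lemma agree_mono: "agree X L K M M' \<Longrightarrow> L' \<le> L \<Longrightarrow> K' \<le> K \<Longrightarrow> agree X L' K' M M'"
  unfolding agree_def using live_mono by blast

lemma node_set_uncovered: "node_set (uncovered m X)"
  by unfold_locales (auto simp: uncovered_def)

lemma node_set_owned: "node_set (owned m X u)"
  by unfold_locales (auto simp: owned_def)

text \<open>\<open>repr\<close> mentions \<open>crit\<close> pointers and owners at covered
  hyperedges only, so it depends on live cells alone.\<close>

lemma repr_agree:
  assumes "repr m X M" "agree X L K M M'"
  shows "repr m X M'"
proof -
  have "M' (a, k) = M (a, k)" if "a \<in> {Cover, UncovNext, UncovPrev, CritFirst}" for a k
    using that by (intro agreeD[OF assms(2)]) (auto simp: live_def)
  moreover have "M' (a, k) = M (a, k)" if "a \<in> {CritNext, CritPrev, Owner}" "X k \<noteq> []" for a k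
    using that by (intro agreeD[OF assms(2)]) (auto simp: live_def)
  ultimately show ?thesis using assms(1) unfolding repr_def by (simp add: owned_def)
qed

section \<open>One iteration of update and undo\<close>

definition update_body :: "name com" where
  "update_body =
     (Edg :== EdgeOf\<langle>reg Occ\<rangle>;;
      IF Cover\<langle>reg Edg\<rangle> =\<^sub>e N 0 THEN
       (UncovNext\<langle>UncovPrev\<langle>reg Edg\<rangle>\<rangle> ::= UncovNext\<langle>reg Edg\<rangle>;;
        UncovPrev\<langle>UncovNext\<langle>reg Edg\<rangle>\<rangle> ::= UncovPrev\<langle>reg Edg\<rangle>;;
        CritNext\<langle>reg Edg\<rangle> ::= CritFirst\<langle>reg Vtx\<rangle>;;
        CritPrev\<langle>reg Edg\<rangle> ::= N 0;;
        WHEN CritFirst\<langle>reg Vtx\<rangle> \<noteq>\<^sub>e N 0 DO CritPrev\<langle>CritFirst\<langle>reg Vtx\<rangle>\<rangle> ::= reg Edg;;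
        CritFirst\<langle>reg Vtx\<rangle> ::= reg Edg;;
        Owner\<langle>reg Edg\<rangle> ::= reg Vtx)
      ELSE WHEN Cover\<langle>reg Edg\<rangle> =\<^sub>e N 1 DO
       (IF CritPrev\<langle>reg Edg\<rangle> =\<^sub>e N 0
          THEN CritFirst\<langle>Owner\<langle>reg Edg\<rangle>\<rangle> ::= CritNext\<langle>reg Edg\<rangle>
          ELSE CritNext\<langle>CritPrev\<langle>reg Edg\<rangle>\<rangle> ::= CritNext\<langle>reg Edg\<rangle>;;
        WHEN CritNext\<langle>reg Edg\<rangle> \<noteq>\<^sub>e N 0 DO CritPrev\<langle>CritNext\<langle>reg Edg\<rangle>\<rangle> ::= CritPrev\<langle>reg Edg\<rangle>);;
      Cover\<langle>reg Edg\<rangle> ::= Inc (Cover\<langle>reg Edg\<rangle>);;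
      Occ :== IncNext\<langle>reg Occ\<rangle>)"

definition undo_body :: "name com" where
  "undo_body =
     (Edg :== EdgeOf\<langle>reg Occ\<rangle>;;
      Cover\<langle>reg Edg\<rangle> ::= Dec (Cover\<langle>reg Edg\<rangle>);;
      IF Cover\<langle>reg Edg\<rangle> =\<^sub>e N 0 THEN
       (CritFirst\<langle>reg Vtx\<rangle> ::= CritNext\<langle>reg Edg\<rangle>;;
        WHEN CritNext\<langle>reg Edg\<rangle> \<noteq>\<^sub>e N 0 DO CritPrev\<langle>CritNext\<langle>reg Edg\<rangle>\<rangle> ::= N 0;;
        UncovNext\<langle>UncovPrev\<langle>reg Edg\<rangle>\<rangle> ::= reg Edg;;
        UncovPrev\<langle>UncovNext\<langle>reg Edg\<rangle>\<rangle> ::= reg Edg)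
      ELSE WHEN Cover\<langle>reg Edg\<rangle> =\<^sub>e N 1 DO
       (IF CritPrev\<langle>reg Edg\<rangle> =\<^sub>e N 0
          THEN CritFirst\<langle>Owner\<langle>reg Edg\<rangle>\<rangle> ::= reg Edg
          ELSE CritNext\<langle>CritPrev\<langle>reg Edg\<rangle>\<rangle> ::= reg Edg;;
        WHEN CritNext\<langle>reg Edg\<rangle> \<noteq>\<^sub>e N 0 DO CritPrev\<langle>CritNext\<langle>reg Edg\<rangle>\<rangle> ::= reg Edg);;
      Occ :== IncPrev\<langle>reg Occ\<rangle>)"

lemma update_eq: "update = (Occ :== IncFirst\<langle>reg Vtx\<rangle>;; WHILE reg Occ \<noteq>\<^sub>e N 0 DO update_body)"
  by (simp add: update_def update_body_def)

lemma undo_eq: "undo = (Occ :== IncLast\<langle>reg Vtx\<rangle>;; WHILE reg Occ \<noteq>\<^sub>e N 0 DO undo_body)"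
  by (simp add: undo_def undo_body_def)

lemma straight_bodies: "straight update_body" "straight undo_body"
  by (simp_all add: update_body_def undo_body_def)

lemma steps_bodies: "steps update_body \<le> 20" "steps undo_body \<le> 20"
  by (simp_all add: update_body_def undo_body_def)

locale visit =
  fixes m :: nat and X :: "nat \<Rightarrow> nat list" and M :: "name cell \<Rightarrow> nat" and j v k :: nat
  assumes rep: "repr m X M" and j: "j \<in> {1..m}"
    and Vtx: "M (Vtx, 0) = v" and Occ: "M (Occ, 0) = k" and EdgeOf: "M (EdgeOf, k) = j"

text \<open>The assumption \<open>front\<close> reflects the descending traversal of F(v): whatever
  v already owns has a larger index, so inserting j at the head keeps \<open>crit[v]\<close>
  ascending.\<close>

locale visit_uncovered = visit +
  assumes Xj: "X j = []" and front: "\<And>j'. j' \<in> owned m X v \<Longrightarrow> j < j'"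
begin

definition p :: nat where "p = prv (uncovered m X) j"
definition n :: nat where "n = nxt (uncovered m X) j"
definition q :: nat where "q = nxt (owned m X v) 0"

sublocale U: node_set "uncovered m X" by (rule node_set_uncovered)
sublocale C: node_set "owned m X v" by (rule node_set_owned)

lemma jU: "j \<in> uncovered m X"
  using j Xj by (simp add: uncovered_def)

lemma mem_j: "M (Cover, j) = 0" "M (UncovPrev, j) = p" "M (UncovNext, j) = n" "M (CritFirst, v) = q"
  using rep j Xj jU by (auto simp: repr_def p_def n_def q_def)

text \<open>Rules out aliasing of j with its neighbours, so that reads following the pointer writes
  can be evaluated. \<open>p\<close> and \<open>n\<close> may still coincide, namely at the
  sentinel.\<close>

lemma neq_j: "p \<noteq> j" "n \<noteq> j" "q \<noteq> j"
  using U.prv_neq[OF jU] U.nxt_neq[OF jU] C.nxt_in[of 0] front j by (auto simp: p_def n_def q_def)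

lemma after_update: "after update_body M = (let M1 = M((Edg, 0) := j, (UncovNext, p) := n,
    (UncovPrev, n) := p, (CritNext, j) := q, (CritPrev, j) := 0) in
    (if q \<noteq> 0 then M1((CritPrev, q) := j) else M1)((CritFirst, v) := j, (Owner, j) := v,
      (Cover, j) := 1, (Occ, 0) := M (IncNext, k)))"
  by (simp add: update_body_def mem_j neq_j Vtx Occ EdgeOf Let_def fun_upd_twist)

lemma uncovered_update: "uncovered m (X(j := [v])) = uncovered m X - {j}"
  by (auto simp: uncovered_def)

lemma owned_update:
  "owned m (X(j := [v])) u = (if u = v then insert j (owned m X v) else owned m X u)"
  using j Xj by (auto simp: owned_def)

lemma repr_update: "repr m (X(j := [v])) (after update_body M)"
proof -
  let ?M = "after update_body M"
  have jC: "j \<notin> owned m X u" for u using Xj by (simp add: owned_def)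
  \<comment> \<open>The old head q of \<open>crit[v]\<close> lies in no other \<open>crit\<close>
    list, so the write to its \<open>CritPrev\<close> cell disturbs none of them.\<close>
  have qC: "q \<noteq> 0 \<Longrightarrow> q \<notin> owned m X u" if "u \<noteq> v" for u
    using C.nxt_in[of 0] that by (auto simp: owned_def q_def)
  have j0: "0 < j" using j by simp
  note C_front = C.nxt_front[OF _ j0] C.nxt_behind[OF _ j0] C.prv_front[OF _ j0] C.prv_behind[OF _ j0]
  have "\<forall>i\<in>{1..m}. ?M (Cover, i) = length ((X(j := [v])) i)"
    using rep by (auto simp: after_update Let_def repr_def)
  moreover have "\<forall>i\<in>{1..m}. (X(j := [v])) i \<noteq> [] \<longrightarrow> ?M (Owner, i) = hd ((X(j := [v])) i)"
    using rep by (auto simp: after_update Let_def repr_def)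
  moreover have "\<forall>i\<in>insert 0 (uncovered m X - {j}). ?M (UncovNext, i) = nxt (uncovered m X - {j}) i"
    using rep j0 jU U.nxt_Diff[OF jU] by (auto simp: after_update Let_def repr_def p_def n_def)
  moreover have "\<forall>i\<in>insert 0 (uncovered m X - {j}). ?M (UncovPrev, i) = prv (uncovered m X - {j}) i"
    using rep j0 jU U.prv_Diff[OF jU] by (auto simp: after_update Let_def repr_def p_def n_def)
  moreover have "?M (CritFirst, u) = nxt (owned m (X(j := [v])) u) 0" for u
    using rep front C_front by (auto simp: after_update Let_def repr_def owned_update q_def)
  moreover have "?M (CritNext, i) = nxt (owned m (X(j := [v])) u) i"
    if "i \<in> owned m (X(j := [v])) u" for u i
    using rep front C_front that jC
    by (auto simp: after_update Let_def repr_def owned_update q_def split: if_splits)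
  moreover have "?M (CritPrev, i) = prv (owned m (X(j := [v])) u) i"
    if "i \<in> owned m (X(j := [v])) u" for u i
    using rep front C_front that jC neq_j(3) qC
    by (auto simp: after_update Let_def repr_def owned_update q_def split: if_splits)
  ultimately show ?thesis unfolding repr_def uncovered_update by blast
qed

text \<open>The principle of dancing links: the unlinked node j keeps its own \<open>uncov\<close>
  pointers, so any memory that agrees with the updated one still shows where j has to be put
  back.\<close>

lemma undo_update:
  assumes ag: "agree (X(j := [v])) L K (after update_body M) M'"
    and Vtx': "M' (Vtx, 0) = v" and Occ': "M' (Occ, 0) = k"
  shows "after undo_body M' = (let M1 = M'((Edg, 0) := j, (Cover, j) := 0, (CritFirst, v) := q) in
      (if q \<noteq> 0 then M1((CritPrev, q) := 0) else M1)((UncovNext, p) := j, (UncovPrev, n) := j,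
      (Occ, 0) := M' (IncPrev, k)))" (is ?A)
    and "agree X L K M (after undo_body M')" (is ?B)
    and "M' (EdgeOf, k) = j" "M' (Cover, j) = 1" "M' (CritNext, j) = q" "M' (UncovPrev, j) = p"
      "M' (UncovNext, j) = n"
proof -
  \<comment> \<open>Covering j only adds live cells, so agreement after the update includes every
    cell that was live before it.\<close>
  have *: "M' (a, i) = after update_body M (a, i)" if "live X L K a i \<or> live (X(j := [v])) L K a i" for a i
    using that by (intro agreeD[OF ag]) (auto simp: live_def)
  show mem': "M' (EdgeOf, k) = j" "M' (Cover, j) = 1" "M' (CritNext, j) = q" "M' (UncovPrev, j) = p"
    "M' (UncovNext, j) = n"
    by (subst *, simp add: live_def, simp add: after_update Let_def EdgeOf mem_j neq_j)+
  show A: ?A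
    by (simp add: undo_body_def mem' neq_j neq_j[symmetric] Vtx' Occ' Let_def fun_upd_twist)
  have "q \<noteq> 0 \<Longrightarrow> q \<in> owned m X v" using C.nxt_in[of 0] by (auto simp: q_def)
  then have "M (CritPrev, q) = 0" if "q \<noteq> 0"
    using rep that C.prv_nxt_0 by (auto simp: repr_def q_def)
  moreover have "M (UncovNext, p) = j" using rep U.nxt_prv[OF jU] U.prv_in[of j]
    by (auto simp: repr_def p_def)
  moreover have "M (UncovPrev, n) = j" using rep U.prv_nxt[OF jU] U.nxt_in[of j]
    by (auto simp: repr_def n_def)
  \<comment> \<open>The \<open>crit\<close> node and the owner of j were overwritten and are not
    restored; as F_j is uncovered under \<open>X\<close>, these cells are garbage.\<close>
  moreover have "live X L K a i \<Longrightarrow> i = j \<Longrightarrow> a \<notin> {CritNext, CritPrev, Owner}" for a i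
    using Xj by (auto simp: live_def)
  moreover have "live X L K a i \<Longrightarrow> a \<notin> {Edg, Occ}" for a i
    by (auto simp: live_def)
  ultimately show ?B
    unfolding agree_def A by (auto simp: Let_def * after_update mem_j)
qed

end

locale visit_owned = visit +
  fixes f :: nat
  assumes Xj: "X j = [f]" and fresh: "v \<noteq> f"
begin

definition p :: nat where "p = prv (owned m X f) j"
definition n :: nat where "n = nxt (owned m X f) j"

sublocale C: node_set "owned m X f" by (rule node_set_owned)

lemma jC: "j \<in> owned m X f"
  using j Xj by (simp add: owned_def)

lemma mem_j: "M (Cover, j) = 1" "M (CritPrev, j) = p" "M (CritNext, j) = n" "M (Owner, j) = f"
  using rep j Xj jC by (auto simp: repr_def p_def n_def)

lemma neq_j: "p \<noteq> j" "n \<noteq> j"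
  using C.prv_neq[OF jC] C.nxt_neq[OF jC] by (auto simp: p_def n_def)

lemma after_update: "after update_body M = (let
    M1 = M((Edg, 0) := j);
    M2 = (if p = 0 then M1((CritFirst, f) := n) else M1((CritNext, p) := n));
    M3 = (if n \<noteq> 0 then M2((CritPrev, n) := p) else M2)
    in M3((Cover, j) := Suc 1, (Occ, 0) := M (IncNext, k)))"
  by (simp add: update_body_def mem_j neq_j neq_j[symmetric] Vtx Occ EdgeOf Let_def fun_upd_twist)

lemma uncovered_update: "uncovered m (X(j := [f, v])) = uncovered m X"
  using Xj by (auto simp: uncovered_def)

lemma owned_update:
  "owned m (X(j := [f, v])) u = (if u = f then owned m X f - {j} else owned m X u)"
  using Xj by (auto simp: owned_def)

lemma repr_update: "repr m (X(j := [f, v])) (after update_body M)"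
proof -
  let ?M = "after update_body M" and ?X = "X(j := [f, v])"
  have pn: "p \<noteq> 0 \<Longrightarrow> p \<notin> owned m X u" "n \<noteq> 0 \<Longrightarrow> n \<notin> owned m X u" if "u \<noteq> f" for u
    using C.prv_in[of j] C.nxt_in[of j] that by (auto simp: owned_def p_def n_def)
  have j0: "j \<noteq> 0" using j by simp
  have z: "0 \<notin> owned m X u" for u by (simp add: owned_def)
  have "\<forall>i\<in>{1..m}. ?M (Cover, i) = length (?X i)"
    using rep by (auto simp: after_update Let_def repr_def)
  moreover have "\<forall>i\<in>{1..m}. ?X i \<noteq> [] \<longrightarrow> ?M (Owner, i) = hd (?X i)"
    using rep mem_j by (auto simp: after_update Let_def repr_def)
  moreover have "\<forall>i\<in>insert 0 (uncovered m X). ?M (UncovNext, i) = nxt (uncovered m X) i"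
    using rep by (auto simp: after_update Let_def repr_def)
  moreover have "\<forall>i\<in>insert 0 (uncovered m X). ?M (UncovPrev, i) = prv (uncovered m X) i"
    using rep by (auto simp: after_update Let_def repr_def)
  moreover have "?M (CritFirst, u) = nxt (owned m ?X u) 0" for u
    using rep j0 C.nxt_Diff[OF jC] by (auto simp: after_update Let_def repr_def owned_update p_def n_def)
  moreover have "?M (CritNext, i) = nxt (owned m ?X u) i" if "i \<in> owned m ?X u" for u i
    using rep that C.nxt_Diff[OF jC] pn z
    by (auto simp: after_update Let_def repr_def owned_update p_def n_def split: if_splits)
  moreover have "?M (CritPrev, i) = prv (owned m ?X u) i" if "i \<in> owned m ?X u" for u i
    using rep that C.prv_Diff[OF jC] pn z
    by (auto simp: after_update Let_def repr_def owned_update p_def n_def split: if_splits)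
  ultimately show ?thesis unfolding repr_def uncovered_update by blast
qed

text \<open>A hyperedge that has just left \<open>crit[f]\<close> is still covered, so its
  \<open>crit\<close> node and owner are live and the undo step can read p, n and f from them. The
  case p = 0 means that the head pointer of \<open>crit[f]\<close> has to be restored.\<close>

lemma undo_update:
  assumes ag: "agree (X(j := [f, v])) L K (after update_body M) M'"
    and Vtx': "M' (Vtx, 0) = v" and Occ': "M' (Occ, 0) = k"
  shows "after undo_body M' = (let
      M1 = M'((Edg, 0) := j, (Cover, j) := 1);
      M2 = (if p = 0 then M1((CritFirst, f) := j) else M1((CritNext, p) := j));
      M3 = (if n \<noteq> 0 then M2((CritPrev, n) := j) else M2)
      in M3((Occ, 0) := M' (IncPrev, k)))" (is ?A)
    and "agree X L K M (after undo_body M')" (is ?B)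
    and "M' (EdgeOf, k) = j" "M' (Cover, j) = 2" "M' (CritPrev, j) = p" "M' (CritNext, j) = n" "M' (Owner, j) = f"
proof -
  have *: "M' (a, i) = after update_body M (a, i)" if "live X L K a i \<or> live (X(j := [f, v])) L K a i" for a i
    using that Xj by (intro agreeD[OF ag]) (auto simp: live_def)
  show mem': "M' (Cover, j) = 2" "M' (CritPrev, j) = p" "M' (CritNext, j) = n" "M' (Owner, j) = f"
    by (subst *, simp add: live_def, simp add: after_update Let_def EdgeOf mem_j neq_j neq_j[symmetric])+
  show e: "M' (EdgeOf, k) = j"
    by (subst *, simp add: live_def, simp add: after_update Let_def EdgeOf)
  with mem' show A: ?A
    by (simp add: undo_body_def mem' neq_j neq_j[symmetric] Vtx' Occ' Let_def fun_upd_twist)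
  have "M (CritNext, p) = j" if "p \<noteq> 0" using that rep C.nxt_prv[OF jC] C.prv_in[of j]
    by (auto simp: repr_def p_def)
  moreover have "M (CritFirst, f) = j" if "p = 0" using that rep C.nxt_prv[OF jC]
    by (auto simp: repr_def p_def)
  moreover have "M (CritPrev, n) = j" if "n \<noteq> 0" using that rep C.prv_nxt[OF jC] C.nxt_in[of j]
    by (auto simp: repr_def n_def)
  moreover have "live X L K a i \<Longrightarrow> a \<notin> {Edg, Occ}" for a i
    by (auto simp: live_def)
  ultimately show ?B
    unfolding agree_def A by (auto simp: Let_def * after_update mem_j)
qed

end

text \<open>Such a hyperedge belongs to neither kind of list, before and after; only its counter
  changes.\<close>

locale visit_covered = visit +
  assumes Xj: "2 \<le> length (X j)"
begin

lemma Xj_nonempty [simp]: "X j \<noteq> []"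
  using Xj by auto

lemma Cover_j: "M (Cover, j) = length (X j)"
  using rep j by (simp add: repr_def)

lemma after_update: "after update_body M =
    M((Edg, 0) := j, (Cover, j) := Suc (length (X j)), (Occ, 0) := M (IncNext, k))"
  using Xj by (simp add: update_body_def Cover_j Vtx Occ EdgeOf Let_def fun_upd_twist)

lemma uncovered_update: "uncovered m (X(j := X j @ [v])) = uncovered m X"
  using Xj by (auto simp: uncovered_def)

lemma owned_update: "owned m (X(j := X j @ [v])) u = owned m X u"
  using Xj by (auto simp: owned_def)

lemma repr_update: "repr m (X(j := X j @ [v])) (after update_body M)"
proof -
  show ?thesis
    using rep by (simp add: repr_def after_update uncovered_update owned_update)
qed

lemma undo_update:
  assumes ag: "agree (X(j := X j @ [v])) L K (after update_body M) M'"
    and Vtx': "M' (Vtx, 0) = v" and Occ': "M' (Occ, 0) = k"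
  shows "after undo_body M' = M'((Edg, 0) := j, (Cover, j) := length (X j), (Occ, 0) := M' (IncPrev, k))"
      (is ?A)
    and "agree X L K M (after undo_body M')" (is ?B)
    and "M' (EdgeOf, k) = j" "M' (Cover, j) = Suc (length (X j))"
proof -
  have *: "M' (a, i) = after update_body M (a, i)" if "live X L K a i" for a i
    using that Xj by (intro agreeD[OF ag]) (auto simp: live_def)
  show c: "M' (Cover, j) = Suc (length (X j))"
    by (subst *, simp add: live_def, simp add: after_update)
  show "M' (EdgeOf, k) = j"
    by (subst *, simp add: live_def, simp add: after_update EdgeOf)
  then show A: ?A
    using Xj by (simp add: undo_body_def c Vtx' Occ' Let_def fun_upd_twist)
  have "live X L K a i \<Longrightarrow> a \<notin> {Edg, Occ}" for a i
    by (auto simp: live_def)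
  then show ?B
    unfolding agree_def A by (auto simp: * after_update Cover_j)
qed

end

context visit
begin

text \<open>Joins the three cases of zero, one or more chosen elements in F_j. The set
  \<open>I\<close> collects all array indices that an iteration can use and later yields the space
  bound. The last conclusion treats the undo step for every memory that agrees with the updated one,
  since recursive calls run in between.\<close>

lemma update_body_correct:
  assumes fresh: "v \<notin> set (X j)" and front: "\<forall>j'\<in>owned m X v. j < j'"
    and I: "0 \<in> I" "{1..m} \<subseteq> I" "k \<in> I" "v \<in> I" "set (X j) \<subseteq> I"
  shows "repr m (X(j := X j @ [v])) (after update_body M)"
    and "after update_body M (Occ, 0) = M (IncNext, k)"
    and "\<And>a i. a \<notin> {UncovNext, UncovPrev, CritFirst, CritNext, CritPrev, Cover, Owner, Edg, Occ} \<Longrightarrow>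
      after update_body M (a, i) = M (a, i)"
    and "touched update_body M \<subseteq> UNIV \<times> I"
    and "agree (X(j := X j @ [v])) L K (after update_body M) M' \<Longrightarrow> M' (Vtx, 0) = v \<Longrightarrow>
      M' (Occ, 0) = k \<Longrightarrow> agree X L K M (after undo_body M') \<and> touched undo_body M' \<subseteq> UNIV \<times> I \<and>
        after undo_body M' (Occ, 0) = M' (IncPrev, k) \<and>
        (\<forall>a\<in>{Vtx, Chosen, Index, Pos}. \<forall>i. after undo_body M' (a, i) = M' (a, i))"
proof -
  have jI: "j \<in> I" using j I by auto
  have ui: "i \<in> I" if "i \<in> insert 0 (uncovered m X)" for i
    using that I by (auto simp: uncovered_def)
  have ci: "i \<in> I" if "i \<in> insert 0 (owned m X u)" for u i
    using that I by (auto simp: owned_def)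
  \<comment> \<open>\<open>remdups_adj.cases\<close> serves only to split lists into empty,
    singleton and longer ones.\<close>
  consider "X j = []" | u where "X j = [u]" | "2 \<le> length (X j)"
    by (cases "X j" rule: remdups_adj.cases) auto
  then have "repr m (X(j := X j @ [v])) (after update_body M) \<and>
    after update_body M (Occ, 0) = M (IncNext, k) \<and>
    (\<forall>a i. a \<notin> {UncovNext, UncovPrev, CritFirst, CritNext, CritPrev, Cover, Owner, Edg, Occ} \<longrightarrow>
      after update_body M (a, i) = M (a, i)) \<and>
    touched update_body M \<subseteq> UNIV \<times> I \<and>
    (agree (X(j := X j @ [v])) L K (after update_body M) M' \<longrightarrow> M' (Vtx, 0) = v \<longrightarrow>
      M' (Occ, 0) = k \<longrightarrow> agree X L K M (after undo_body M') \<and> touched undo_body M' \<subseteq> UNIV \<times> I \<and>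
        after undo_body M' (Occ, 0) = M' (IncPrev, k) \<and>
        (\<forall>a\<in>{Vtx, Chosen, Index, Pos}. \<forall>i. after undo_body M' (a, i) = M' (a, i)))"
  proof cases
    case 1
    interpret visit_uncovered m X M j v k by unfold_locales (use 1 front in auto)
    have pnq: "p \<in> I" "n \<in> I" "q \<in> I"
      using U.prv_in[of j] U.nxt_in[of j] C.nxt_in[of 0] ui ci by (auto simp: p_def n_def q_def)
    have t: "touched update_body M \<subseteq> UNIV \<times> I"
      using pnq I jI by (simp add: update_body_def mem_j neq_j neq_j[symmetric] Vtx Occ EdgeOf)
    have u: "touched undo_body M' \<subseteq> UNIV \<times> I \<and>
        after undo_body M' (Occ, 0) = M' (IncPrev, k) \<and>
        (\<forall>a\<in>{Vtx, Chosen, Index, Pos}. \<forall>i. after undo_body M' (a, i) = M' (a, i))"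
      if "agree (X(j := [v])) L K (after update_body M) M'" "M' (Vtx, 0) = v" "M' (Occ, 0) = k"
    proof -
      note undo = undo_update[OF that]
      show ?thesis
        using pnq I jI undo(3-) that
        by (simp add: undo(1) Let_def) (simp add: undo_body_def neq_j neq_j[symmetric])
    qed
    show ?thesis using repr_update t u undo_update(2) 1 by (auto simp: after_update Let_def)
  next
    case (2 f)
    interpret visit_owned m X M j v k f by unfold_locales (use 2 fresh in auto)
    have pn: "p \<in> I" "n \<in> I" "f \<in> I"
      using C.prv_in[of j] C.nxt_in[of j] ci I 2 by (auto simp: p_def n_def)
    have t: "touched update_body M \<subseteq> UNIV \<times> I"
      using pn I jI by (simp add: update_body_def mem_j neq_j neq_j[symmetric] Vtx Occ EdgeOf)
    have u: "touched undo_body M' \<subseteq> UNIV \<times> I \<and>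
        after undo_body M' (Occ, 0) = M' (IncPrev, k) \<and>
        (\<forall>a\<in>{Vtx, Chosen, Index, Pos}. \<forall>i. after undo_body M' (a, i) = M' (a, i))"
      if "agree (X(j := [f, v])) L K (after update_body M) M'" "M' (Vtx, 0) = v" "M' (Occ, 0) = k"
    proof -
      note undo = undo_update[OF that]
      show ?thesis
        using pn I jI undo(3-) that
        by (simp add: undo(1) Let_def) (simp add: undo_body_def neq_j neq_j[symmetric])
    qed
    show ?thesis using repr_update t u undo_update(2) 2 by (auto simp: after_update Let_def)
  next
    case 3
    interpret visit_covered m X M j v k by unfold_locales (use 3 in auto)
    have t: "touched update_body M \<subseteq> UNIV \<times> I"
      using 3 I jI by (simp add: update_body_def Cover_j Vtx Occ EdgeOf)
    have u: "touched undo_body M' \<subseteq> UNIV \<times> I \<and>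
        after undo_body M' (Occ, 0) = M' (IncPrev, k) \<and>
        (\<forall>a\<in>{Vtx, Chosen, Index, Pos}. \<forall>i. after undo_body M' (a, i) = M' (a, i))"
      if "agree (X(j := X j @ [v])) L K (after update_body M) M'" "M' (Vtx, 0) = v" "M' (Occ, 0) = k"
    proof -
      note undo = undo_update[OF that]
      show ?thesis
        using 3 I jI undo(3-) that
        by (simp add: undo(1) Let_def) (simp add: undo_body_def)
    qed
    show ?thesis using repr_update t u undo_update(2) by (auto simp: after_update)
  qed
  then show "repr m (X(j := X j @ [v])) (after update_body M)"
    and "after update_body M (Occ, 0) = M (IncNext, k)"
    and "\<And>a i. a \<notin> {UncovNext, UncovPrev, CritFirst, CritNext, CritPrev, Cover, Owner, Edg, Occ} \<Longrightarrow>
      after update_body M (a, i) = M (a, i)"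
    and "touched update_body M \<subseteq> UNIV \<times> I"
    and "agree (X(j := X j @ [v])) L K (after update_body M) M' \<Longrightarrow> M' (Vtx, 0) = v \<Longrightarrow>
      M' (Occ, 0) = k \<Longrightarrow> agree X L K M (after undo_body M') \<and> touched undo_body M' \<subseteq> UNIV \<times> I \<and>
        after undo_body M' (Occ, 0) = M' (IncPrev, k) \<and>
        (\<forall>a\<in>{Vtx, Chosen, Index, Pos}. \<forall>i. after undo_body M' (a, i) = M' (a, i))"
    by blast+
qed

end


section \<open>The loops over the hyperedges of a vertex\<close>

fun path :: "(nat \<Rightarrow> nat) \<Rightarrow> nat \<Rightarrow> nat list \<Rightarrow> bool" where
  "path f x [] \<longleftrightarrow> x = 0"
| "path f x (k # ks) \<longleftrightarrow> x = k \<and> k \<noteq> 0 \<and> path f (f k) ks"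

lemma path_cong: "path f x ks \<Longrightarrow> (\<And>k. k \<in> set ks \<Longrightarrow> g k = f k) \<Longrightarrow> path g x ks"
  by (induction ks arbitrary: x) auto

locale encoded =
  fixes Es :: "nat list list" and Fs :: "nat set list"
  assumes enum: "enumerates Es Fs"
begin

section \<open>Arithmetic of the input encoding\<close>

definition m :: nat where "m = length Es"

definition incidences :: "(nat \<times> nat) list" where
  "incidences = concat (map (\<lambda>j. map (Pair j) (Es ! (j - 1))) [1..<Suc m])"

definition sz :: nat where "sz = length incidences"

definition edge_at :: "nat \<Rightarrow> nat" where "edge_at k = fst (incidences ! (k - 1))"
definition elt_at :: "nat \<Rightarrow> nat" where "elt_at k = snd (incidences ! (k - 1))"

definition start :: "nat \<Rightarrow> nat" where "start j = length (concat (take (j - 1) Es)) + 1"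

text \<open>The bound \<open>p\<close> allows for incidence lists that are only partly built;
  \<open>occ\<close> is the completed case.\<close>

definition occs :: "nat \<Rightarrow> nat \<Rightarrow> nat list" where
  "occs v p = filter (\<lambda>k. elt_at k = v) [1..<p]"

abbreviation occ :: "nat \<Rightarrow> nat list" where "occ v \<equiv> occs v (Suc sz)"

definition verts :: "nat set" where "verts = \<Union>(set Fs)"

text \<open>The initial segment covers hyperedges up to m + 1, positions up to sz + 1 and stack
  levels. Vertices are arbitrary naturals, but space counts accessed cells and not the largest
  address, so adding \<open>verts\<close> costs at most sz indices.\<close>

definition idx :: "nat set" where "idx = {..m + sz + 2} \<union> verts"

lemma length_Fs: "length Fs = m"
  using enum by (simp add: enumerates_def m_def list_all2_lengthD)

lemma edge_eq:
  assumes "j \<in> {1..m}"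
  shows "edge Fs j = set (Es ! (j - 1))" "distinct (Es ! (j - 1))"
proof -
  have "j - 1 < length Es" using assms by (auto simp: m_def)
  then show "edge Fs j = set (Es ! (j - 1))" "distinct (Es ! (j - 1))"
    using enum list_all2_nthD[of _ Es Fs "j - 1"] by (auto simp: enumerates_def edge_def)
qed

lemma edge_subset_verts: "j \<in> {1..m} \<Longrightarrow> edge Fs j \<subseteq> verts"
  using set_eq_edges[of Fs] length_Fs by (auto simp: verts_def)

lemma verts_eq: "verts = set (concat Es)"
proof -
  have "set Fs = set ` set Es"
    using enum unfolding enumerates_def by (induction rule: list_all2_induct) auto
  then show ?thesis by (simp add: verts_def)
qed

lemma finite_verts [simp]: "finite verts"
  unfolding verts_eq by simp

text \<open>The machine sees only vertices that occur in hyperedges, so depth and space are measured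
  by \<open>verts\<close> and not by the given vertex set.\<close>

lemma hypergraph_verts: "hypergraph verts Fs"
  by (auto simp: hypergraph_def verts_def[symmetric]) (auto simp: verts_def)

lemma map_snd_incidences: "map snd incidences = concat Es"
proof -
  have "map snd incidences = concat (map (\<lambda>j. Es ! (j - 1)) [1..<Suc m])"
    by (simp add: incidences_def map_concat comp_def)
  also have "map (\<lambda>j. Es ! (j - 1)) [1..<Suc m] = Es"
    by (rule nth_equalityI) (auto simp: m_def nth_upt simp del: upt_Suc)
  finally show ?thesis .
qed

lemma sz_eq: "sz = length (concat Es)"
  using arg_cong[OF map_snd_incidences, of length] by (simp add: sz_def)

lemma total_size_eq: "total_size Fs = sz"
proof -
  have "total_size Fs = sum_list (map length Es)"
    using enum unfolding enumerates_def total_size_def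
    by (induction rule: list_all2_induct) (auto simp: distinct_card)
  then show ?thesis by (simp add: sz_eq length_concat)
qed

lemma elt_at_eq: "k \<in> {1..sz} \<Longrightarrow> elt_at k = concat Es ! (k - 1)"
  unfolding elt_at_def map_snd_incidences[symmetric] by (subst nth_map) (auto simp: sz_def)

lemma edge_at_range: "k \<in> {1..sz} \<Longrightarrow> edge_at k \<in> {1..m}"
proof -
  assume "k \<in> {1..sz}"
  then have "incidences ! (k - 1) \<in> set incidences" by (intro nth_mem) (auto simp: sz_def)
  then show ?thesis by (auto simp: incidences_def edge_at_def simp del: upt_Suc)
qed

lemma start_Suc: "j \<in> {1..m} \<Longrightarrow> start (Suc j) = start j + length (Es ! (j - 1))"
  by (cases j) (auto simp: start_def m_def take_Suc_conv_app_nth)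

lemma start_1: "start 1 = 1"
  by (simp add: start_def)

lemma start_last: "start (Suc m) = Suc sz"
  by (simp add: start_def m_def sz_eq)

lemma start_mono: "i \<le> j \<Longrightarrow> start i \<le> start j"
proof -
  assume "i \<le> j"
  then have "take (i - 1) Es = take (i - 1) (take (j - 1) Es)" by (simp add: min_def)
  then have "concat (take (j - 1) Es) = concat (take (i - 1) Es) @ concat (drop (i - 1) (take (j - 1) Es))"
    by (metis append_take_drop_id concat_append)
  then show ?thesis by (simp add: start_def)
qed

lemma start_le: "j \<le> Suc m \<Longrightarrow> start j \<le> Suc sz"
  using start_mono[of j "Suc m"] start_last by simp

lemma incidence_at:
  assumes "j \<in> {1..m}" "l < length (Es ! (j - 1))"
  shows "edge_at (start j + l) = j" "elt_at (start j + l) = Es ! (j - 1) ! l"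
    "start j + l \<in> {1..sz}"
proof -
  let ?f = "\<lambda>j. map (Pair j) (Es ! (j - 1))"
  have len: "length (concat (map ?f [1..<Suc i])) = length (concat (take i Es))" if "i \<le> m" for i
    using that
  proof (induction i)
    case (Suc i)
    then show ?case by (simp add: take_Suc_conv_app_nth m_def)
  qed simp
  have "[1..<Suc m] = [1..<j] @ j # [Suc j..<Suc m]"
    using assms(1) upt_add_eq_append[of 1 j "Suc m - j"] by (simp add: upt_conv_Cons del: upt_Suc)
  then have inc: "incidences = concat (map ?f [1..<j]) @ ?f j @ concat (map ?f [Suc j..<Suc m])"
    by (simp add: incidences_def del: upt_Suc)
  have st: "length (concat (map ?f [1..<j])) = start j - 1"
  proof -
    have "j - 1 \<le> m" "Suc (j - 1) = j" using assms(1) by auto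
    with len[of "j - 1"] show ?thesis by (simp only: start_def diff_add_inverse2)
  qed
  have "incidences ! (start j + l - 1) = ?f j ! l"
    unfolding inc using st assms(2) by (simp add: nth_append start_def del: upt_Suc)
  then show "edge_at (start j + l) = j" "elt_at (start j + l) = Es ! (j - 1) ! l"
    using assms(2) by (simp_all add: edge_at_def elt_at_def)
  have "start j + l < start (Suc j)" using start_Suc[OF assms(1)] assms(2) by simp
  also have "\<dots> \<le> Suc sz" using start_le assms(1) by simp
  finally show "start j + l \<in> {1..sz}" by (simp add: start_def)
qed

lemma map_filter_positions:
  "map (\<lambda>k. f (xs ! (k - 1))) (filter (\<lambda>k. P (xs ! (k - 1))) [1..<Suc (length xs)]) = map f (filter P xs)"
proof -
  have "[1..<Suc (length xs)] = map Suc [0..<length xs]" by (simp add: map_Suc_upt)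
  moreover have "filter P xs = filter P (map ((!) xs) [0..<length xs])" by (simp add: map_nth)
  ultimately show ?thesis by (simp add: filter_map comp_def del: upt_Suc)
qed

lemma filter_eq_distinct: "distinct xs \<Longrightarrow> filter (\<lambda>x. x = v) xs = (if v \<in> set xs then [v] else [])"
  by (induction xs) auto

lemma concat_map_if: "concat (map (\<lambda>j. if P j then [j] else []) xs) = filter P xs"
  by (induction xs) auto

text \<open>The input lists have no repetitions, so v has at most one position in each hyperedge.
  Hence walking through the positions of v enumerates F(v) once, in ascending order.\<close>

lemma edge_at_occ: "map edge_at (occ v) = filter (\<lambda>j. v \<in> edge Fs j) [1..<Suc m]"
proof -
  have "map edge_at (occ v) = map fst (filter (\<lambda>q. snd q = v) incidences)"
    unfolding edge_at_def occs_def elt_at_def sz_def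
    by (rule map_filter_positions[of fst incidences "\<lambda>q. snd q = v"])
  also have "\<dots> = concat (map (\<lambda>j. map fst (filter (\<lambda>q. snd q = v) (map (Pair j) (Es ! (j - 1))))) [1..<Suc m])"
    by (simp add: incidences_def filter_concat map_concat comp_def del: upt_Suc)
  also have "map (\<lambda>j. map fst (filter (\<lambda>q. snd q = v) (map (Pair j) (Es ! (j - 1))))) [1..<Suc m] =
      map (\<lambda>j. if v \<in> edge Fs j then [j] else []) [1..<Suc m]"
  proof (rule map_cong)
    fix j assume "j \<in> set [1..<Suc m]"
    then have j: "j \<in> {1..m}" by auto
    have "map fst (filter (\<lambda>q. snd q = v) (map (Pair j) xs)) = (if v \<in> set xs then [j] else [])"
      if "distinct xs" for xs
      using that by (simp add: filter_map comp_def filter_eq_distinct)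
    from this[OF edge_eq(2)[OF j]] show "map fst (filter (\<lambda>q. snd q = v) (map (Pair j) (Es ! (j - 1)))) =
      (if v \<in> edge Fs j then [j] else [])" by (simp only: edge_eq(1)[OF j])
  qed simp
  also have "concat \<dots> = filter (\<lambda>j. v \<in> edge Fs j) [1..<Suc m]"
    by (rule concat_map_if)
  finally show ?thesis .
qed

lemma set_occ: "set (occ v) \<subseteq> {1..sz}"
  by (auto simp: occs_def simp del: upt_Suc)

lemma edges_occ: "edge_at ` set (occ v) = {j \<in> {1..m}. v \<in> edge Fs j}"
  unfolding set_map[symmetric] edge_at_occ by auto

lemma sorted_edges_occ: "sorted_wrt (>) (map edge_at (rev (occ v)))"
  unfolding rev_map[symmetric] edge_at_occ sorted_wrt_rev
  by (intro sorted_wrt_filter) (simp add: strict_sorted_iff[symmetric] del: upt_Suc)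

lemma sum_length_occ:
  assumes "distinct vs"
  shows "(\<Sum>v\<leftarrow>vs. length (occ v)) \<le> sz"
proof -
  have l: "length (occ v) = card {k \<in> {1..sz}. elt_at k = v}" for v
  proof -
    have "{k \<in> {1..sz}. elt_at k = v} = set (occ v)" by (auto simp: occs_def simp del: upt_Suc)
    moreover have "distinct (occ v)" by (simp add: occs_def del: upt_Suc)
    ultimately show ?thesis by (simp only: distinct_card)
  qed
  have "(\<Sum>v\<leftarrow>vs. length (occ v)) = (\<Sum>v\<in>set vs. card {k \<in> {1..sz}. elt_at k = v})"
    using assms l by (simp add: sum_list_distinct_conv_sum_set)
  also have "\<dots> = card (\<Union>v\<in>set vs. {k \<in> {1..sz}. elt_at k = v})"
    by (rule card_UN_disjoint[symmetric]) auto
  also have "\<dots> \<le> card {1..sz}" by (intro card_mono) auto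
  finally show ?thesis by simp
qed

lemma card_verts: "card verts \<le> sz"
  unfolding verts_eq sz_eq by (rule card_length)

lemma finite_idx [simp]: "finite idx"
  by (simp add: idx_def)

lemma card_idx: "card idx \<le> m + 2 * sz + 3"
proof -
  have "card idx \<le> card {..m + sz + 2} + card verts" unfolding idx_def by (rule card_Un_le)
  then show ?thesis using card_verts by simp
qed

abbreviation cells :: "name cell set" where "cells \<equiv> UNIV \<times> idx"

section \<open>The update and undo loops\<close>

definition static :: "(name cell \<Rightarrow> nat) \<Rightarrow> bool" where
  "static M \<longleftrightarrow> M (NumEdges, 0) = m \<and> (\<forall>j\<in>{1..Suc m}. M (Start, j) = start j) \<and>
     (\<forall>k\<in>{1..sz}. M (Elt, k) = elt_at k \<and> M (EdgeOf, k) = edge_at k) \<and>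
     (\<forall>v. path (\<lambda>k. M (IncNext, k)) (M (IncFirst, v)) (rev (occ v))) \<and>
     (\<forall>v. path (\<lambda>k. M (IncPrev, k)) (M (IncLast, v)) (occ v))"

lemma static_cong:
  assumes "static M"
    and "\<And>a i. a \<in> {NumEdges, Start, Elt, EdgeOf, IncFirst, IncLast, IncNext, IncPrev} \<Longrightarrow> M' (a, i) = M (a, i)"
  shows "static M'"
  using assms(1) by (simp add: static_def assms(2))

lemma static_agree: "agree X L K M M' \<Longrightarrow> static M \<Longrightarrow> static M'"
  by (erule static_cong, erule agreeD) (auto simp: live_def)

definition add :: "nat \<Rightarrow> nat set \<Rightarrow> (nat \<Rightarrow> nat list) \<Rightarrow> nat \<Rightarrow> nat list" where
  "add v D X = (\<lambda>j. if j \<in> D then X j @ [v] else X j)"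

abbreviation update_loop :: "name com" where "update_loop \<equiv> WHILE reg Occ \<noteq>\<^sub>e N 0 DO update_body"
abbreviation undo_loop :: "name com" where "undo_loop \<equiv> WHILE reg Occ \<noteq>\<^sub>e N 0 DO undo_body"

lemma idx_facts: "0 \<in> idx" "{1..m} \<subseteq> idx" "k \<le> Suc sz \<Longrightarrow> k \<in> idx" "v \<in> verts \<Longrightarrow> v \<in> idx"
  by (auto simp: idx_def)

text \<open>The undo loop is described by what it does before the rest of its traversal, as it visits the
  hyperedges in the reverse order.\<close>

lemma update_loop_correct:
  assumes "static M" "repr m X M" "M (Vtx, 0) = v" "path (\<lambda>k. M (IncNext, k)) (M (Occ, 0)) ks"
    and "set ks \<subseteq> {1..sz}" "sorted_wrt (>) (map edge_at ks)"
    and "\<And>k. k \<in> set ks \<Longrightarrow> v \<notin> set (X (edge_at k))"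
    and "\<And>k j'. k \<in> set ks \<Longrightarrow> j' \<in> owned m X v \<Longrightarrow> edge_at k < j'"
    and "v \<in> verts" "\<And>j. set (X j) \<subseteq> verts"
  shows "\<exists>M'. runs p update_loop (M, w) (21 * length ks + 1) cells d (M', w) \<and>
    repr m (add v (edge_at ` set ks) X) M' \<and>
    (\<forall>a i. a \<notin> {UncovNext, UncovPrev, CritFirst, CritNext, CritPrev, Cover, Owner, Edg, Occ} \<longrightarrow>
      M' (a, i) = M (a, i)) \<and>
    (\<forall>M2 rest. agree (add v (edge_at ` set ks) X) L K M' M2 \<longrightarrow> M2 (Vtx, 0) = v \<longrightarrow>
      path (\<lambda>k. M2 (IncPrev, k)) (M2 (Occ, 0)) (rev ks @ rest) \<longrightarrow>
      (\<exists>M3. agree X L K M M3 \<and> M3 (Vtx, 0) = v \<and> path (\<lambda>k. M3 (IncPrev, k)) (M3 (Occ, 0)) rest \<and>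
        (\<forall>a\<in>{Chosen, Index, Pos}. \<forall>i. M3 (a, i) = M2 (a, i)) \<and>
        (\<forall>w n t. runs p undo_loop (M3, w) n cells d t \<longrightarrow>
          runs p undo_loop (M2, w) (21 * length ks + n) cells d t)))"
  using assms
proof (induction ks arbitrary: M X)
  case Nil
  have "runs p update_loop (M, w) 1 cells d (M, w)"
    using Nil by (intro runs_WhileFalse) (auto simp: idx_facts)
  moreover have "add v {} X = X" by (simp add: add_def)
  ultimately show ?case using Nil by (intro exI[of _ M]) auto
next
  case (Cons k ks)
  let ?j = "edge_at k"
  have k: "k \<in> {1..sz}" using Cons.prems(5) by simp
  have j: "?j \<in> {1..m}" using edge_at_range[OF k] .
  have at_k: "M (Occ, 0) = k" "k \<noteq> 0" "path (\<lambda>k. M (IncNext, k)) (M (IncNext, k)) ks"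
    using Cons.prems(4) by simp_all
  have EdgeOf: "M (EdgeOf, k) = ?j" using Cons.prems(1) k by (simp add: static_def)
  interpret visit m X M ?j v k
    by unfold_locales (use Cons.prems(2,3) at_k EdgeOf j in auto)
  let ?M = "after update_body M" and ?X = "X(?j := X ?j @ [v])"
  have fresh: "v \<notin> set (X ?j)" and front: "\<forall>j'\<in>owned m X v. ?j < j'"
    using Cons.prems(7,8)[of k] by auto
  have I: "0 \<in> idx" "{1..m} \<subseteq> idx" "k \<in> idx" "v \<in> idx" "set (X ?j) \<subseteq> idx"
    using idx_facts k Cons.prems(9) Cons.prems(10)[of ?j] by auto
  note body = update_body_correct[OF fresh front I]
  have less: "edge_at k' < ?j" if "k' \<in> set ks" for k' using Cons.prems(6) that by simp
  \<comment> \<open>The indices strictly descend, so F_j does not occur again later and v is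
    appended to its list just once.\<close>
  have add_eq: "add v (edge_at ` set ks) ?X = add v (edge_at ` set (k # ks)) X"
    using less by (fastforce simp: add_def)
  have fr: "?M (a, i) = M (a, i)"
    if "a \<notin> {UncovNext, UncovPrev, CritFirst, CritNext, CritPrev, Cover, Owner, Edg, Occ}" for a i
    using body(3) that .
  have "\<exists>M'. runs p update_loop (?M, w) (21 * length ks + 1) cells d (M', w) \<and>
    repr m (add v (edge_at ` set ks) ?X) M' \<and>
    (\<forall>a i. a \<notin> {UncovNext, UncovPrev, CritFirst, CritNext, CritPrev, Cover, Owner, Edg, Occ} \<longrightarrow>
      M' (a, i) = ?M (a, i)) \<and>
    (\<forall>M2 rest. agree (add v (edge_at ` set ks) ?X) L K M' M2 \<longrightarrow> M2 (Vtx, 0) = v \<longrightarrow>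
      path (\<lambda>k. M2 (IncPrev, k)) (M2 (Occ, 0)) (rev ks @ rest) \<longrightarrow>
      (\<exists>M3. agree ?X L K ?M M3 \<and> M3 (Vtx, 0) = v \<and> path (\<lambda>k. M3 (IncPrev, k)) (M3 (Occ, 0)) rest \<and>
        (\<forall>a\<in>{Chosen, Index, Pos}. \<forall>i. M3 (a, i) = M2 (a, i)) \<and>
        (\<forall>w n t. runs p undo_loop (M3, w) n cells d t \<longrightarrow>
          runs p undo_loop (M2, w) (21 * length ks + n) cells d t)))"
  proof (rule Cons.IH)
    show "static ?M" using Cons.prems(1) by (rule static_cong) (rule fr, auto)
    show "repr m ?X ?M" by (rule body(1))
    show "?M (Vtx, 0) = v" using Cons.prems(3) by (simp add: fr)
    show "path (\<lambda>k. ?M (IncNext, k)) (?M (Occ, 0)) ks" using at_k(3) by (simp add: fr body(2))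
    show "set ks \<subseteq> {1..sz}" "sorted_wrt (>) (map edge_at ks)" "v \<in> verts" using Cons.prems by simp_all
    show "v \<notin> set (?X (edge_at k'))" if "k' \<in> set ks" for k'
      using Cons.prems(7)[of k'] less[OF that] that by simp
    \<comment> \<open>The set owned by v may have gained j itself, which exceeds all hyperedges
      still to come.\<close>
    show "edge_at k' < j'" if "k' \<in> set ks" "j' \<in> owned m ?X v" for k' j'
      using Cons.prems(8)[of k' j'] less[OF that(1)] that by (auto simp: owned_def split: if_splits)
    show "set (?X j) \<subseteq> verts" for j using Cons.prems(9,10) by simp
  qed
  then obtain M' where M': "runs p update_loop (?M, w) (21 * length ks + 1) cells d (M', w)"
    "repr m (add v (edge_at ` set ks) ?X) M'"
    "\<forall>a i. a \<notin> {UncovNext, UncovPrev, CritFirst, CritNext, CritPrev, Cover, Owner, Edg, Occ} \<longrightarrow>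
      M' (a, i) = ?M (a, i)"
    and undo: "\<And>M2 rest. agree (add v (edge_at ` set ks) ?X) L K M' M2 \<Longrightarrow> M2 (Vtx, 0) = v \<Longrightarrow>
      path (\<lambda>k. M2 (IncPrev, k)) (M2 (Occ, 0)) (rev ks @ rest) \<Longrightarrow>
      \<exists>M3. agree ?X L K ?M M3 \<and> M3 (Vtx, 0) = v \<and> path (\<lambda>k. M3 (IncPrev, k)) (M3 (Occ, 0)) rest \<and>
        (\<forall>a\<in>{Chosen, Index, Pos}. \<forall>i. M3 (a, i) = M2 (a, i)) \<and>
        (\<forall>w n t. runs p undo_loop (M3, w) n cells d t \<longrightarrow>
          runs p undo_loop (M2, w) (21 * length ks + n) cells d t)"
    by blast
  have "runs p update_body (M, w) 20 cells d (?M, w)"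
    using straight_bodies steps_bodies body(4) by (intro runs_straight') auto
  \<comment> \<open>At most 20 steps for the body and one for the guard give the factor 21.\<close>
  then have "runs p update_loop (M, w) (Suc (20 + (21 * length ks + 1))) cells d (M', w)"
    using M'(1) at_k I by (intro runs_WhileTrue) auto
  then have r: "runs p update_loop (M, w) (21 * length (k # ks) + 1) cells d (M', w)"
    by (rule runs_mono) auto
  have u: "\<exists>M3. agree X L K M M3 \<and> M3 (Vtx, 0) = v \<and> path (\<lambda>k. M3 (IncPrev, k)) (M3 (Occ, 0)) rest \<and>
        (\<forall>a\<in>{Chosen, Index, Pos}. \<forall>i. M3 (a, i) = M2 (a, i)) \<and>
        (\<forall>w n t. runs p undo_loop (M3, w) n cells d t \<longrightarrow>
          runs p undo_loop (M2, w) (21 * length (k # ks) + n) cells d t)"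
    if M2: "agree (add v (edge_at ` set (k # ks)) X) L K M' M2" "M2 (Vtx, 0) = v"
      "path (\<lambda>k. M2 (IncPrev, k)) (M2 (Occ, 0)) (rev (k # ks) @ rest)" for M2 rest
  proof -
    \<comment> \<open>The undo traversal meets k after all of \<open>ks\<close>, so the induction
      hypothesis is used with \<open>k # rest\<close> as the remainder, and k is undone
      last.\<close>
    have "path (\<lambda>k. M2 (IncPrev, k)) (M2 (Occ, 0)) (rev ks @ k # rest)" using M2(3) by simp
    from undo[OF M2(1)[folded add_eq] M2(2) this] obtain M3 where
      M3: "agree ?X L K ?M M3" "M3 (Vtx, 0) = v" "path (\<lambda>k. M3 (IncPrev, k)) (M3 (Occ, 0)) (k # rest)"
        "\<forall>a\<in>{Chosen, Index, Pos}. \<forall>i. M3 (a, i) = M2 (a, i)"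
      and runs3: "\<And>w n t. runs p undo_loop (M3, w) n cells d t \<Longrightarrow>
          runs p undo_loop (M2, w) (21 * length ks + n) cells d t" by blast
    have k3: "M3 (Occ, 0) = k" using M3(3) by simp
    let ?M4 = "after undo_body M3"
    have M4: "agree X L K M ?M4" "touched undo_body M3 \<subseteq> cells" "?M4 (Occ, 0) = M3 (IncPrev, k)"
      "\<forall>a\<in>{Vtx, Chosen, Index, Pos}. \<forall>i. ?M4 (a, i) = M3 (a, i)"
      using body(5)[OF M3(1,2) k3] by blast+
    have "?M4 (IncPrev, i) = M3 (IncPrev, i)" for i
    proof -
      have "?M4 (IncPrev, i) = M (IncPrev, i)" by (rule agreeD[OF M4(1)]) (simp add: live_def)
      moreover have "M3 (IncPrev, i) = ?M (IncPrev, i)" by (rule agreeD[OF M3(1)]) (simp add: live_def)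
      ultimately show ?thesis by (simp add: fr)
    qed
    then have p4: "path (\<lambda>k. ?M4 (IncPrev, k)) (?M4 (Occ, 0)) rest" using M3(3) M4(3) k3 by simp
    have b4: "runs p undo_body (M3, w) 20 cells d (?M4, w)" for w
      using straight_bodies steps_bodies M4(2) by (intro runs_straight') auto
    have "runs p undo_loop (M2, w) (21 * length (k # ks) + n) cells d t"
      if "runs p undo_loop (?M4, w) n cells d t" for w n t
    proof -
      have "runs p undo_loop (M3, w) (Suc (20 + n)) cells d t"
        using that b4 k3 at_k(2) I by (intro runs_WhileTrue) auto
      from runs3[OF this] show ?thesis by (rule runs_mono) auto
    qed
    moreover have "?M4 (Vtx, 0) = v" using M4(4) M3(2) by simp
    moreover have "\<forall>a\<in>{Chosen, Index, Pos}. \<forall>i. ?M4 (a, i) = M2 (a, i)" using M4(4) M3(4) by simp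
    ultimately show ?thesis using M4(1) p4 by blast
  qed
  show ?case
    using r M'(2,3) u fr unfolding add_eq by (intro exI[of _ M']) simp
qed

section \<open>The test loop\<close>

definition test_body :: "name com" where
  "test_body =
     (Edg :== EdgeOf\<langle>reg Occ\<rangle>;;
      WHEN Cover\<langle>reg Edg\<rangle> =\<^sub>e N 2 DO
       (IF Conj (CritFirst\<langle>Owner\<langle>reg Edg\<rangle>\<rangle> \<noteq>\<^sub>e N 0)
               (CritFirst\<langle>Owner\<langle>reg Edg\<rangle>\<rangle> <\<^sub>e Index\<langle>reg Level\<rangle>)
          THEN SKIP
          ELSE Ok :== N 0);;
      Occ :== IncNext\<langle>reg Occ\<rangle>)"

lemma test_eq: "test = (Ok :== N 1;; Occ :== IncFirst\<langle>reg Vtx\<rangle>;; WHILE reg Occ \<noteq>\<^sub>e N 0 DO test_body)"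
  by (simp add: test_def test_body_def)

definition passes :: "(name cell \<Rightarrow> nat) \<Rightarrow> nat \<Rightarrow> bool" where
  "passes M j \<longleftrightarrow> (M (Cover, j) = 2 \<longrightarrow> M (CritFirst, M (Owner, j)) \<noteq> 0 \<and>
     M (CritFirst, M (Owner, j)) < M (Index, M (Level, 0)))"

text \<open>\<open>Ok\<close> is never set back to 1 inside the loop, so its final value records
  whether all inspected hyperedges passed. The loop writes three registers only, none of which
  \<open>passes\<close> reads.\<close>

lemma test_loop_correct:
  assumes "static M" "M (Level, 0) \<in> idx"
    and "\<And>j. j \<in> {1..m} \<Longrightarrow> M (Cover, j) = 2 \<Longrightarrow> M (Owner, j) \<in> idx"
    and "path (\<lambda>k. M (IncNext, k)) (M (Occ, 0)) ks" "set ks \<subseteq> {1..sz}"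
  shows "\<exists>M'. runs p (WHILE reg Occ \<noteq>\<^sub>e N 0 DO test_body) (M, w) (10 * length ks + 1) cells d (M', w) \<and>
    (\<forall>a i. a \<notin> {Edg, Occ, Ok} \<longrightarrow> M' (a, i) = M (a, i)) \<and>
    M' (Ok, 0) = (if \<forall>k\<in>set ks. passes M (edge_at k) then M (Ok, 0) else 0)"
  using assms
proof (induction ks arbitrary: M)
  case Nil
  have "runs p (WHILE reg Occ \<noteq>\<^sub>e N 0 DO test_body) (M, w) 1 cells d (M, w)"
    using Nil by (intro runs_WhileFalse) (auto simp: idx_facts)
  then show ?case using Nil by (intro exI[of _ M]) auto
next
  case (Cons k ks)
  let ?j = "edge_at k"
  have k: "k \<in> {1..sz}" using Cons.prems(5) by simp
  have j: "?j \<in> {1..m}" using edge_at_range[OF k] .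
  have Occ: "M (Occ, 0) = k" "k \<noteq> 0" "path (\<lambda>k. M (IncNext, k)) (M (IncNext, k)) ks"
    using Cons.prems(4) by simp_all
  have EdgeOf: "M (EdgeOf, k) = ?j" using Cons.prems(1) k by (simp add: static_def)
  have I: "0 \<in> idx" "k \<in> idx" "?j \<in> idx" using idx_facts k j by auto
  let ?M = "after test_body M"
  have M_eq: "?M = (if passes M ?j then M((Edg, 0) := ?j) else M((Edg, 0) := ?j, (Ok, 0) := 0))
      ((Occ, 0) := M (IncNext, k))"
    by (simp add: test_body_def Occ(1) EdgeOf passes_def fun_upd_twist)
  have fr: "?M (a, i) = M (a, i)" if "a \<notin> {Edg, Occ, Ok}" for a i
    using that by (auto simp: M_eq)
  have touched: "touched test_body M \<subseteq> cells"
    using I Cons.prems(2,3) j by (simp add: test_body_def Occ(1) EdgeOf)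
  have passes: "passes ?M = passes M" by (simp add: fun_eq_iff passes_def fr)
  have "\<exists>M'. runs p (WHILE reg Occ \<noteq>\<^sub>e N 0 DO test_body) (?M, w) (10 * length ks + 1) cells d (M', w) \<and>
    (\<forall>a i. a \<notin> {Edg, Occ, Ok} \<longrightarrow> M' (a, i) = ?M (a, i)) \<and>
    M' (Ok, 0) = (if \<forall>k\<in>set ks. passes ?M (edge_at k) then ?M (Ok, 0) else 0)"
  proof (rule Cons.IH)
    show "static ?M" using Cons.prems(1) by (rule static_cong) (rule fr, auto)
    show "?M (Level, 0) \<in> idx" using Cons.prems(2) by (simp add: fr)
    show "?M (Owner, j) \<in> idx" if "j \<in> {1..m}" "?M (Cover, j) = 2" for j
      using Cons.prems(3)[of j] that by (simp add: fr)
    have "?M (Occ, 0) = M (IncNext, k)" by (simp add: M_eq)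
    then show "path (\<lambda>k. ?M (IncNext, k)) (?M (Occ, 0)) ks" using Occ(3) by (simp add: fr)
    show "set ks \<subseteq> {1..sz}" using Cons.prems(5) by simp
  qed
  then obtain M' where M': "runs p (WHILE reg Occ \<noteq>\<^sub>e N 0 DO test_body) (?M, w) (10 * length ks + 1) cells d (M', w)"
    "\<forall>a i. a \<notin> {Edg, Occ, Ok} \<longrightarrow> M' (a, i) = ?M (a, i)"
    "M' (Ok, 0) = (if \<forall>k\<in>set ks. passes M (edge_at k) then ?M (Ok, 0) else 0)"
    unfolding passes by blast
  have "runs p test_body (M, w) 9 cells d (?M, w)"
    using touched by (intro runs_straight') (simp_all add: test_body_def)
  then have "runs p (WHILE reg Occ \<noteq>\<^sub>e N 0 DO test_body) (M, w) (Suc (9 + (10 * length ks + 1))) cells d (M', w)"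
    using M'(1) Occ I by (intro runs_WhileTrue) auto
  then have r: "runs p (WHILE reg Occ \<noteq>\<^sub>e N 0 DO test_body) (M, w) (10 * length (k # ks) + 1) cells d (M', w)"
    by (rule runs_mono) auto
  moreover have "?M (Ok, 0) = (if passes M ?j then M (Ok, 0) else 0)" by (simp add: M_eq)
  ultimately show ?case using M'(2,3) fr by (intro exI[of _ M']) auto
qed

end


section \<open>The recursive procedure\<close>

lemma filter_eq_singleton_iff:
  assumes "distinct xs"
  shows "filter P xs = [u] \<longleftrightarrow> {x \<in> set xs. P x} = {u}"
proof
  assume "{x \<in> set xs. P x} = {u}"
  then have s: "set (filter P xs) = {u}" by auto
  moreover have "length (filter P xs) = card (set (filter P xs))"
    using assms by (simp only: distinct_card distinct_filter)
  ultimately have "length (filter P xs) = 1" by simp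
  then obtain y where "filter P xs = [y]" by (auto simp: length_Suc_conv)
  with s show "filter P xs = [u]" by (simp del: set_filter)
next
  assume "filter P xs = [u]"
  then have "set (filter P xs) = {u}" by simp
  then show "{x \<in> set xs. P x} = {u}" by auto
qed

lemma nxt_0: "nxt P 0 = (if {x \<in> P. 0 < x} = {} then 0 else Min {x \<in> P. 0 < x})"
  by (simp add: nxt_def)

context encoded
begin

abbreviation descendants :: "nat set \<Rightarrow> nat set set" where
  "descendants S \<equiv> {H. (S, H) \<in> (child Fs)\<^sup>*}"

text \<open>The order of selection matters: the head of the list is the \<open>Owner\<close>, and it
  is unaffected by later choices.\<close>

definition chosen :: "nat list \<Rightarrow> nat \<Rightarrow> nat list" where
  "chosen vs = (\<lambda>j. if j \<in> {1..m} then filter (\<lambda>u. u \<in> edge Fs j) vs else [])"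

lemma set_chosen: "set (chosen vs j) \<subseteq> set vs"
  by (auto simp: chosen_def)

lemma chosen_snoc: "add v {j \<in> {1..m}. v \<in> edge Fs j} (chosen vs) = chosen (vs @ [v])"
  by (auto simp: add_def chosen_def)

lemma uncovered_chosen: "uncovered m (chosen vs) = uncov Fs (set vs)"
  by (auto simp: uncovered_def chosen_def uncov_def length_Fs filter_empty_conv)

lemma chosen_singleton_iff:
  "distinct vs \<Longrightarrow> j \<in> {1..m} \<Longrightarrow> chosen vs j = [u] \<longleftrightarrow> set vs \<inter> edge Fs j = {u}"
  by (simp add: chosen_def filter_eq_singleton_iff) blast

lemma owned_chosen: "distinct vs \<Longrightarrow> owned m (chosen vs) u = crit Fs u (set vs)"
  using chosen_singleton_iff by (auto simp: owned_def crit_def length_Fs)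

lemma nxt_crit_0: "nxt (crit Fs u S) 0 = (if crit Fs u S = {} then 0 else Min (crit Fs u S))"
proof -
  have "{x \<in> crit Fs u S. 0 < x} = crit Fs u S" by (auto simp: crit_def)
  then show ?thesis by (simp only: nxt_0)
qed

lemma crit_pos: "crit Fs u S \<noteq> {} \<Longrightarrow> 0 < Min (crit Fs u S)"
  using Min_in[OF finite_crit, of Fs u S] by (auto simp: crit_def)

text \<open>Here validity of S enters. A list \<open>crit[f]\<close> that lost nothing is the one
  for S, nonempty and with minimum below every uncovered index, so f passes automatically. A list
  that lost a hyperedge F_j lost it because v is in F_j, and then F_j is now covered twice with
  owner f.\<close>

lemma test_iff:
  assumes "distinct (vs @ [v])" "valid Fs (set vs)" "uncov Fs (set vs) \<noteq> {}"
    and "v \<in> edge Fs (Min (uncov Fs (set vs)))"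
    and "repr m (chosen (vs @ [v])) M" "M (Index, M (Level, 0)) = Min (uncov Fs (set vs))"
  shows "(\<forall>k\<in>set (rev (occ v)). passes M (edge_at k)) \<longleftrightarrow> (set vs, insert v (set vs)) \<in> child Fs"
proof -
  let ?S = "set vs" and ?i = "Min (uncov Fs (set vs))"
  let ?ok = "\<lambda>f. crit Fs f (insert v ?S) \<noteq> {} \<and> Min (crit Fs f (insert v ?S)) < ?i"
  have first: "M (CritFirst, u) \<noteq> 0 \<and> M (CritFirst, u) < ?i \<longleftrightarrow> ?ok u" for u
  proof -
    have "M (CritFirst, u) = nxt (crit Fs u (insert v ?S)) 0"
      using assms(1,5) owned_chosen[of "vs @ [v]" u] by (simp add: repr_def)
    then show ?thesis using crit_pos[of u "insert v ?S"] by (simp add: nxt_crit_0)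
  qed
  have snoc: "chosen (vs @ [v]) j = chosen vs j @ [v]" if "j \<in> {1..m}" "v \<in> edge Fs j" for j
    using that by (simp add: chosen_def)
  have passes: "passes M j \<longleftrightarrow> (\<forall>f. chosen vs j = [f] \<longrightarrow> ?ok f)" if j: "j \<in> {1..m}" "v \<in> edge Fs j" for j
  proof -
    \<comment> \<open>Cover 2 after the update means one chosen element before it, and that element
      is still the head of the list, hence the owner.\<close>
    have "M (Cover, j) = Suc (length (chosen vs j))" "M (Owner, j) = hd (chosen vs j @ [v])"
      using assms(5) j snoc[OF j] by (auto simp: repr_def)
    then have "passes M j \<longleftrightarrow> (length (chosen vs j) = 1 \<longrightarrow> ?ok (hd (chosen vs j @ [v])))"
      unfolding passes_def assms(6) first by simp
    then show ?thesis by (cases "chosen vs j" rule: remdups_adj.cases) auto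
  qed
  have "(\<forall>k\<in>set (rev (occ v)). passes M (edge_at k)) \<longleftrightarrow> (\<forall>j\<in>edge_at ` set (occ v). passes M j)"
    by simp
  also have "\<dots> \<longleftrightarrow> (\<forall>j\<in>{1..m}. v \<in> edge Fs j \<longrightarrow> (\<forall>f. chosen vs j = [f] \<longrightarrow> ?ok f))"
    unfolding edges_occ using passes by blast
  also have "\<dots> \<longleftrightarrow> (\<forall>f\<in>?S. ?ok f)"
  proof (intro iffI ballI impI allI)
    fix f assume lost: "\<forall>j\<in>{1..m}. v \<in> edge Fs j \<longrightarrow> (\<forall>f. chosen vs j = [f] \<longrightarrow> ?ok f)" and f: "f \<in> ?S"
    show "?ok f"
    proof (cases "\<exists>j\<in>{1..m}. v \<in> edge Fs j \<and> chosen vs j = [f]")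
      case False
      have "crit Fs f ?S \<subseteq> crit Fs f (insert v ?S)"
      proof
        fix j assume j: "j \<in> crit Fs f ?S"
        then have "j \<in> {1..m}" "chosen vs j = [f]"
          using chosen_singleton_iff[of vs j f] assms(1) by (auto simp: crit_def length_Fs)
        with False have "v \<notin> edge Fs j" by blast
        with j show "j \<in> crit Fs f (insert v ?S)" by (simp add: crit_def)
      qed
      then have "crit Fs f (insert v ?S) = crit Fs f ?S" using crit_insert_subset[OF f] by blast
      then show ?thesis
        using valid_crit_nonempty[OF assms(2) f] valid_Min_less[OF assms(2) f Min_in[OF finite_uncov assms(3)]]
        by simp
    qed (use lost in blast)
  next
    fix j f assume "\<forall>f\<in>?S. ?ok f" "chosen vs j = [f]"
    moreover from this have "f \<in> ?S" using set_chosen[of vs j] by simp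
    ultimately show "?ok f" by blast
  qed
  also have "\<dots> \<longleftrightarrow> (?S, insert v ?S) \<in> child Fs"
    by (rule child_iff[OF assms(3,4), symmetric])
  finally show ?thesis .
qed

lemma tape_of_append: "tape_of (xs @ ys) = tape_of xs @ tape_of ys"
  by (simp add: tape_of_def)

lemma print_loop_correct:
  assumes "M (Level, 0) = length vs" "\<And>l. l < length vs \<Longrightarrow> M (Chosen, l) = vs ! l" "length vs \<le> sz"
    and "M (Cnt, 0) = c" "c \<le> length vs"
  shows "\<exists>M'. runs p (WHILE reg Cnt \<noteq>\<^sub>e reg Level DO (Print (Chosen\<langle>reg Cnt\<rangle>);; Cnt :== Inc (reg Cnt)))
      (M, w) (3 * (length vs - c) + 1) cells d (M', w @ map Some (drop c vs)) \<and>
    (\<forall>a i. a \<noteq> Cnt \<longrightarrow> M' (a, i) = M (a, i))" (is "\<exists>M'. runs p ?loop _ _ _ _ _ \<and> _")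
  using assms
proof (induction "length vs - c" arbitrary: M c w)
  case 0
  then have "runs p ?loop (M, w) 1 cells d (M, w)"
    by (intro runs_WhileFalse) (auto simp: idx_facts)
  with 0 show ?case by (intro exI[of _ M]) simp
next
  case (Suc n)
  then have c: "c < length vs" by simp
  let ?M = "M((Cnt, 0) := Suc c)"
  have "\<exists>M'. runs p ?loop (?M, w @ [Some (vs ! c)]) (3 * (length vs - Suc c) + 1) cells d
      (M', (w @ [Some (vs ! c)]) @ map Some (drop (Suc c) vs)) \<and> (\<forall>a i. a \<noteq> Cnt \<longrightarrow> M' (a, i) = ?M (a, i))"
    by (rule Suc.hyps) (use Suc.hyps Suc.prems c in auto)
  then obtain M' where M': "runs p ?loop (?M, w @ [Some (vs ! c)]) (3 * (length vs - Suc c) + 1) cells d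
      (M', w @ map Some (drop c vs))" "\<forall>a i. a \<noteq> Cnt \<longrightarrow> M' (a, i) = ?M (a, i)"
    using c by (auto simp: Cons_nth_drop_Suc[symmetric])
  have I: "c \<in> idx" "0 \<in> idx" using c Suc.prems(3) idx_facts by auto
  have "runs p (Print (Chosen\<langle>reg Cnt\<rangle>);; Cnt :== Inc (reg Cnt)) (M, w) (1 + 1) cells d
      (?M, w @ [Some (vs ! c)])"
  proof (rule runs_Seq)
    show "runs p (Print (Chosen\<langle>reg Cnt\<rangle>)) (M, w) 1 cells d (M, w @ [Some (vs ! c)])"
      using runs_Print[of "Chosen\<langle>reg Cnt\<rangle>" M cells p w d] I Suc.prems c by simp
    show "runs p (Cnt :== Inc (reg Cnt)) (M, w @ [Some (vs ! c)]) 1 cells d (?M, w @ [Some (vs ! c)])"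
      using I Suc.prems by (intro runs_straight') auto
  qed
  then have "runs p ?loop (M, w) (Suc (1 + 1 + (3 * (length vs - Suc c) + 1))) cells d (M', w @ map Some (drop c vs))"
    using M'(1) Suc.prems c I by (intro runs_WhileTrue) auto
  then have "runs p ?loop (M, w) (3 * (length vs - c) + 1) cells d (M', w @ map Some (drop c vs))"
    by (rule runs_mono) (use c in auto)
  with M'(2) show ?case by (intro exI[of _ M']) simp
qed

lemma print_S_correct:
  assumes "M (Level, 0) = length vs" "\<And>l. l < length vs \<Longrightarrow> M (Chosen, l) = vs ! l" "length vs \<le> sz"
  shows "\<exists>M'. runs p print_S (M, w) (3 * length vs + 3) cells d (M', w @ tape_of [vs]) \<and> agree X L K M M'"
proof -
  let ?loop = "WHILE reg Cnt \<noteq>\<^sub>e reg Level DO (Print (Chosen\<langle>reg Cnt\<rangle>);; Cnt :== Inc (reg Cnt))"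
  let ?M = "M((Cnt, 0) := 0)"
  obtain M' where M': "runs p ?loop (?M, w) (3 * (length vs - 0) + 1) cells d (M', w @ map Some (drop 0 vs))"
    "\<forall>a i. a \<noteq> Cnt \<longrightarrow> M' (a, i) = ?M (a, i)"
    using print_loop_correct[of ?M vs 0 p w d] assms by auto
  have "runs p (Cnt :== N 0) (M, w) 1 cells d (?M, w)"
    by (intro runs_straight') (auto simp: idx_facts)
  then have "runs p print_S (M, w) (1 + (3 * (length vs - 0) + 1) + 1) cells d (M', (w @ map Some (drop 0 vs)) @ [None])"
    unfolding print_S_def by (rule runs_Seq[OF runs_Seq[OF _ M'(1)] runs_EndRecord])
  then have "runs p print_S (M, w) (3 * length vs + 3) cells d (M', (w @ map Some (drop 0 vs)) @ [None])"
    by (rule runs_mono) auto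
  then have "runs p print_S (M, w) (3 * length vs + 3) cells d (M', w @ tape_of [vs])"
    by (simp add: tape_of_def)
  moreover have "agree X L K M M'" using M'(2) by (simp add: agree_def live_def)
  ultimately show ?thesis by blast
qed

definition for_body :: "name com" where
  "for_body =
       (Vtx :== Elt\<langle>Pos\<langle>reg Level\<rangle>\<rangle>;;
        update;;
        test;;
        WHEN reg Ok =\<^sub>e N 1 DO
         (Chosen\<langle>reg Level\<rangle> ::= reg Vtx;;
          Level :== Inc (reg Level);;
          Call;;
          Level :== Dec (reg Level));;
        Vtx :== Elt\<langle>Pos\<langle>reg Level\<rangle>\<rangle>;;
        undo;;
        Pos\<langle>reg Level\<rangle> ::= Inc (Pos\<langle>reg Level\<rangle>))"

lemma RS_body_eq: "RS_body =
   (IF UncovNext\<langle>N 0\<rangle> =\<^sub>e N 0 THEN print_S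
    ELSE
     (Index\<langle>reg Level\<rangle> ::= UncovNext\<langle>N 0\<rangle>;;
      Pos\<langle>reg Level\<rangle> ::= Start\<langle>Index\<langle>reg Level\<rangle>\<rangle>;;
      WHILE Pos\<langle>reg Level\<rangle> \<noteq>\<^sub>e Start\<langle>Inc (Index\<langle>reg Level\<rangle>)\<rangle> DO for_body))"
  by (simp add: RS_body_def for_body_def)

section \<open>Specification and cost of a call\<close>

definition entered :: "nat list \<Rightarrow> (name cell \<Rightarrow> nat) \<Rightarrow> bool" where
  "entered vs M \<longleftrightarrow> static M \<and> repr m (chosen vs) M \<and> M (Level, 0) = length vs \<and>
     (\<forall>l<length vs. M (Chosen, l) = vs ! l)"

lemma entered_agree:
  assumes "entered vs M" "agree (chosen vs) L K M M'" "length vs \<le> L"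
  shows "entered vs M'"
  using assms static_agree[OF assms(2)] repr_agree[OF _ assms(2)]
    agreeD[OF assms(2), of Level 0] agreeD[OF assms(2), of Chosen]
  by (auto simp: entered_def live_def)

text \<open>Every set in the subtree of S is charged \<open>100 * (sz + 1)\<close> steps, for its
  own loops and guards but not for its recursive calls.\<close>

definition cost :: "nat set \<Rightarrow> nat" where
  "cost S = 100 * (sz + 1) * card (descendants S)"

text \<open>Halting, time, restored memory and an RS derivation for the printed records are asserted
  together, so that this can serve as the induction hypothesis for deeper calls. Each nested call
  adds a fresh vertex, whence the bound \<open>card verts - length vs\<close> on the remaining
  depth.\<close>

definition calls_correct :: "nat list \<Rightarrow> bool" where
  "calls_correct vs \<longleftrightarrow> (\<forall>M w. entered vs M \<longrightarrow> (\<exists>outs M'.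
     runs RS_body RS_body (M, w) (cost (set vs)) cells (card verts - length vs) (M', w @ tape_of outs) \<and>
     agree (chosen vs) (length vs) (length vs) M M' \<and> (\<forall>xs\<in>set outs. distinct xs) \<and>
     RS Fs (set vs) (map set outs)))"

end

section \<open>A call with uncovered hyperedges\<close>

locale node = encoded +
  fixes vs :: "nat list"
  assumes distinct_vs: "distinct vs" and vs_subset: "set vs \<subseteq> verts"
    and valid_vs: "valid Fs (set vs)" and uncov_vs: "uncov Fs (set vs) \<noteq> {}"
begin

abbreviation S :: "nat set" where "S \<equiv> set vs"
abbreviation L :: nat where "L \<equiv> length vs"
definition i :: nat where "i = Min (uncov Fs S)"
definition es :: "nat list" where "es = Es ! (i - 1)"

abbreviation passing :: "nat \<Rightarrow> bool" where "passing v \<equiv> (S, insert v S) \<in> child Fs"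

lemma i_range: "i \<in> {1..m}"
  using Min_in[OF finite_uncov uncov_vs] by (simp add: i_def uncov_def length_Fs)

lemma set_es: "set es = edge Fs i" and distinct_es: "distinct es"
  using edge_eq[OF i_range] by (simp_all add: es_def)

lemma es_new: "v \<in> set es \<Longrightarrow> v \<notin> S"
  using Min_uncov_disjoint[OF uncov_vs] by (auto simp: set_es i_def)

lemma es_verts: "v \<in> set es \<Longrightarrow> v \<in> verts"
  using edge_subset_verts[OF i_range] by (auto simp: set_es)

lemma L_le: "L \<le> sz"
proof -
  have "L = card S" using distinct_vs by (simp add: distinct_card)
  also have "\<dots> \<le> card verts" using vs_subset by (intro card_mono) auto
  finally show ?thesis using card_verts by simp
qed

lemma L_less: "v \<in> set es \<Longrightarrow> L < card verts"
proof -
  assume v: "v \<in> set es"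
  have "L = card S" using distinct_vs by (simp add: distinct_card)
  also have "\<dots> < card verts" using vs_subset es_new[OF v] es_verts[OF v] by (intro psubset_card_mono) auto
  finally show ?thesis .
qed

text \<open>The stack bounds differ, \<open>L\<close> for \<open>Chosen\<close> but
  \<open>Suc L\<close> for \<open>Index\<close> and \<open>Pos\<close>: the loop's own index and
  position at level L must survive the recursive call, whereas \<open>Chosen\<close> at L holds a
  vertex outside S.\<close>

lemma for_body_correct:
  assumes calls: "\<And>v. v \<in> set es \<Longrightarrow> passing v \<Longrightarrow> calls_correct (vs @ [v])"
    and ent: "entered vs M" and Index: "M (Index, L) = i" and Pos: "M (Pos, L) = start i + l"
    and l: "l < length es" and v: "v = es ! l"
  shows "\<exists>outs M'. runs RS_body for_body (M, w)
      (99 * length (occ v) + (if passing v then cost (insert v S) else 0)) cells (card verts - L)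
      (M', w @ tape_of outs) \<and>
    agree (chosen vs) L (Suc L) (M((Pos, L) := Suc (M (Pos, L)))) M' \<and>
    (\<forall>xs\<in>set outs. distinct xs) \<and> (if passing v then RS Fs (insert v S) (map set outs) else outs = [])"
proof -
  let ?d = "card verts - L" and ?k = "start i + l" and ?X = "chosen (vs @ [v])"
  let ?D = "{j \<in> {1..m}. v \<in> edge Fs j}"
  have ves: "v \<in> set es" using l v by simp
  have k: "?k \<in> {1..sz}" "elt_at ?k = v"
    using incidence_at[OF i_range] l v by (simp_all add: es_def)
  have stat: "static M" and rep: "repr m (chosen vs) M" and Lev: "M (Level, 0) = L"
    and Cho: "\<And>l. l < L \<Longrightarrow> M (Chosen, l) = vs ! l"
    using ent by (auto simp: entered_def)
  have Elt: "M (Elt, ?k) = v" using stat k by (auto simp: static_def)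
  have I: "0 \<in> idx" "L \<in> idx" "?k \<in> idx" "v \<in> idx"
    using idx_facts L_le k es_verts[OF ves] by auto
  \<comment> \<open>v occurs in F_i, so constant overheads can be charged to its occurrences: the
    iteration takes at most 52 steps per occurrence and 20 more, which 99 per occurrence
    covers.\<close>
  have deg: "1 \<le> length (occ v)"
  proof -
    have "?k \<in> set (occ v)" using k by (auto simp: occs_def simp del: upt_Suc)
    then show ?thesis by (cases "occ v") (simp_all del: upt_Suc)
  qed
  let ?M1 = "M((Vtx, 0) := v, (Occ, 0) := M (IncFirst, v))"
  have s1: "runs RS_body (Vtx :== Elt\<langle>Pos\<langle>reg Level\<rangle>\<rangle>) (M, w) 1 cells ?d (M((Vtx, 0) := v), w)"
    using I by (intro runs_straight') (auto simp: Lev Pos Elt)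
  have s2: "runs RS_body (Occ :== IncFirst\<langle>reg Vtx\<rangle>) (M((Vtx, 0) := v), w) 1 cells ?d (?M1, w)"
    using I by (intro runs_straight') auto
  have new: "v \<notin> S" using es_new[OF ves] .
  have D: "edge_at ` set (rev (occ v)) = ?D" using edges_occ by simp
  have X: "add v (edge_at ` set (rev (occ v))) (chosen vs) = ?X"
    unfolding D by (rule chosen_snoc)
  have "static ?M1" by (rule static_cong[OF stat]) auto
  moreover have "repr m (chosen vs) ?M1" using rep by (simp add: repr_def)
  moreover have "?M1 (Vtx, 0) = v" by simp
  ultimately have 1: "static ?M1" "repr m (chosen vs) ?M1" "?M1 (Vtx, 0) = v" .
  have 2: "path (\<lambda>k. ?M1 (IncNext, k)) (?M1 (Occ, 0)) (rev (occ v))"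
    using stat by (simp add: static_def)
  have 3: "v \<notin> set (chosen vs j)" for j using new set_chosen[of vs j] by blast
  \<comment> \<open>v is new and owns nothing before the update, so the ordering condition of the
    update loop holds vacuously at the start.\<close>
  have 4: "owned m (chosen vs) v = {}"
    using 3 by (auto simp: owned_def) (metis list.set_intros(1))
  have 5: "set (chosen vs j) \<subseteq> verts" for j using vs_subset set_chosen[of vs j] by blast
  have "set (rev (occ v)) \<subseteq> {1..sz}" using set_occ by simp
  from update_loop_correct[OF 1 2 this sorted_edges_occ 3 _ es_verts[OF ves] 5, of RS_body w ?d L "Suc L", unfolded X] 4
  obtain Mu where Mu: "runs RS_body update_loop (?M1, w) (21 * length (rev (occ v)) + 1) cells ?d (Mu, w)"
      "repr m ?X Mu" "\<forall>a i. a \<notin> {UncovNext, UncovPrev, CritFirst, CritNext, CritPrev, Cover, Owner, Edg, Occ} \<longrightarrow>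
      Mu (a, i) = ?M1 (a, i)"
    and undo: "\<And>M2 rest. agree ?X L (Suc L) Mu M2 \<Longrightarrow> M2 (Vtx, 0) = v \<Longrightarrow>
      path (\<lambda>k. M2 (IncPrev, k)) (M2 (Occ, 0)) (rev (rev (occ v)) @ rest) \<Longrightarrow>
      \<exists>M3. agree (chosen vs) L (Suc L) ?M1 M3 \<and> M3 (Vtx, 0) = v \<and> path (\<lambda>k. M3 (IncPrev, k)) (M3 (Occ, 0)) rest \<and>
        (\<forall>a\<in>{Chosen, Index, Pos}. \<forall>i. M3 (a, i) = M2 (a, i)) \<and>
        (\<forall>w n t. runs RS_body undo_loop (M3, w) n cells ?d t \<longrightarrow>
          runs RS_body undo_loop (M2, w) (21 * length (rev (occ v)) + n) cells ?d t)"
    by blast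
  have fr: "Mu (a, x) = M (a, x)" if "a \<notin> {UncovNext, UncovPrev, CritFirst, CritNext, CritPrev, Cover, Owner, Edg, Occ, Vtx}" for a x
    using Mu(3) that by simp
  have Vtx_u: "Mu (Vtx, 0) = v" using Mu(3) by simp
  have statu: "static Mu" using stat by (rule static_cong) (rule fr, auto)
  let ?M2 = "Mu((Ok, 0) := 1, (Occ, 0) := Mu (IncFirst, v))"
  have s3: "runs RS_body (Ok :== N 1;; Occ :== IncFirst\<langle>reg Vtx\<rangle>) (Mu, w) 2 cells ?d (?M2, w)"
    using I by (intro runs_straight') (auto simp: Vtx_u)
  have owner: "?M2 (Owner, j) \<in> idx" if "j \<in> {1..m}" "?M2 (Cover, j) = 2" for j
  proof -
    have "length (?X j) = 2" using that Mu(2) by (simp add: repr_def)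
    then have "?X j \<noteq> []" by auto
    then have "Mu (Owner, j) \<in> set (?X j)" using that(1) Mu(2) by (simp add: repr_def)
    then show ?thesis using set_chosen[of "vs @ [v]" j] vs_subset I(4) idx_facts(4) by auto
  qed
  have t1: "static ?M2" by (rule static_cong[OF statu]) auto
  have t2: "?M2 (Level, 0) \<in> idx" using I Lev by (simp add: fr)
  have t3: "path (\<lambda>k. ?M2 (IncNext, k)) (?M2 (Occ, 0)) (rev (occ v))"
    using statu by (simp add: static_def)
  have t4: "set (rev (occ v)) \<subseteq> {1..sz}" using set_occ by simp
  obtain Mt where Mt: "runs RS_body (WHILE reg Occ \<noteq>\<^sub>e N 0 DO test_body) (?M2, w)
      (10 * length (rev (occ v)) + 1) cells ?d (Mt, w)"
    "\<forall>a i. a \<notin> {Edg, Occ, Ok} \<longrightarrow> Mt (a, i) = ?M2 (a, i)"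
    "Mt (Ok, 0) = (if \<forall>k\<in>set (rev (occ v)). passes ?M2 (edge_at k) then ?M2 (Ok, 0) else 0)"
    using test_loop_correct[where M = "?M2" and ks = "rev (occ v)" and p = RS_body and w = w and d = "?d",
        OF t1 t2 owner t3 t4] by blast
  have "(\<forall>k\<in>set (rev (occ v)). passes Mu (edge_at k)) \<longleftrightarrow> passing v"
    using distinct_vs new valid_vs uncov_vs ves Mu(2)
    by (intro test_iff) (auto simp: fr Lev Index i_def[symmetric] set_es)
  then have Ok: "Mt (Ok, 0) = 1 \<longleftrightarrow> passing v"
    unfolding Mt(3) by (simp add: passes_def)
  have frt: "Mt (a, x) = Mu (a, x)" if "a \<notin> {Edg, Occ, Ok}" for a x
    using Mt(2) that by simp
  have agt: "agree ?X L (Suc L) Mu Mt"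
    unfolding agree_def live_def by (simp add: frt)
  let ?call = "Chosen\<langle>reg Level\<rangle> ::= reg Vtx;; Level :== Inc (reg Level);; Call;; Level :== Dec (reg Level)"
  have "\<exists>outs M3. runs RS_body (WHEN reg Ok =\<^sub>e N 1 DO (?call)) (Mt, w)
      (10 + (if passing v then cost (insert v S) else 0)) cells ?d (M3, w @ tape_of outs) \<and>
    agree ?X L (Suc L) Mu M3 \<and> M3 (Pos, L) = ?k \<and>
    (\<forall>xs\<in>set outs. distinct xs) \<and> (if passing v then RS Fs (insert v S) (map set outs) else outs = [])"
  proof (cases "passing v")
    case False
    have "runs RS_body (WHEN reg Ok =\<^sub>e N 1 DO (?call)) (Mt, w) (Suc 1) cells ?d (Mt, w)"
    proof (rule runs_Cond)
      show "runs RS_body SKIP (Mt, w) 1 cells ?d (Mt, w)" by (intro runs_straight') auto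
    qed (use I Ok False in auto)
    then have "runs RS_body (WHEN reg Ok =\<^sub>e N 1 DO (?call)) (Mt, w) 10 cells ?d (Mt, w)"
      by (rule runs_mono) auto
    then show ?thesis using False agt Pos
      by (intro exI[of _ "[]"] exI[of _ Mt]) (simp add: tape_of_def frt fr)
  next
    case True
    let ?Mc = "Mt((Chosen, L) := v, (Level, 0) := Suc L)"
    have Levt: "Mt (Level, 0) = L" by (simp add: frt fr Lev)
    have "entered (vs @ [v]) ?Mc"
      unfolding entered_def
    proof (intro conjI allI impI)
      have "static Mt" using statu by (rule static_cong) (rule frt, auto)
      then show "static ?Mc" by (rule static_cong) auto
      have "repr m ?X Mt" using Mu(2) agt by (rule repr_agree)
      then show "repr m ?X ?Mc" by (simp add: repr_def)
      show "?Mc (Chosen, l) = (vs @ [v]) ! l" if "l < length (vs @ [v])" for l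
        using that Cho by (auto simp: nth_append frt fr less_Suc_eq)
    qed simp
    then obtain outs M2 where M2: "runs RS_body RS_body (?Mc, w) (cost (insert v S)) cells (card verts - Suc L) (M2, w @ tape_of outs)"
      "agree ?X (Suc L) (Suc L) ?Mc M2" "\<forall>xs\<in>set outs. distinct xs" "RS Fs (insert v S) (map set outs)"
      using calls[OF ves True] unfolding calls_correct_def by fastforce
    let ?M3 = "M2((Level, 0) := L)"
    have Lev2: "M2 (Level, 0) = Suc L"
      by (subst agreeD[OF M2(2)]) (simp_all add: live_def)
    \<comment> \<open>v is a vertex outside S, hence L < \<open>card verts\<close> and the truncated
      subtraction is exact.\<close>
    have d: "Suc (card verts - Suc L) = ?d" using L_less[OF ves] by simp
    have "runs RS_body (?call) (Mt, w) (2 + Suc (cost (insert v S)) + 1) cells ?d (?M3, w @ tape_of outs)"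
    proof (intro runs_Seq)
      show "runs RS_body (Chosen\<langle>reg Level\<rangle> ::= reg Vtx;; Level :== Inc (reg Level)) (Mt, w) 2 cells ?d (?Mc, w)"
        using I by (intro runs_straight') (auto simp: Levt frt Vtx_u)
      show "runs RS_body Call (?Mc, w) (Suc (cost (insert v S))) cells ?d (M2, w @ tape_of outs)"
        using runs_Call[OF M2(1)] unfolding d .
      show "runs RS_body (Level :== Dec (reg Level)) (M2, w @ tape_of outs) 1 cells ?d (?M3, w @ tape_of outs)"
        using I by (intro runs_straight') (auto simp: Lev2)
    qed
    then have "runs RS_body (WHEN reg Ok =\<^sub>e N 1 DO (?call)) (Mt, w)
        (Suc (2 + Suc (cost (insert v S)) + 1)) cells ?d (?M3, w @ tape_of outs)"
      using I Ok True by (intro runs_Cond) auto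
    then have r: "runs RS_body (WHEN reg Ok =\<^sub>e N 1 DO (?call)) (Mt, w) (10 + cost (insert v S)) cells ?d (?M3, w @ tape_of outs)"
      by (rule runs_mono) auto
    \<comment> \<open>The callee preserves both stacks below \<open>Suc L\<close>, and
      \<open>Level\<close> is reset. The entry of \<open>Chosen\<close> at L has changed, but it is
      not live for the caller.\<close>
    have ag3: "agree ?X L (Suc L) Mu ?M3"
      unfolding agree_def
    proof (intro allI impI)
      fix a x assume lv: "live ?X L (Suc L) a x"
      then have "Mt (a, x) = Mu (a, x)" by (rule agreeD[OF agt])
      moreover have "M2 (a, x) = ?Mc (a, x)"
        using lv by (intro agreeD[OF M2(2)]) (auto simp: live_def)
      moreover have "(a, x) \<noteq> (Chosen, L)" using lv by (auto simp: live_def)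
      ultimately show "?M3 (a, x) = Mu (a, x)" using Levt by (auto simp: frt)
    qed
    moreover have "?M3 (Pos, L) = ?k"
      by (subst agreeD[OF ag3]) (simp_all add: live_def fr Pos)
    ultimately show ?thesis using r M2(3,4) True
      by (intro exI[of _ outs] exI[of _ ?M3]) simp
  qed
  then obtain outs M3 where M3: "runs RS_body (WHEN reg Ok =\<^sub>e N 1 DO (?call)) (Mt, w)
      (10 + (if passing v then cost (insert v S) else 0)) cells ?d (M3, w @ tape_of outs)"
    "agree ?X L (Suc L) Mu M3" "M3 (Pos, L) = ?k" "\<forall>xs\<in>set outs. distinct xs"
    "if passing v then RS Fs (insert v S) (map set outs) else outs = []"
    by blast
  let ?w = "w @ tape_of outs"
  have stat3: "static M3" by (rule static_agree[OF M3(2) statu])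
  have Lev3: "M3 (Level, 0) = L" by (subst agreeD[OF M3(2)]) (simp_all add: live_def fr Lev)
  \<comment> \<open>Registers are garbage after a call, so v is read again through the preserved
    stack cell \<open>Pos\<close> at level L.\<close>
  have Elt3: "M3 (Elt, ?k) = v" using stat3 k by (auto simp: static_def)
  let ?M4 = "M3((Vtx, 0) := v, (Occ, 0) := M3 (IncLast, v))"
  have s4: "runs RS_body (Vtx :== Elt\<langle>Pos\<langle>reg Level\<rangle>\<rangle>) (M3, ?w) 1 cells ?d (M3((Vtx, 0) := v), ?w)"
    using I by (intro runs_straight') (auto simp: Lev3 M3(3) Elt3)
  have s5: "runs RS_body (Occ :== IncLast\<langle>reg Vtx\<rangle>) (M3((Vtx, 0) := v), ?w) 1 cells ?d (?M4, ?w)"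
    using I by (intro runs_straight') auto
  have "agree ?X L (Suc L) Mu ?M4" using M3(2) by (simp add: agree_def live_def)
  moreover have "path (\<lambda>k. ?M4 (IncPrev, k)) (?M4 (Occ, 0)) (rev (rev (occ v)) @ [])"
    using stat3 by (simp add: static_def)
  ultimately obtain M5 where M5: "agree (chosen vs) L (Suc L) ?M1 M5" "M5 (Occ, 0) = 0"
      "M5 (Pos, L) = M3 (Pos, L)"
    and runs5: "\<And>w n t. runs RS_body undo_loop (M5, w) n cells ?d t \<Longrightarrow>
          runs RS_body undo_loop (?M4, w) (21 * length (rev (occ v)) + n) cells ?d t"
    using undo[of ?M4 "[]"] by auto
  have "runs RS_body undo_loop (M5, ?w) 1 cells ?d (M5, ?w)"
    using I M5(2) by (intro runs_WhileFalse) auto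
  note s6 = runs5[OF this]
  have Lev5: "M5 (Level, 0) = L" by (subst agreeD[OF M5(1)]) (simp_all add: live_def Lev)
  let ?M6 = "M5((Pos, L) := Suc (M5 (Pos, L)))"
  have s7: "runs RS_body (Pos\<langle>reg Level\<rangle> ::= Inc (Pos\<langle>reg Level\<rangle>)) (M5, ?w) 1 cells ?d (?M6, ?w)"
    using I by (intro runs_straight') (auto simp: Lev5)
  have "runs RS_body for_body (M, w) (1 + (1 + (21 * length (rev (occ v)) + 1)) + (2 + (10 * length (rev (occ v)) + 1)) +
      (10 + (if passing v then cost (insert v S) else 0)) + 1 + (1 + (21 * length (rev (occ v)) + 1)) + 1) cells ?d (?M6, ?w)"
    unfolding for_body_def update_eq undo_eq test_eq
    by (intro runs_Seq) (rule s1, rule s2, rule Mu(1), rule s3, rule Mt(1), rule M3(1), rule s4,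
        rule s5, rule s6, rule s7)
  then have r: "runs RS_body for_body (M, w) (99 * length (occ v) + (if passing v then cost (insert v S) else 0)) cells ?d (?M6, ?w)"
    by (rule runs_mono) (use deg in auto)
  moreover have "agree (chosen vs) L (Suc L) (M((Pos, L) := Suc (M (Pos, L)))) ?M6"
    unfolding agree_def
  proof (intro allI impI)
    fix a x assume lv: "live (chosen vs) L (Suc L) a x"
    then have "M5 (a, x) = ?M1 (a, x)" by (rule agreeD[OF M5(1)])
    moreover have "?M1 (a, x) = M (a, x)" using lv by (auto simp: live_def)
    ultimately show "?M6 (a, x) = (M((Pos, L) := Suc (M (Pos, L)))) (a, x)"
      using M5(3) M3(3) Pos by auto
  qed
  ultimately show ?thesis using M3(4,5) by blast
qed

text \<open>Induction on the vertices of F_i not yet processed. The evaluation of the guard turns 99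
  steps per occurrence into 100, again because every vertex of F_i has an occurrence.\<close>

lemma for_loop_correct:
  assumes calls: "\<And>v. v \<in> set es \<Longrightarrow> passing v \<Longrightarrow> calls_correct (vs @ [v])"
    and "entered vs M" "M (Index, L) = i" "M (Pos, L) = start i + l" "l \<le> length es"
  shows "\<exists>outs M'. runs RS_body (WHILE Pos\<langle>reg Level\<rangle> \<noteq>\<^sub>e Start\<langle>Inc (Index\<langle>reg Level\<rangle>)\<rangle> DO for_body) (M, w)
      (100 * (\<Sum>v\<leftarrow>drop l es. length (occ v)) + 1 + (\<Sum>v\<leftarrow>drop l es. if passing v then cost (insert v S) else 0))
      cells (card verts - L) (M', w @ tape_of outs) \<and>
    agree (chosen vs) L L M M' \<and> (\<forall>xs\<in>set outs. distinct xs) \<and> RS_for Fs S i (drop l es) (map set outs)"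
    (is "\<exists>outs M'. runs RS_body ?loop _ _ _ _ _ \<and> _")
  using assms(2-)
proof (induction "length es - l" arbitrary: M l w)
  case 0
  have [simp]: "M (Level, 0) = L" using 0 by (simp add: entered_def)
  have "M (Start, Suc i) = start i + l"
    using 0 i_range start_Suc[OF i_range] by (auto simp: entered_def static_def es_def)
  moreover have "0 \<in> idx" "L \<in> idx" "Suc i \<in> idx"
    using idx_facts L_le i_range by (auto simp: idx_def)
  ultimately have "runs RS_body ?loop (M, w) 1 cells (card verts - L) (M, w)"
    using 0 by (intro runs_WhileFalse) auto
  then show ?case using 0
    by (intro exI[of _ "[]"] exI[of _ M]) (auto simp: tape_of_def RS_for_Nil)
next
  case (Suc n)
  let ?v = "es ! l" and ?M = "M((Pos, L) := Suc (M (Pos, L)))"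
  have l: "l < length es" using Suc by simp
  have [simp]: "M (Level, 0) = L" using Suc by (simp add: entered_def)
  have start: "M (Start, Suc i) = start i + length es"
    using Suc i_range start_Suc[OF i_range] by (auto simp: entered_def static_def es_def)
  have I: "0 \<in> idx" "L \<in> idx" "Suc i \<in> idx"
    using idx_facts L_le i_range by (auto simp: idx_def)
  from for_body_correct[OF calls Suc.prems(1-3) l refl, of w]
  obtain outs1 M1 where M1: "runs RS_body for_body (M, w)
      (99 * length (occ ?v) + (if passing ?v then cost (insert ?v S) else 0)) cells (card verts - L)
      (M1, w @ tape_of outs1)" "agree (chosen vs) L (Suc L) ?M M1" "\<forall>xs\<in>set outs1. distinct xs"
    "if passing ?v then RS Fs (insert ?v S) (map set outs1) else outs1 = []" by blast
  have agM: "agree (chosen vs) L L M ?M" by (simp add: agree_def live_def)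
  have ag1: "agree (chosen vs) L L M M1"
    by (rule agree_trans[OF agM agree_mono[OF M1(2)]]) auto
  have "entered vs M1" by (rule entered_agree[OF Suc.prems(1) ag1]) simp
  moreover have "M1 (Index, L) = i" by (subst agreeD[OF M1(2)]) (simp_all add: live_def Suc.prems)
  moreover have "M1 (Pos, L) = start i + Suc l" by (subst agreeD[OF M1(2)]) (simp_all add: live_def Suc.prems)
  moreover have n: "n = length es - Suc l" using Suc.hyps(2) by simp
  ultimately obtain outs2 M2 where M2: "runs RS_body ?loop (M1, w @ tape_of outs1)
      (100 * (\<Sum>v\<leftarrow>drop (Suc l) es. length (occ v)) + 1 + (\<Sum>v\<leftarrow>drop (Suc l) es. if passing v then cost (insert v S) else 0))
      cells (card verts - L) (M2, (w @ tape_of outs1) @ tape_of outs2)"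
    "agree (chosen vs) L L M1 M2" "\<forall>xs\<in>set outs2. distinct xs" "RS_for Fs S i (drop (Suc l) es) (map set outs2)"
    using Suc.hyps(1)[of "Suc l" M1 "w @ tape_of outs1", OF n] l by auto
  have dr: "drop l es = ?v # drop (Suc l) es" using l by (simp add: Cons_nth_drop_Suc)
  have deg: "1 \<le> length (occ ?v)"
  proof -
    have "start i + l \<in> set (occ ?v)"
      using incidence_at[OF i_range, of l] l by (auto simp: occs_def es_def simp del: upt_Suc)
    then show ?thesis by (cases "occ ?v") (simp_all del: upt_Suc)
  qed
  have "runs RS_body ?loop (M, w) (Suc ((99 * length (occ ?v) + (if passing ?v then cost (insert ?v S) else 0)) +
      (100 * (\<Sum>v\<leftarrow>drop (Suc l) es. length (occ v)) + 1 + (\<Sum>v\<leftarrow>drop (Suc l) es. if passing v then cost (insert v S) else 0))))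
      cells (card verts - L) (M2, (w @ tape_of outs1) @ tape_of outs2)"
    by (rule runs_WhileTrue[OF _ _ M1(1) M2(1)]) (use I l start Suc.prems in auto)
  then have "runs RS_body ?loop (M, w) (100 * (\<Sum>v\<leftarrow>drop l es. length (occ v)) + 1 +
      (\<Sum>v\<leftarrow>drop l es. if passing v then cost (insert v S) else 0))
      cells (card verts - L) (M2, w @ tape_of (outs1 @ outs2))"
    unfolding dr tape_of_append append_assoc by (rule runs_mono) (use deg in auto)
  moreover have "RS_for Fs S i (drop l es) (map set (outs1 @ outs2))"
  proof -
    have "?v \<in> edge Fs (Min (uncov Fs S))" using l by (simp add: set_es[symmetric] i_def[symmetric])
    note iff = child_iff[OF uncov_vs this, folded i_def]
    show ?thesis
    proof (cases "passing ?v")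
      case True
      then show ?thesis unfolding dr map_append
        using RS_for_call[of S Fs ?v i "map set outs1"] M1(4) M2(4) iff by auto
    next
      case False
      then show ?thesis unfolding dr map_append
        using RS_for_skip[of S Fs ?v i] M1(4) M2(4) iff by auto
    qed
  qed
  moreover have "agree (chosen vs) L L M M2" using ag1 M2(2) by (rule agree_trans)
  moreover have "\<forall>xs\<in>set (outs1 @ outs2). distinct xs" using M1(3) M2(3) by auto
  ultimately show ?case by blast
qed

lemma finite_descendants: "T \<subseteq> verts \<Longrightarrow> finite (descendants T)"
  by (rule finite_subset[of _ "Pow verts"]) (auto dest: descendant_subset[OF _ hypergraph_verts])

text \<open>The subtree of S consists of S and the disjoint subtrees of the passing children, so the
  budget is exactly the share of S plus the budgets of the children.\<close>

lemma cost_eq: "100 * (sz + 1) + (\<Sum>v\<leftarrow>es. if passing v then cost (insert v S) else 0) = cost S"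
proof -
  let ?P = "{v \<in> set es. passing v}"
  have fin: "finite (descendants (insert v S))" if "v \<in> set es" for v
    using that es_verts vs_subset by (intro finite_descendants) auto
  have "card (descendants S) = card (insert S (\<Union>v\<in>?P. descendants (insert v S)))"
    using descendants_unfold[OF uncov_vs] by (simp add: set_es i_def)
  also have "\<dots> = Suc (card (\<Union>v\<in>?P. descendants (insert v S)))"
  proof (rule card_insert_disjoint)
    show "finite (\<Union>v\<in>?P. descendants (insert v S))" using fin by auto
    show "S \<notin> (\<Union>v\<in>?P. descendants (insert v S))" using child_rtrancl_subset es_new by blast
  qed
  also have "card (\<Union>v\<in>?P. descendants (insert v S)) = (\<Sum>v\<in>?P. card (descendants (insert v S)))"
  proof (rule card_UN_disjoint)
    show "\<forall>v\<in>?P. \<forall>w\<in>?P. v \<noteq> w \<longrightarrow> descendants (insert v S) \<inter> descendants (insert w S) = {}"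
      using descendants_disjoint[of S _ _ _ Fs] es_new by fastforce
  qed (use fin in auto)
  also have "\<dots> = (\<Sum>v\<in>set es. if passing v then card (descendants (insert v S)) else 0)"
    by (simp add: sum.inter_filter[symmetric])
  also have "\<dots> = (\<Sum>v\<leftarrow>es. if passing v then card (descendants (insert v S)) else 0)"
    using distinct_es by (simp add: sum_list_distinct_conv_sum_set)
  finally have "cost S = 100 * (sz + 1) + 100 * (sz + 1) * (\<Sum>v\<leftarrow>es. if passing v then card (descendants (insert v S)) else 0)"
    unfolding cost_def by (simp add: algebra_simps)
  then show ?thesis
    unfolding cost_def sum_list_const_mult[symmetric] by (simp add: if_distrib cong: if_cong)
qed

lemma RS_body_branch:
  assumes calls: "\<And>v. v \<in> set es \<Longrightarrow> passing v \<Longrightarrow> calls_correct (vs @ [v])"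
  shows "calls_correct vs"
  unfolding calls_correct_def
proof (intro allI impI)
  fix M w assume ent: "entered vs M"
  have Lev: "M (Level, 0) = L" using ent by (simp add: entered_def)
  have "M (UncovNext, 0) = nxt (uncov Fs S) 0"
    using ent by (simp add: entered_def repr_def uncovered_chosen)
  moreover have "{x \<in> uncov Fs S. 0 < x} = uncov Fs S" by (auto simp: uncov_def)
  ultimately have first: "M (UncovNext, 0) = i" using uncov_vs by (simp add: nxt_0 i_def)
  let ?M = "M((Index, L) := i, (Pos, L) := start i)"
  have I: "0 \<in> idx" "L \<in> idx" "i \<in> idx" using idx_facts L_le i_range by auto
  have St: "M (Start, i) = start i" using ent i_range by (auto simp: entered_def static_def)
  have s1: "runs RS_body (Index\<langle>reg Level\<rangle> ::= UncovNext\<langle>N 0\<rangle>;; Pos\<langle>reg Level\<rangle> ::= Start\<langle>Index\<langle>reg Level\<rangle>\<rangle>)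
      (M, w) 2 cells (card verts - L) (?M, w)"
    using I by (intro runs_straight') (auto simp: Lev first St)
  have agM: "agree (chosen vs) L L M ?M" by (simp add: agree_def live_def)
  have "entered vs ?M" by (rule entered_agree[OF ent agM]) simp
  from for_loop_correct[OF calls this, of 0 w]
  obtain outs M' where M': "runs RS_body (WHILE Pos\<langle>reg Level\<rangle> \<noteq>\<^sub>e Start\<langle>Inc (Index\<langle>reg Level\<rangle>)\<rangle> DO for_body) (?M, w)
      (100 * (\<Sum>v\<leftarrow>es. length (occ v)) + 1 + (\<Sum>v\<leftarrow>es. if passing v then cost (insert v S) else 0))
      cells (card verts - L) (M', w @ tape_of outs)"
    "agree (chosen vs) L L ?M M'" "\<forall>xs\<in>set outs. distinct xs" "RS_for Fs S i es (map set outs)"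
    by auto
  \<comment> \<open>Only the executed command is unfolded; the procedure parameter of
    \<open>runs\<close> must remain folded.\<close>
  have "runs RS_body RS_body (M, w) (Suc (2 + (100 * (\<Sum>v\<leftarrow>es. length (occ v)) + 1 +
      (\<Sum>v\<leftarrow>es. if passing v then cost (insert v S) else 0)))) cells (card verts - L) (M', w @ tape_of outs)"
    using runs_Seq[OF s1 M'(1)] I(1) i_range first
    by (subst (2) RS_body_eq) (rule runs_Cond; simp)
  \<comment> \<open>Position lists of distinct vertices are disjoint, so all traversals take at most
    \<open>100 * sz\<close> steps; the other 4 fit into the share \<open>100 * (sz + 1)\<close> of
    S.\<close>
  then have "runs RS_body RS_body (M, w) (cost S) cells (card verts - L) (M', w @ tape_of outs)"
    by (rule runs_mono) (use sum_length_occ[OF distinct_es] cost_eq in auto)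
  moreover have "agree (chosen vs) L L M M'" using agM M'(2) by (rule agree_trans)
  moreover have "RS Fs S (map set outs)"
    using RS_branch[OF uncov_vs i_def distinct_es set_es M'(4)] .
  ultimately show "\<exists>outs M'. runs RS_body RS_body (M, w) (cost S) cells (card verts - L) (M', w @ tape_of outs) \<and>
     agree (chosen vs) L L M M' \<and> (\<forall>xs\<in>set outs. distinct xs) \<and> RS Fs S (map set outs)"
    using M'(3) by blast
qed

end

context encoded
begin

text \<open>The number of vertices not yet chosen bounds the remaining recursion depth and serves as
  the induction measure.\<close>

lemma RS_body_correct:
  "distinct vs \<Longrightarrow> set vs \<subseteq> verts \<Longrightarrow> valid Fs (set vs) \<Longrightarrow> calls_correct vs"
proof (induction "card verts - length vs" arbitrary: vs rule: less_induct)
  case less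
  show ?case
  proof (cases "uncov Fs (set vs) = {}")
    case False
    interpret node Es Fs vs by unfold_locales (use less.prems False in auto)
    show ?thesis
    proof (rule RS_body_branch)
      fix v assume v: "v \<in> set es" "passing v"
      show "calls_correct (vs @ [v])"
        using L_less[OF v(1)] es_new[OF v(1)] es_verts[OF v(1)] less.prems valid_child[OF v(2)]
        by (intro less.hyps) auto
    qed
  next
    case True
    show ?thesis unfolding calls_correct_def
    proof (intro allI impI)
      fix M w assume ent: "entered vs M"
      have "length vs = card (set vs)" using less.prems by (simp add: distinct_card)
      also have "\<dots> \<le> card verts" using less.prems by (intro card_mono) auto
      finally have len: "length vs \<le> sz" using card_verts by simp
      have "M (UncovNext, 0) = 0"
        using ent True by (simp add: entered_def repr_def uncovered_chosen nxt_0)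
      moreover obtain M' where M': "runs RS_body print_S (M, w) (3 * length vs + 3) cells (card verts - length vs) (M', w @ tape_of [vs])"
        "agree (chosen vs) (length vs) (length vs) M M'"
        using print_S_correct[of M vs RS_body w "card verts - length vs" "chosen vs" "length vs" "length vs"]
          ent len by (auto simp: entered_def)
      ultimately have "runs RS_body RS_body (M, w) (Suc (3 * length vs + 3)) cells (card verts - length vs) (M', w @ tape_of [vs])"
        by (subst (2) RS_body_eq, intro runs_Cond) (auto simp: idx_facts)
      \<comment> \<open>S has at most sz elements, so the share of the single node S pays for
        printing it.\<close>
      moreover have "Suc (3 * length vs + 3) \<le> cost (set vs)"
      proof -
        have "descendants (set vs) \<subseteq> Pow verts"
          using descendant_subset[OF _ hypergraph_verts] less.prems by blast
        then have "finite (descendants (set vs))" by (rule finite_subset) simp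
        moreover have "set vs \<in> descendants (set vs)" by simp
        ultimately have "1 \<le> card (descendants (set vs))" by (metis One_nat_def Suc_leI card_gt_0_iff empty_iff)
        then have "100 * (sz + 1) * 1 \<le> cost (set vs)" unfolding cost_def by (rule mult_le_mono2)
        then show ?thesis using len by simp
      qed
      ultimately have "runs RS_body RS_body (M, w) (cost (set vs)) cells (card verts - length vs) (M', w @ tape_of [vs])"
        by (auto intro: runs_mono)
      then show "\<exists>outs M'. runs RS_body RS_body (M, w) (cost (set vs)) cells (card verts - length vs) (M', w @ tape_of outs) \<and>
        agree (chosen vs) (length vs) (length vs) M M' \<and> (\<forall>xs\<in>set outs. distinct xs) \<and> RS Fs (set vs) (map set outs)"
        using M'(2) less.prems True by (intro exI[of _ "[vs]"] exI[of _ M']) (auto intro: RS_output)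
    qed
  qed
qed

end


section \<open>Building the lists\<close>

lemma path_eq_0_iff: "path f x ks \<Longrightarrow> x = 0 \<longleftrightarrow> ks = []"
  by (cases ks) auto

text \<open>Redirecting the last node to p extends the list, because the link of p itself is still
  the initial 0.\<close>

lemma path_append:
  "path f x ks \<Longrightarrow> ks \<noteq> [] \<Longrightarrow> distinct ks \<Longrightarrow> p \<noteq> 0 \<Longrightarrow> p \<notin> set ks \<Longrightarrow> f p = 0 \<Longrightarrow>
     path (f(last ks := p)) x (ks @ [p])"
proof (induction ks arbitrary: x)
  case (Cons k ks)
  show ?case
  proof (cases "ks = []")
    case False
    then have "k \<noteq> last ks" using Cons.prems(3) by auto
    then show ?thesis using Cons False by simp
  qed (use Cons in auto)
qed simp

context encoded
begin

lemma occs_Suc: "1 \<le> p \<Longrightarrow> occs v (Suc p) = occs v p @ (if elt_at p = v then [p] else [])"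
  by (simp add: occs_def)

lemma set_occs: "k \<in> set (occs v p) \<longleftrightarrow> 1 \<le> k \<and> k < p \<and> elt_at k = v"
  by (auto simp: occs_def)

lemma distinct_occs: "distinct (occs v p)"
  by (simp add: occs_def)

lemma elt_at_verts: "k \<in> {1..sz} \<Longrightarrow> elt_at k \<in> verts"
  unfolding verts_eq elt_at_eq by (intro nth_mem) (auto simp: sz_eq)

text \<open>The program never sets the \<open>IncPrev\<close> entry of a newly appended position;
  that it is null comes from the initial memory, which the clause for \<open>k \<ge> p\<close> keeps
  available. \<open>Cover\<close> and \<open>CritFirst\<close> rely on zeroed memory in the same
  way.\<close>

definition built :: "nat \<Rightarrow> nat \<Rightarrow> (name cell \<Rightarrow> nat) \<Rightarrow> bool" where
  "built u p M \<longleftrightarrow> M (NumEdges, 0) = m \<and> (\<forall>j\<in>{1..Suc m}. M (Start, j) = start j) \<and>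
     (\<forall>k\<in>{1..sz}. M (Elt, k) = elt_at k) \<and> (\<forall>k\<in>{1..<p}. M (EdgeOf, k) = edge_at k) \<and>
     (\<forall>v. path (\<lambda>k. M (IncNext, k)) (M (IncFirst, v)) (rev (occs v p))) \<and>
     (\<forall>v. path (\<lambda>k. M (IncPrev, k)) (M (IncLast, v)) (occs v p)) \<and>
     (\<forall>k\<ge>p. M (IncPrev, k) = 0) \<and>
     (\<forall>j<u. M (UncovNext, j) = Suc j \<and> M (UncovPrev, Suc j) = j) \<and>
     (\<forall>j. M (Cover, j) = 0 \<and> M (CritFirst, j) = 0)"

lemma built_cong:
  assumes "built u p M" and "\<And>a k. a \<notin> {Edg, Ptr, Vtx} \<Longrightarrow> M' (a, k) = M (a, k)"
  shows "built u p M'"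
  using assms(1) by (simp add: built_def assms(2))

definition link_body :: "name com" where
  "link_body =
       (EdgeOf\<langle>reg Ptr\<rangle> ::= reg Edg;;
        Vtx :== Elt\<langle>reg Ptr\<rangle>;;
        IncNext\<langle>reg Ptr\<rangle> ::= IncFirst\<langle>reg Vtx\<rangle>;;
        IF IncFirst\<langle>reg Vtx\<rangle> =\<^sub>e N 0
          THEN IncLast\<langle>reg Vtx\<rangle> ::= reg Ptr
          ELSE IncPrev\<langle>IncFirst\<langle>reg Vtx\<rangle>\<rangle> ::= reg Ptr;;
        IncFirst\<langle>reg Vtx\<rangle> ::= reg Ptr;;
        Ptr :== Inc (reg Ptr))"

abbreviation link_loop :: "name com" where
  "link_loop \<equiv> WHILE reg Ptr \<noteq>\<^sub>e Start\<langle>Inc (reg Edg)\<rangle> DO link_body"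

definition edge_body :: "name com" where
  "edge_body =
     (UncovNext\<langle>Dec (reg Edg)\<rangle> ::= reg Edg;;
      UncovPrev\<langle>reg Edg\<rangle> ::= Dec (reg Edg);;
      link_loop;;
      Edg :== Inc (reg Edg))"

abbreviation edge_loop :: "name com" where
  "edge_loop \<equiv> WHILE reg Edg \<noteq>\<^sub>e Inc (reg NumEdges) DO edge_body"

lemma build_lists_eq: "build_lists = (Edg :== N 1;; Ptr :== N 1;; edge_loop;;
    UncovNext\<langle>reg NumEdges\<rangle> ::= N 0;; UncovPrev\<langle>N 0\<rangle> ::= reg NumEdges;; Level :== N 0)"
  by (simp add: build_lists_def edge_body_def link_body_def)

text \<open>Positions are scanned upwards and pushed onto the front of the \<open>IncNext\<close>
  list, which makes it descending; seen along \<open>IncPrev\<close>, the same step appends at the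
  end.\<close>

lemma link_body_correct:
  assumes b: "built u p M" and Edg: "M (Edg, 0) = edge_at p" and Ptr: "M (Ptr, 0) = p"
    and p: "p \<in> {1..sz}"
  shows "\<exists>M'. runs q link_body (M, w) 10 cells d (M', w) \<and> built u (Suc p) M' \<and>
    M' (Edg, 0) = M (Edg, 0) \<and> M' (Ptr, 0) = Suc p"
proof -
  let ?v = "elt_at p" and ?M = "after link_body M"
  define f where "f = M (IncFirst, ?v)"
  have Elt: "M (Elt, p) = ?v" using b p by (simp add: built_def)
  have nextp: "path (\<lambda>k. M (IncNext, k)) (M (IncFirst, v)) (rev (occs v p))"
    and prevp: "path (\<lambda>k. M (IncPrev, k)) (M (IncLast, v)) (occs v p)" for v
    using b by (auto simp: built_def)
  have M_eq: "?M = (if f = 0 then M((IncLast, ?v) := p) else M((IncPrev, f) := p))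
      ((EdgeOf, p) := edge_at p, (Vtx, 0) := ?v, (IncNext, p) := f, (IncFirst, ?v) := p, (Ptr, 0) := Suc p)"
    by (simp add: link_body_def Edg Ptr Elt f_def fun_upd_twist)
  have f0: "f = 0 \<longleftrightarrow> occs ?v p = []" using path_eq_0_iff[OF nextp[of ?v]] by (simp add: f_def)
  \<comment> \<open>The head of the descending list is the last node of the ascending one, so it is
    the node whose \<open>IncPrev\<close> must now point to p.\<close>
  have f_last: "f = last (occs ?v p)" if "f \<noteq> 0"
    using nextp[of ?v] that f0 by (cases "rev (occs ?v p)") (auto simp: f_def last_rev hd_rev[symmetric])
  have f_in: "f \<in> set (occs ?v p)" if "f \<noteq> 0" using f_last[OF that] f0 that by auto
  have "built u (Suc p) ?M"
    unfolding built_def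
  proof (intro conjI allI ballI impI)
    show "?M (NumEdges, 0) = m" using b by (simp add: M_eq built_def)
    show "?M (Start, j) = start j" if "j \<in> {1..Suc m}" for j using b that by (simp add: M_eq built_def)
    show "?M (Elt, k) = elt_at k" if "k \<in> {1..sz}" for k using b that by (simp add: M_eq built_def)
    show "?M (EdgeOf, k) = edge_at k" if "k \<in> {1..<Suc p}" for k
      using b that by (auto simp: M_eq built_def less_Suc_eq)
    show "?M (IncPrev, k) = 0" if "Suc p \<le> k" for k
      using b that f_in set_occs[of k ?v p] by (auto simp: M_eq built_def)
    show "?M (UncovNext, j) = Suc j" if "j < u" for j using b that by (simp add: M_eq built_def)
    show "?M (UncovPrev, Suc j) = j" if "j < u" for j using b that by (simp add: M_eq built_def)
    show "?M (Cover, j) = 0" "?M (CritFirst, j) = 0" for j using b by (simp_all add: M_eq built_def)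
    show "path (\<lambda>k. ?M (IncNext, k)) (?M (IncFirst, v)) (rev (occs v (Suc p)))" for v
    proof -
      have eq: "?M (IncNext, k) = (if k = p then f else M (IncNext, k))"
        "?M (IncFirst, v) = (if v = ?v then p else M (IncFirst, v))" for k
        by (simp_all add: M_eq)
      have "path (\<lambda>k. ?M (IncNext, k)) (M (IncFirst, v)) (rev (occs v p))"
        by (rule path_cong[OF nextp]) (auto simp: eq set_occs)
      then show ?thesis using p by (auto simp: occs_Suc eq f_def)
    qed
    show "path (\<lambda>k. ?M (IncPrev, k)) (?M (IncLast, v)) (occs v (Suc p))" for v
    proof (cases "v = ?v")
      case False
      have eq: "?M (IncPrev, k) = (if f \<noteq> 0 \<and> k = f then p else M (IncPrev, k))"
        "?M (IncLast, v) = M (IncLast, v)" for k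
        using False by (auto simp: M_eq)
      have "path (\<lambda>k. ?M (IncPrev, k)) (M (IncLast, v)) (occs v p)"
        by (rule path_cong[OF prevp]) (use f_in False in \<open>auto simp: eq set_occs\<close>)
      then show ?thesis using False p by (simp add: occs_Suc eq)
    next
      case True
      have z: "M (IncPrev, p) = 0" using b by (simp add: built_def)
      show ?thesis
      proof (cases "f = 0")
        case f: True
        then show ?thesis using True p z f0 by (simp add: occs_Suc M_eq)
      next
        case False
        have "path ((\<lambda>k. M (IncPrev, k))(f := p)) (M (IncLast, v)) (occs v p @ [p])"
          using path_append[OF prevp[of v] _ distinct_occs, of p] True False f0 f_last p z
          by (simp add: set_occs)
        moreover have "(\<lambda>k. ?M (IncPrev, k)) = (\<lambda>k. M (IncPrev, k))(f := p)"
          using False by (auto simp: M_eq)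
        ultimately show ?thesis using True False p by (simp add: occs_Suc M_eq)
      qed
    qed
  qed
  moreover have "touched link_body M \<subseteq> cells"
  proof -
    have "p \<in> idx" "?v \<in> idx" "edge_at p \<in> idx" using p elt_at_verts[OF p] edge_at_range[OF p] idx_facts by auto
    moreover have "f \<in> idx" using f_in p by (cases "f = 0") (auto simp: set_occs idx_facts)
    ultimately show ?thesis using idx_facts(1) by (simp add: link_body_def Edg Ptr Elt f_def)
  qed
  then have "runs q link_body (M, w) 10 cells d (?M, w)"
    by (intro runs_straight') (simp_all add: link_body_def)
  moreover have "?M (Edg, 0) = M (Edg, 0)" "?M (Ptr, 0) = Suc p" by (simp_all add: M_eq)
  ultimately show ?thesis by blast
qed

lemma link_loop_correct:
  assumes "built u (start e + l) M" "M (Edg, 0) = e" "M (Ptr, 0) = start e + l"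
    and e: "e \<in> {1..m}" and "l \<le> length (Es ! (e - 1))"
  shows "\<exists>M'. runs q link_loop (M, w) (11 * (length (Es ! (e - 1)) - l) + 1) cells d (M', w) \<and>
    built u (start (Suc e)) M' \<and> M' (Edg, 0) = e \<and> M' (Ptr, 0) = start (Suc e)"
  using assms(1-3,5)
proof (induction "length (Es ! (e - 1)) - l" arbitrary: M l)
  case 0
  then have l: "start e + l = start (Suc e)" using start_Suc[OF e] by simp
  have I: "0 \<in> idx" "Suc e \<in> idx" using e by (auto simp: idx_def)
  have "M (Start, Suc e) = start (Suc e)" using 0 e by (simp add: built_def)
  then have "runs q link_loop (M, w) 1 cells d (M, w)"
    using 0 I l by (intro runs_WhileFalse) auto
  then show ?case using 0 l by (intro exI[of _ M]) simp
next
  case (Suc n)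
  then have l: "l < length (Es ! (e - 1))" by simp
  note at = incidence_at[OF e l]
  have I: "0 \<in> idx" "Suc e \<in> idx" using e by (auto simp: idx_def)
  have St: "M (Start, Suc e) = start e + length (Es ! (e - 1))"
    using Suc.prems(1) e start_Suc[OF e] by (simp add: built_def)
  obtain M1 where M1: "runs q link_body (M, w) 10 cells d (M1, w)" "built u (start e + Suc l) M1"
      "M1 (Edg, 0) = e" "M1 (Ptr, 0) = start e + Suc l"
    using link_body_correct[OF Suc.prems(1) _ Suc.prems(3) at(3), of q w d] Suc.prems(2) at(1) by auto
  have "n = length (Es ! (e - 1)) - Suc l" using Suc.hyps(2) by simp
  from Suc.hyps(1)[OF this M1(2-4)] l obtain M2 where
    M2: "runs q link_loop (M1, w) (11 * (length (Es ! (e - 1)) - Suc l) + 1) cells d (M2, w)"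
      "built u (start (Suc e)) M2" "M2 (Edg, 0) = e" "M2 (Ptr, 0) = start (Suc e)" by auto
  have "runs q link_loop (M, w) (Suc (10 + (11 * (length (Es ! (e - 1)) - Suc l) + 1))) cells d (M2, w)"
    by (rule runs_WhileTrue[OF _ _ M1(1) M2(1)]) (use Suc.prems St l I in auto)
  then have "runs q link_loop (M, w) (11 * (length (Es ! (e - 1)) - l) + 1) cells d (M2, w)"
    by (rule runs_mono) (use l in auto)
  with M2(2-4) show ?case by blast
qed

text \<open>The number \<open>Suc sz - start e\<close> of remaining positions telescopes over the
  hyperedges, so the nested loops take linear time altogether; the 6 covers the overhead of one
  hyperedge.\<close>

lemma edge_loop_correct:
  assumes "built (e - 1) (start e) M" "M (Edg, 0) = e" "M (Ptr, 0) = start e" "1 \<le> e" "e \<le> Suc m"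
  shows "\<exists>M'. runs q edge_loop (M, w) (6 * (Suc m - e) + 11 * (Suc sz - start e) + 1) cells d (M', w) \<and>
    built m (Suc sz) M'"
  using assms
proof (induction "Suc m - e" arbitrary: M e)
  case 0
  then have e: "e = Suc m" by simp
  have "M (NumEdges, 0) = m" using 0 by (simp add: built_def)
  then have "runs q edge_loop (M, w) 1 cells d (M, w)"
    using 0 e by (intro runs_WhileFalse) (auto simp: idx_facts)
  then show ?case using 0 e start_last by (intro exI[of _ M]) simp
next
  case (Suc n)
  then have e: "e \<in> {1..m}" by simp
  have Num: "M (NumEdges, 0) = m" using Suc.prems by (simp add: built_def)
  have I: "0 \<in> idx" "e \<in> idx" "e - 1 \<in> idx" using e by (auto simp: idx_def)
  let ?M = "M((UncovNext, e - 1) := e, (UncovPrev, e) := e - 1)"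
  have s1: "runs q (UncovNext\<langle>Dec (reg Edg)\<rangle> ::= reg Edg;; UncovPrev\<langle>reg Edg\<rangle> ::= Dec (reg Edg)) (M, w) 2 cells d (?M, w)"
    using I Suc.prems by (intro runs_straight') auto
  have "built e (start e + 0) ?M"
  proof -
    have "\<forall>j<e. ?M (UncovNext, j) = Suc j \<and> ?M (UncovPrev, Suc j) = j"
    proof (intro allI impI)
      fix j assume "j < e"
      then show "?M (UncovNext, j) = Suc j \<and> ?M (UncovPrev, Suc j) = j"
        using Suc.prems(1) e by (cases "j = e - 1") (auto simp: built_def)
    qed
    then show ?thesis using Suc.prems(1) by (simp add: built_def)
  qed
  from link_loop_correct[OF this _ _ e, of q w d] Suc.prems obtain M1 where
    M1: "runs q link_loop (?M, w) (11 * length (Es ! (e - 1)) + 1) cells d (M1, w)"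
      "built e (start (Suc e)) M1" "M1 (Edg, 0) = e" "M1 (Ptr, 0) = start (Suc e)" by auto
  let ?M1 = "M1((Edg, 0) := Suc e)"
  have s3: "runs q (Edg :== Inc (reg Edg)) (M1, w) 1 cells d (?M1, w)"
    using I M1(3) by (intro runs_straight') auto
  have body: "runs q edge_body (M, w) (2 + (11 * length (Es ! (e - 1)) + 1) + 1) cells d (?M1, w)"
    unfolding edge_body_def by (rule runs_Seq[OF runs_Seq[OF s1 M1(1)] s3])
  have "built (Suc e - 1) (start (Suc e)) ?M1" using built_cong[OF M1(2), of ?M1] by simp
  moreover have "n = Suc m - Suc e" using Suc.hyps(2) by simp
  ultimately obtain M2 where
    M2: "runs q edge_loop (?M1, w) (6 * (Suc m - Suc e) + 11 * (Suc sz - start (Suc e)) + 1) cells d (M2, w)"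
      "built m (Suc sz) M2"
    using Suc.hyps(1)[of "Suc e" ?M1] M1(4) e by auto
  have "runs q edge_loop (M, w) (Suc ((2 + (11 * length (Es ! (e - 1)) + 1) + 1) +
      (6 * (Suc m - Suc e) + 11 * (Suc sz - start (Suc e)) + 1))) cells d (M2, w)"
    by (rule runs_WhileTrue[OF _ _ body M2(1)]) (use Suc.prems Num e I in auto)
  moreover have "start (Suc e) = start e + length (Es ! (e - 1))" "start (Suc e) \<le> Suc sz"
    using start_Suc[OF e] start_le[of "Suc e"] e by auto
  ultimately have "runs q edge_loop (M, w) (6 * (Suc m - e) + 11 * (Suc sz - start e) + 1) cells d (M2, w)"
    using e by (auto elim!: runs_mono)
  with M2(2) show ?case by blast
qed

lemma nxt_interval: "j \<le> m \<Longrightarrow> nxt {Suc 0..m} j = (if j < m then Suc j else 0)"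
proof -
  interpret node_set "{Suc 0..m}" by unfold_locales auto
  show "j \<le> m \<Longrightarrow> ?thesis" by (auto simp: nxt_iff)
qed

lemma prv_interval: "j \<le> m \<Longrightarrow> prv {Suc 0..m} j = (if j = 0 then m else j - 1)"
proof -
  interpret node_set "{Suc 0..m}" by unfold_locales auto
  show "j \<le> m \<Longrightarrow> ?thesis" by (auto simp: prv_iff)
qed

lemma build_lists_correct:
  "\<exists>M. runs q build_lists (input_mem Es, w) (6 * m + 11 * sz + 10) cells d (M, w) \<and> entered [] M"
proof -
  let ?M = "(input_mem Es)((Edg, 0) := 1, (Ptr, 0) := 1)"
  have s1: "runs q (Edg :== N 1;; Ptr :== N 1) (input_mem Es, w) 2 cells d (?M, w)"
    by (intro runs_straight') (auto simp: idx_facts)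
  have "built 0 1 ?M"
    using elt_at_eq by (auto simp: built_def input_mem_def m_def start_def sz_eq occs_def)
  then obtain M1 where M1: "runs q edge_loop (?M, w) (6 * m + 11 * sz + 1) cells d (M1, w)" "built m (Suc sz) M1"
    using edge_loop_correct[of 1 ?M q w d] by (auto simp: start_1[simplified])
  \<comment> \<open>These writes close the chain 0, 1, ..., m into a cycle; for m = 0 the sentinel
    points to itself.\<close>
  let ?M2 = "M1((UncovNext, m) := 0, (UncovPrev, 0) := m, (Level, 0) := 0)"
  have Num: "M1 (NumEdges, 0) = m" using M1(2) by (simp add: built_def)
  have I: "0 \<in> idx" "m \<in> idx" by (auto simp: idx_def)
  have s2: "runs q (UncovNext\<langle>reg NumEdges\<rangle> ::= N 0) (M1, w) 1 cells d (M1((UncovNext, m) := 0), w)"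
    using I Num by (intro runs_straight') auto
  have s3: "runs q (UncovPrev\<langle>N 0\<rangle> ::= reg NumEdges) (M1((UncovNext, m) := 0), w) 1 cells d
      (M1((UncovNext, m) := 0, (UncovPrev, 0) := m), w)"
    using I Num by (intro runs_straight') auto
  have s4: "runs q (Level :== N 0) (M1((UncovNext, m) := 0, (UncovPrev, 0) := m), w) 1 cells d (?M2, w)"
    using I by (intro runs_straight') auto
  have "runs q build_lists (input_mem Es, w) (2 + (6 * m + 11 * sz + 1) + 1 + 1 + 1) cells d (?M2, w)"
    unfolding build_lists_eq by (intro runs_Seq) (rule s1, rule M1(1), rule s2, rule s3, rule s4)
  then have "runs q build_lists (input_mem Es, w) (6 * m + 11 * sz + 10) cells d (?M2, w)"
    by (rule runs_mono) auto
  moreover have "entered [] ?M2"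
  proof -
    have "static ?M2" using M1(2) by (simp add: static_def built_def)
    moreover have "repr m (chosen []) ?M2"
    proof -
      have X: "chosen [] j = []" for j by (simp add: chosen_def)
      then have U: "uncovered m (chosen []) = {1..m}" "owned m (chosen []) u = {}" for u
        by (auto simp: uncovered_def owned_def)
      have n: "?M2 (UncovNext, j) = nxt {1..m} j" if "j \<le> m" for j
        using M1(2) that nxt_interval[OF that] by (auto simp: built_def)
      have p: "?M2 (UncovPrev, j) = prv {1..m} j" if "j \<le> m" for j
        using M1(2) that prv_interval[OF that] by (cases j) (auto simp: built_def)
      have "\<forall>j\<in>insert 0 {1..m}. ?M2 (UncovNext, j) = nxt {1..m} j"
        "\<forall>j\<in>insert 0 {1..m}. ?M2 (UncovPrev, j) = prv {1..m} j"
        by (intro ballI n p; force)+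
      moreover have "\<forall>j\<in>{1..m}. ?M2 (Cover, j) = length ([] :: nat list)" "\<forall>u. ?M2 (CritFirst, u) = nxt {} 0"
        using M1(2) by (simp_all add: built_def nxt_0)
      ultimately show ?thesis unfolding repr_def U X by blast
    qed
    ultimately show ?thesis by (simp add: entered_def)
  qed
  ultimately show ?thesis by blast
qed

lemma card_names: "finite (UNIV :: name set)" "card (UNIV :: name set) \<le> 25"
proof -
  let ?ns = "[NumEdges, Start, Elt, EdgeOf, IncFirst, IncLast, IncNext, IncPrev, UncovNext, UncovPrev,
    CritFirst, CritNext, CritPrev, Cover, Owner, Level, Chosen, Index, Pos, Edg, Cnt, Ptr, Occ, Vtx, Ok]"
  have U: "UNIV = set ?ns" by (rule UNIV_eq_I) (case_tac x; simp)
  show "finite (UNIV :: name set)" unfolding U by simp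
  show "card (UNIV :: name set) \<le> 25" unfolding U using card_length[of ?ns] by simp
qed

text \<open>Space is 25 arrays times the usable indices, plus a call depth of at most
  \<open>card verts + 1\<close>, which is at most sz + 1.\<close>

lemma RS_main_correct:
  "\<exists>time space outs. RS_run Es time space outs \<and> (\<forall>xs\<in>set outs. distinct xs) \<and> RS Fs {} (map set outs) \<and>
     time \<le> 6 * m + 11 * sz + 11 + cost {} \<and> space \<le> 25 * (m + 2 * sz + 3) + sz + 1"
proof -
  let ?d = "Suc (card verts)"
  obtain M where M: "runs RS_body build_lists (input_mem Es, []) (6 * m + 11 * sz + 10) cells ?d (M, [])" "entered [] M"
    using build_lists_correct by blast
  obtain outs M' where M': "runs RS_body RS_body (M, []) (cost {}) cells (card verts) (M', tape_of outs)"
    "\<forall>xs\<in>set outs. distinct xs" "RS Fs {} (map set outs)"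
  proof -
    have "calls_correct []" by (rule RS_body_correct) auto
    note this[unfolded calls_correct_def, rule_format, OF M(2), of "[]"]
    then show ?thesis using that by auto
  qed
  have "runs RS_body RS_main (input_mem Es, []) (6 * m + 11 * sz + 10 + Suc (cost {})) cells ?d (M', tape_of outs)"
    unfolding RS_main_def by (rule runs_Seq[OF M(1) runs_Call[OF M'(1)]])
  then obtain n A d where run: "exec RS_body RS_main (input_mem Es, []) n A d (M', tape_of outs)"
    "n \<le> 6 * m + 11 * sz + 10 + Suc (cost {})" "A \<subseteq> cells" "d \<le> ?d" by (auto simp: runs_def)
  have "card A \<le> card cells" using run(3) card_names(1) by (intro card_mono) auto
  also have "\<dots> = card (UNIV :: name set) * card idx" by (simp add: card_cartesian_product)
  also have "\<dots> \<le> 25 * (m + 2 * sz + 3)" using card_names(2) card_idx by (rule mult_le_mono)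
  finally have "exec_space A d \<le> 25 * (m + 2 * sz + 3) + sz + 1"
    using run(4) card_verts by (simp add: exec_space_def)
  moreover have "RS_run Es n (exec_space A d) outs" using run(1) by (auto simp: RS_run_def)
  ultimately show ?thesis using run(2) M'(2,3) by (intro exI[of _ n] exI[of _ "exec_space A d"] exI[of _ outs]) simp
qed

text \<open>Each nonempty hyperedge occupies a position, so terms linear in m are absorbed by the
  total size.\<close>

lemma nonempty_edges_le:
  assumes "{} \<notin> set Fs"
  shows "m \<le> sz"
proof -
  have "list_all2 (\<lambda>xs F. distinct xs \<and> set xs = F) Es Fs" using enum by (simp add: enumerates_def)
  then have "length Es \<le> length (concat Es)" using assms
  proof (induction rule: list_all2_induct)
    case (Cons x xs y ys)
    then have "x \<noteq> []" by auto
    then have "1 \<le> length x" by (cases x) auto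
    with Cons show ?case by simp
  qed simp
  then show ?thesis by (simp add: m_def sz_eq)
qed

end

text \<open>The product bound presupposes a nonempty family of nonempty hyperedges. For an empty
  family, or if F_1 is empty, no prefix has a minimal hitting set and the product is 0 although the
  machine takes steps; many empty hyperedges also make the input longer than its total size. The
  bounds with added terms cover these cases. As execution is deterministic, the asserted run is the
  only one.\<close>

theorem theorem1:
  "\<exists>C::nat. \<forall>(V::nat set) (Fs::nat set list).
     hypergraph V Fs \<longrightarrow>
       (\<forall>outs. RS Fs {} outs \<longrightarrow> distinct outs \<and> set outs = dual V Fs) \<and>
       (\<forall>Es. enumerates Es Fs \<longrightarrow>
         (\<exists>time space outs.
            RS_run Es time space outs \<and>
            (\<forall>xs\<in>set outs. distinct xs) \<and>
            RS Fs {} (map set outs) \<and>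
            (Fs \<noteq> [] \<and> {} \<notin> set Fs \<longrightarrow>
               time \<le> C * (total_size Fs * card (prefix_duals V Fs)) \<and>
               space \<le> C * total_size Fs) \<and>
            time \<le> C * ((total_size Fs + length Fs + 1) * (card (prefix_duals V Fs) + 1)) \<and>
            space \<le> C * (total_size Fs + length Fs + 1)))"
proof (rule exI[of _ 1000], intro allI impI conjI)
  fix V :: "nat set" and Fs :: "nat set list" and outs
  assume V: "hypergraph V Fs" and "RS Fs {} outs"
  then show "distinct outs" "set outs = dual V Fs" using RS_outputs_dual by blast+
next
  fix V :: "nat set" and Fs :: "nat set list" and Es
  assume V: "hypergraph V Fs" and "enumerates Es Fs"
  then interpret encoded Es Fs by unfold_locales
  let ?P = "card (prefix_duals V Fs)"
  obtain time space outs where run: "RS_run Es time space outs" "\<forall>xs\<in>set outs. distinct xs"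
      "RS Fs {} (map set outs)"
    and time: "time \<le> 6 * m + 11 * sz + 11 + cost {}" and space: "space \<le> 25 * (m + 2 * sz + 3) + sz + 1"
    using RS_main_correct by blast
  \<comment> \<open>Naming the products leaves inequalities that are linear in a, b and c.\<close>
  define a b c where "a = (sz + 1) * (?P + 1)" "b = (sz + m + 1) * (?P + 1)" "c = sz * ?P"
  note abc = this
  have "cost {} \<le> 100 * (sz + 1) * (?P + 1)"
    unfolding cost_def by (intro mult_le_mono2 card_descendants V)
  with time have time: "time \<le> 6 * m + 11 * sz + 11 + 100 * a"
    unfolding abc mult.assoc by linarith
  have "sz + m + 1 \<le> b" unfolding abc by simp
  moreover have "a \<le> b" unfolding abc by (intro mult_le_mono1) simp
  ultimately have "time \<le> 1000 * b" using time by linarith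
  moreover have "space \<le> 1000 * (sz + m + 1)" using space by simp
  \<comment> \<open>Here \<open>sz\<close> and \<open>?P\<close> are at least 1, so a \<le> 4c and
    the linear terms are at most 28c, giving 428c for the time; space is at most
    \<open>152 * sz\<close>. The constant 1000 is a round number above both.\<close>
  moreover have "time \<le> 1000 * c \<and> space \<le> 1000 * sz" if ne: "Fs \<noteq> []" "{} \<notin> set Fs"
  proof -
    have P: "1 \<le> ?P" using prefix_duals_nonempty[OF V ne] .
    have m: "m \<le> sz" using nonempty_edges_le[OF ne(2)] .
    have "1 \<le> m" using ne(1) length_Fs by (cases Fs) auto
    with m have sz: "1 \<le> sz" by simp
    have "sz \<le> c" unfolding abc using P by simp
    moreover have "a \<le> (2 * sz) * (2 * ?P)" unfolding abc using P sz by (intro mult_le_mono) simp_all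
    then have "a \<le> 4 * c" by (simp add: abc)
    ultimately have "time \<le> 1000 * c" using time m sz by linarith
    then show ?thesis using space m sz by simp
  qed
  ultimately show "\<exists>time space outs.
            RS_run Es time space outs \<and>
            (\<forall>xs\<in>set outs. distinct xs) \<and>
            RS Fs {} (map set outs) \<and>
            (Fs \<noteq> [] \<and> {} \<notin> set Fs \<longrightarrow>
               time \<le> 1000 * (total_size Fs * ?P) \<and>
               space \<le> 1000 * total_size Fs) \<and>
            time \<le> 1000 * ((total_size Fs + length Fs + 1) * (?P + 1)) \<and>
            space \<le> 1000 * (total_size Fs + length Fs + 1)"
    unfolding total_size_eq length_Fs abc using run by blast
qed

end
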